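(* Let $c=\sum_{A\in\Theta(n,r)}x_A[A]$ (with $x_A\in K$) be an element of the center $Z(\boldsymbol{\mathcal S}_q(n,r))$ of the $q$-Schur algebra $\boldsymbol{\mathcal S}_q(n,r)$. Then $x_A=0$ unless $A\in\Omega(n,r)$, i.e. unless $\operatorname{ro}(A)=\operatorname{co}(A)$. Hence $$Z(\boldsymbol{\mathcal S}_q(n,r))\subseteq \operatorname{Span}_K\{[A]\mid A\in\Omega(n,r)\}.$$
   Context: Let $\upsilon$ be an indeterminate, $q=\upsilon^2$, $\mathcal A=\mathbb Z[\upsilon,\upsilon^{-1}]$, $K=\mathbb Q(\upsilon)$, $\mathbb N=\{0,1,2,\dots\}$. Hecke algebra: $\mathcal H_{\mathcal A}(r)$ is the Hecke algebra over $\mathcal A$ of the symmetric group $\mathfrak S_r=\langle s_1,\dots,s_{r-1}\rangle$, generated by $T_i=T_{s_i}$ ($1\le i<r$) with $T_i^2=(q-1)T_i+q$, $T_iT_{i+1}T_i=T_{i+1}T_iT_{i+1}$, and $T_iT_j=T_jT_i$ for $|i-j|>1$. $q$-Schur algebra of type $A$: let $\Lambda(n,r)=\{\lambda\in\mathbb N^n\mid \sum_i\lambda_i=r\}$; for $\lambda\in\Lambda(n,r)$ let $\mathfrak S_\lambda$ be the Young subgroup and $x_\lambda=\sum_{w\in\mathfrak S_\lambda}T_w$. Put $\mathcal S_q(n,r)=\operatorname{End}_{\mathcal H_{\mathcal A}(r)}\big(\bigoplus_{\lambda\in\Lambda(n,r)}x_\lambda\mathcal H_{\mathcal A}(r)\big)$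 and $\boldsymbol{\mathcal S}_q(n,r)=K\otimes_{\mathcal A}\mathcal S_q(n,r)$. Normalized BLM basis: $\Theta(n,r)$ is the set of $n\times n$ matrices $A=(a_{ij})$ over $\mathbb N$ with $\sum_{i,j}a_{ij}=r$; $\operatorname{ro}(A)$ and $\operatorname{co}(A)$ are the vectors of row sums and column sums. If $\operatorname{ro}(A)=\lambda$, $\operatorname{co}(A)=\mu$, then $A$ corresponds to the double coset $D_A=\mathfrak S_\lambda w\mathfrak S_\mu$ with $a_{ij}=|R^\lambda_i\cap wR^\mu_j|$, where $R^\lambda_1,\dots,R^\lambda_n$ are the consecutive blocks of $\{1,\dots,r\}$ of sizes $\lambda_1,\dots,\lambda_n$. Let $e_A\in\mathcal S_q(n,r)$ be given by $e_A(x_\nu h)=\delta_{\nu,\mu}\sum_{w\in D_A}T_wh$, and put $[A]=\upsilon^{-d_A}e_A$ with $d_A=\sum_{i\ge k,\ j<l}a_{ij}a_{kl}$. The set $\{[A]\mid A\in\Theta(n,r)\}$ is a $K$-basis of $\boldsymbol{\mathcal S}_q(n,r)$. Balanced matrices: $\Omega(n,r)=\{A\in\Theta(n,r)\mid \operatorname{ro}(A)=\operatorname{co}(A)\}$. *)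

theory Defs
  imports
    "HOL-Algebra.Generated_Rings"
    "HOL-Algebra.IntRing"
    "HOL-Algebra.Module"
    "HOL-Algebra.QuotRing"
    "HOL-Algebra.Sym_Groups"
    "HOL-Computational_Algebra.Fraction_Field"
    "HOL-Computational_Algebra.Polynomial"
    "Jordan_Normal_Form.Matrix"
begin

section \<open>Algebras over a commutative ring\<close>

text \<open>
  An algebra over \<open>R\<close> is given by a record of type \<^typ>\<open>('r, 'a) module\<close>: a ring
  (in general not commutative) with a scalar multiplication.
\<close>

text \<open>
  The monoid algebra \<open>R[M]\<close>: finitely supported functions \<open>M \<rightarrow> R\<close> with convolution.
\<close>

definition monoid_algebra ::
  "('r, 'x) ring_scheme \<Rightarrow> ('m, 'y) monoid_scheme \<Rightarrow> ('r, 'm \<Rightarrow> 'r) module"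
where
  "monoid_algebra R M =
    \<lparr> carrier = {f. (\<forall>m. f m \<in> carrier R) \<and> (\<forall>m. m \<notin> carrier M \<longrightarrow> f m = \<zero>\<^bsub>R\<^esub>)
                    \<and> finite {m. f m \<noteq> \<zero>\<^bsub>R\<^esub>}},
      monoid.mult = (\<lambda>f g m. \<Oplus>\<^bsub>R\<^esub>p \<in> {(a, b). f a \<noteq> \<zero>\<^bsub>R\<^esub> \<and> g b \<noteq> \<zero>\<^bsub>R\<^esub> \<and> a \<otimes>\<^bsub>M\<^esub> b = m}.
                        f (fst p) \<otimes>\<^bsub>R\<^esub> g (snd p)),
      one = (\<lambda>m. if m = \<one>\<^bsub>M\<^esub> then \<one>\<^bsub>R\<^esub> else \<zero>\<^bsub>R\<^esub>),
      ring.zero = (\<lambda>m. \<zero>\<^bsub>R\<^esub>),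
      ring.add = (\<lambda>f g m. f m \<oplus>\<^bsub>R\<^esub> g m),
      module.smult = (\<lambda>a f m. a \<otimes>\<^bsub>R\<^esub> f m) \<rparr>"

definition single :: "('r, 'x) ring_scheme \<Rightarrow> 'm \<Rightarrow> 'm \<Rightarrow> 'r" where
  "single R m = (\<lambda>m'. if m' = m then \<one>\<^bsub>R\<^esub> else \<zero>\<^bsub>R\<^esub>)"

definition free_monoid :: "'a set \<Rightarrow> 'a list monoid" where
  "free_monoid S = \<lparr> carrier = lists S, monoid.mult = (@), one = [] \<rparr>"

text \<open>
  The tensor product \<open>B \<otimes>\<^sub>A C\<close> of two \<open>A\<close>-algebras, as the free abelian group on
  \<open>B \<times> C\<close> modulo the bilinearity and balancing relations. The free abelian group is taken with
  its ring structure \<open>(b, c) (b', c') = (bb', cc')\<close>, i.e. as \<open>\<int>[B \<times> C]\<close>. The additive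
  subgroup generated by the relations is stable under left and right multiplication by every
  \<open>(b, c)\<close>, hence it equals the two-sided ideal generated by them.
\<close>

definition tensor_free :: "('a, 'b, 'x) module_scheme \<Rightarrow> ('a, 'c, 'y) module_scheme
    \<Rightarrow> (int, 'b \<times> 'c \<Rightarrow> int) module" where
  "tensor_free B C = monoid_algebra \<Z> (B \<times>\<times> C)"

definition tensor_rels :: "('a, 'z) ring_scheme \<Rightarrow> ('a, 'b, 'x) module_scheme
    \<Rightarrow> ('a, 'c, 'y) module_scheme \<Rightarrow> ('b \<times> 'c \<Rightarrow> int) set" where
  "tensor_rels A B C = (let F = tensor_free B C; g = (\<lambda>b c. single \<Z> (b, c)) in
      {g (b \<oplus>\<^bsub>B\<^esub> b') c \<ominus>\<^bsub>F\<^esub> (g b c \<oplus>\<^bsub>F\<^esub> g b' c) | b b' c.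
         b \<in> carrier B \<and> b' \<in> carrier B \<and> c \<in> carrier C}
    \<union> {g b (c \<oplus>\<^bsub>C\<^esub> c') \<ominus>\<^bsub>F\<^esub> (g b c \<oplus>\<^bsub>F\<^esub> g b c') | b c c'.
         b \<in> carrier B \<and> c \<in> carrier C \<and> c' \<in> carrier C}
    \<union> {g (a \<odot>\<^bsub>B\<^esub> b) c \<ominus>\<^bsub>F\<^esub> g b (a \<odot>\<^bsub>C\<^esub> c) | a b c.
         a \<in> carrier A \<and> b \<in> carrier B \<and> c \<in> carrier C})"

definition tensor_ideal :: "('a, 'z) ring_scheme \<Rightarrow> ('a, 'b, 'x) module_scheme
    \<Rightarrow> ('a, 'c, 'y) module_scheme \<Rightarrow> ('b \<times> 'c \<Rightarrow> int) set" where
  "tensor_ideal A B C = Idl\<^bsub>tensor_free B C\<^esub> (tensor_rels A B C)"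

definition pure_tensor :: "('a, 'z) ring_scheme \<Rightarrow> ('a, 'b, 'x) module_scheme
    \<Rightarrow> ('a, 'c, 'y) module_scheme \<Rightarrow> 'b \<Rightarrow> 'c \<Rightarrow> ('b \<times> 'c \<Rightarrow> int) set" where
  "pure_tensor A B C b c = tensor_ideal A B C +>\<^bsub>tensor_free B C\<^esub> single \<Z> (b, c)"

text \<open>The tensor product is regarded as an algebra over its left factor \<open>B\<close>.\<close>

definition tensor_algebra :: "('a, 'z) ring_scheme \<Rightarrow> ('a, 'b, 'x) module_scheme
    \<Rightarrow> ('a, 'c, 'y) module_scheme \<Rightarrow> ('b, ('b \<times> 'c \<Rightarrow> int) set) module" where
  "tensor_algebra A B C = (let Q = tensor_free B C Quot tensor_ideal A B C in
     ring.extend Q (module.fields (\<lambda>b t. pure_tensor A B C b \<one>\<^bsub>C\<^esub> \<otimes>\<^bsub>Q\<^esub> t)))"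

definition ring_center :: "('a, 'x) ring_scheme \<Rightarrow> 'a set" where
  "ring_center R = {c \<in> carrier R. \<forall>d \<in> carrier R. c \<otimes>\<^bsub>R\<^esub> d = d \<otimes>\<^bsub>R\<^esub> c}"

definition lin_span :: "('r, 'z) ring_scheme \<Rightarrow> ('r, 'a, 'x) module_scheme \<Rightarrow> 'a set \<Rightarrow> 'a set"
where
  "lin_span R M S = {\<Oplus>\<^bsub>M\<^esub>b \<in> F. x b \<odot>\<^bsub>M\<^esub> b | F x. finite F \<and> F \<subseteq> S \<and> x \<in> F \<rightarrow> carrier R}"


section \<open>The ground rings\<close>

type_synonym ratfun = "rat poly fract"

definition KK :: "(ratfun, ratfun) module" where
  "KK = \<lparr> carrier = UNIV, monoid.mult = (*), one = 1, ring.zero = 0, ring.add = (+),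
          module.smult = (*) \<rparr>"

definition upsilon :: ratfun where
  "upsilon = Fraction_Field.Fract [:0, 1:] 1"

definition qq :: ratfun where
  "qq = upsilon ^ 2"

text \<open>\<open>\<int>[\<upsilon>, \<upsilon>\<^sup>-\<^sup>1]\<close>, as a subring of \<open>\<rat>(\<upsilon>)\<close>.\<close>

definition AA :: "(ratfun, ratfun) module" where
  "AA = KK \<lparr> carrier := generate_ring KK {upsilon, inverse upsilon} \<rparr>"


section \<open>The Hecke algebra of the symmetric group\<close>

type_synonym hecke_elt = "(nat list \<Rightarrow> ratfun) set"

definition hecke_free :: "nat \<Rightarrow> (ratfun, nat list \<Rightarrow> ratfun) module" where
  "hecke_free r = monoid_algebra AA (free_monoid {1..<r})"

definition hecke_rels :: "nat \<Rightarrow> (nat list \<Rightarrow> ratfun) set" where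
  "hecke_rels r = (let F = hecke_free r; t = (\<lambda>i. single AA [i]) in
      {t i \<otimes>\<^bsub>F\<^esub> t i \<ominus>\<^bsub>F\<^esub> ((qq - 1) \<odot>\<^bsub>F\<^esub> t i \<oplus>\<^bsub>F\<^esub> qq \<odot>\<^bsub>F\<^esub> \<one>\<^bsub>F\<^esub>) | i. i \<in> {1..<r}}
    \<union> {t i \<otimes>\<^bsub>F\<^esub> t (i + 1) \<otimes>\<^bsub>F\<^esub> t i \<ominus>\<^bsub>F\<^esub> t (i + 1) \<otimes>\<^bsub>F\<^esub> t i \<otimes>\<^bsub>F\<^esub> t (i + 1) | i.
         i \<in> {1..<r} \<and> i + 1 \<in> {1..<r}}
    \<union> {t i \<otimes>\<^bsub>F\<^esub> t j \<ominus>\<^bsub>F\<^esub> t j \<otimes>\<^bsub>F\<^esub> t i | i j.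
         i \<in> {1..<r} \<and> j \<in> {1..<r} \<and> (i + 1 < j \<or> j + 1 < i)})"

definition hecke_ideal :: "nat \<Rightarrow> (nat list \<Rightarrow> ratfun) set" where
  "hecke_ideal r = Idl\<^bsub>hecke_free r\<^esub> (hecke_rels r)"

definition hecke :: "nat \<Rightarrow> (ratfun, hecke_elt) module" where
  "hecke r = (let F = hecke_free r; Q = F Quot hecke_ideal r in
     ring.extend Q
       (module.fields (\<lambda>a h. (hecke_ideal r +>\<^bsub>F\<^esub> (a \<odot>\<^bsub>F\<^esub> \<one>\<^bsub>F\<^esub>)) \<otimes>\<^bsub>Q\<^esub> h)))"

text \<open>The permutation \<open>s\<^sub>i \<circ> s\<^sub>j \<circ> \<dots>\<close> given by a word \<open>[i, j, \<dots>]\<close>.\<close>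

definition word_perm :: "nat list \<Rightarrow> nat \<Rightarrow> nat" where
  "word_perm ws = foldr (\<circ>) (map (\<lambda>i. Transposition.transpose i (i + 1)) ws) id"

definition reduced_word :: "nat \<Rightarrow> (nat \<Rightarrow> nat) \<Rightarrow> nat list" where
  "reduced_word r w = arg_min length (\<lambda>ws. ws \<in> lists {1..<r} \<and> word_perm ws = w)"

text \<open>
  \<open>T\<^sub>w = T\<^sub>i T\<^sub>j \<dots>\<close> for a reduced expression \<open>w = s\<^sub>i s\<^sub>j \<dots>\<close>; by Matsumoto's theorem
  the choice of the reduced expression does not matter.
\<close>

definition hecke_T :: "nat \<Rightarrow> (nat \<Rightarrow> nat) \<Rightarrow> hecke_elt" where
  "hecke_T r w = hecke_ideal r +>\<^bsub>hecke_free r\<^esub> single AA (reduced_word r w)"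


section \<open>Compositions, matrices and double cosets\<close>

text \<open>Entries of vectors and matrices are indexed from \<open>0\<close>, whereas \<open>\<SS>\<^sub>r\<close> acts on \<open>{1..r}\<close>.\<close>

definition Lambda :: "nat \<Rightarrow> nat \<Rightarrow> nat vec set" where
  "Lambda n r = {l \<in> carrier_vec n. (\<Sum>i<n. l $ i) = r}"

definition Theta :: "nat \<Rightarrow> nat \<Rightarrow> nat mat set" where
  "Theta n r = {A \<in> carrier_mat n n. (\<Sum>i<n. \<Sum>j<n. A $$ (i, j)) = r}"

definition ro :: "nat mat \<Rightarrow> nat vec" where
  "ro A = vec (dim_row A) (\<lambda>i. \<Sum>j<dim_col A. A $$ (i, j))"

definition co :: "nat mat \<Rightarrow> nat vec" where
  "co A = vec (dim_col A) (\<lambda>j. \<Sum>i<dim_row A. A $$ (i, j))"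

definition Omega :: "nat \<Rightarrow> nat \<Rightarrow> nat mat set" where
  "Omega n r = {A \<in> Theta n r. ro A = co A}"

definition block :: "nat vec \<Rightarrow> nat \<Rightarrow> nat set" where
  "block l i = {(\<Sum>j<i. l $ j) <.. (\<Sum>j\<le>i. l $ j)}"

definition young_subgroup :: "nat \<Rightarrow> nat vec \<Rightarrow> (nat \<Rightarrow> nat) set" where
  "young_subgroup r l =
     {w \<in> carrier (sym_group r). \<forall>i < dim_vec l. w ` block l i = block l i}"

definition double_coset :: "nat \<Rightarrow> nat mat \<Rightarrow> (nat \<Rightarrow> nat) set" where
  "double_coset r A = (THE D. \<exists>w \<in> carrier (sym_group r).
      (\<forall>i < dim_row A. \<forall>j < dim_col A.
         A $$ (i, j) = card (block (ro A) i \<inter> w ` block (co A) j)) \<and>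
      D = (young_subgroup r (ro A) #>\<^bsub>sym_group r\<^esub> w)
            <#>\<^bsub>sym_group r\<^esub> young_subgroup r (co A))"


section \<open>The q-Schur algebra\<close>

type_synonym schur_mod_elt = "nat vec \<Rightarrow> hecke_elt"
type_synonym schur_elt = "schur_mod_elt \<Rightarrow> schur_mod_elt"

definition x_elt :: "nat \<Rightarrow> nat vec \<Rightarrow> hecke_elt" where
  "x_elt r l = (\<Oplus>\<^bsub>hecke r\<^esub>w \<in> young_subgroup r l. hecke_T r w)"

text \<open>
  The right module \<open>\<Oplus>\<^sub>\<lambda> x\<^sub>\<lambda> H\<close> over the Hecke algebra \<open>H\<close>; the index set \<^term>\<open>Lambda n r\<close>
  is finite, so the direct sum consists of all families.
\<close>

definition schur_mod :: "nat \<Rightarrow> nat \<Rightarrow> schur_mod_elt set" where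
  "schur_mod n r = (\<Pi>\<^sub>E l \<in> Lambda n r. x_elt r l <#\<^bsub>hecke r\<^esub> carrier (hecke r))"

definition schur_mod_add ::
  "nat \<Rightarrow> nat \<Rightarrow> schur_mod_elt \<Rightarrow> schur_mod_elt \<Rightarrow> schur_mod_elt" where
  "schur_mod_add n r m m' = (\<lambda>l \<in> Lambda n r. m l \<oplus>\<^bsub>hecke r\<^esub> m' l)"

definition schur_mod_act ::
  "nat \<Rightarrow> nat \<Rightarrow> schur_mod_elt \<Rightarrow> hecke_elt \<Rightarrow> schur_mod_elt" where
  "schur_mod_act n r m h = (\<lambda>l \<in> Lambda n r. m l \<otimes>\<^bsub>hecke r\<^esub> h)"

text \<open>The element \<open>h\<close> of the summand indexed by \<open>l\<close>.\<close>

definition schur_mod_inj :: "nat \<Rightarrow> nat \<Rightarrow> nat vec \<Rightarrow> hecke_elt \<Rightarrow> schur_mod_elt" where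
  "schur_mod_inj n r l h = (\<lambda>k \<in> Lambda n r. if k = l then h else \<zero>\<^bsub>hecke r\<^esub>)"

definition schur :: "nat \<Rightarrow> nat \<Rightarrow> (ratfun, schur_elt) module" where
  "schur n r =
    \<lparr> carrier = {f \<in> schur_mod n r \<rightarrow>\<^sub>E schur_mod n r.
        (\<forall>m \<in> schur_mod n r. \<forall>m' \<in> schur_mod n r.
           f (schur_mod_add n r m m') = schur_mod_add n r (f m) (f m')) \<and>
        (\<forall>m \<in> schur_mod n r. \<forall>h \<in> carrier (hecke r).
           f (schur_mod_act n r m h) = schur_mod_act n r (f m) h)},
      monoid.mult = (\<lambda>f g. compose (schur_mod n r) f g),
      one = (\<lambda>m \<in> schur_mod n r. m),
      ring.zero = (\<lambda>m \<in> schur_mod n r. \<lambda>l \<in> Lambda n r. \<zero>\<^bsub>hecke r\<^esub>),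
      ring.add = (\<lambda>f g. \<lambda>m \<in> schur_mod n r. schur_mod_add n r (f m) (g m)),
      module.smult = (\<lambda>a f. \<lambda>m \<in> schur_mod n r. \<lambda>l \<in> Lambda n r. a \<odot>\<^bsub>hecke r\<^esub> f m l) \<rparr>"

definition e_elt :: "nat \<Rightarrow> nat \<Rightarrow> nat mat \<Rightarrow> schur_elt" where
  "e_elt n r A = (THE f. f \<in> carrier (schur n r) \<and>
     (\<forall>l \<in> Lambda n r. \<forall>h \<in> carrier (hecke r).
        f (schur_mod_inj n r l (x_elt r l \<otimes>\<^bsub>hecke r\<^esub> h)) =
          schur_mod_inj n r (ro A)
            (if l = co A
             then (\<Oplus>\<^bsub>hecke r\<^esub>w \<in> double_coset r A. hecke_T r w) \<otimes>\<^bsub>hecke r\<^esub> h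
             else \<zero>\<^bsub>hecke r\<^esub>)))"

definition d_exp :: "nat mat \<Rightarrow> nat" where
  "d_exp A = (\<Sum>i<dim_row A. \<Sum>k\<le>i. \<Sum>l<dim_col A. \<Sum>j<l. A $$ (i, j) * A $$ (k, l))"

definition blm :: "nat \<Rightarrow> nat \<Rightarrow> nat mat \<Rightarrow> schur_elt" where
  "blm n r A = inverse upsilon ^ d_exp A \<odot>\<^bsub>schur n r\<^esub> e_elt n r A"

definition schur_K :: "nat \<Rightarrow> nat \<Rightarrow> (ratfun, (ratfun \<times> schur_elt \<Rightarrow> int) set) module" where
  "schur_K n r = tensor_algebra AA KK (schur n r)"

definition blm_K :: "nat \<Rightarrow> nat \<Rightarrow> nat mat \<Rightarrow> (ratfun \<times> schur_elt \<Rightarrow> int) set" where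
  "blm_K n r A = pure_tensor AA KK (schur n r) 1 (blm n r A)"

end

theory Submission
  imports Defs
begin

text \<open>
  For a composition \<open>\<lambda>\<close> let \<open>1\<^sub>\<lambda>\<close> be the projection of \<open>\<Oplus>\<^sub>\<mu> x\<^sub>\<mu> H\<close> onto the summand \<open>x\<^sub>\<lambda> H\<close>. If \<open>c\<close> is
  central and \<open>\<lambda> \<noteq> \<mu>\<close>, then \<open>1\<^sub>\<lambda> c 1\<^sub>\<mu> = c 1\<^sub>\<lambda> 1\<^sub>\<mu> = 0\<close>. On the other hand \<open>1\<^sub>\<lambda> [A] 1\<^sub>\<mu>\<close> is \<open>[A]\<close> if
  \<open>ro A = \<lambda>\<close> and \<open>co A = \<mu>\<close>, and \<open>0\<close> otherwise. Hence the part of \<open>c\<close> supported on the matrices with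
  \<open>ro A = \<lambda>\<close> and \<open>co A = \<mu>\<close> vanishes. The two assertions of the theorem therefore rest on the linear
  independence and on the spanning property of the \<open>[A]\<close> over \<open>K\<close>.

  Independence. The functional \<open>coord \<lambda> \<mu> w\<close> reads off the coefficient of \<open>T\<^sub>w\<close> in the \<open>\<lambda>\<close>-component of
  \<open>f (x\<^sub>\<mu>)\<close>. It is linear, extends to \<open>K \<otimes> S\<close> (as \<open>coordK\<close>), is unchanged by \<open>f \<mapsto> 1\<^sub>\<lambda> f 1\<^sub>\<mu>\<close>, and
  sends \<open>e\<^sub>A\<close> to the indicator of \<open>ro A = \<lambda>\<close>, \<open>co A = \<mu>\<close>, \<open>w \<in> D\<^sub>A\<close>; the double cosets being disjoint,
  these functionals separate the \<open>[A]\<close>. What has to be known is that the \<open>T\<^sub>w\<close> form a basis of the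
  Hecke algebra, which is given by generators and relations. They span it by Matsumoto's theorem,
  proved here by counting inversions, and their coefficients are well defined because the left
  regular representation can be written down on functions of permutations (\<open>opL\<close>).

  Spanning. An endomorphism \<open>f\<close> is determined by the elements \<open>f (x\<^sub>\<mu>)\<close>. A component \<open>y\<close> of such an
  element lies in \<open>x\<^sub>\<lambda> H\<close> and satisfies \<open>T\<^sub>i y = q y\<close> for \<open>s\<^sub>i \<in> S\<^sub>\<lambda>\<close> and \<open>y T\<^sub>i = q y\<close> for
  \<open>s\<^sub>i \<in> S\<^sub>\<mu>\<close>. In terms of coefficients this says that \<open>y\<close> is constant on double cosets, so \<open>f\<close> is a
  combination of the \<open>e\<^sub>A\<close>. Conversely \<open>e\<^sub>A\<close> exists because the sum of \<open>T\<^sub>w\<close> over \<open>D\<^sub>A\<close> lies in both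
  \<open>x\<^sub>\<lambda> H\<close> and \<open>H x\<^sub>\<mu>\<close>; over \<open>\<int>[\<upsilon>, \<upsilon>\<^sup>-\<^sup>1]\<close> this needs coset representatives of minimal length, for which
  \<open>T\<^sub>u T\<^sub>d = T\<^sub>u\<^sub>d\<close>.

  The Hecke algebra and the tensor product are both quotients of a monoid algebra by the ideal
  generated by some relations. A linear functional on the monoid algebra descends to the quotient as
  soon as all its two-sided translates kill the relations (\<open>pairing_genideal\<close>); both \<open>coef\<close> and
  \<open>coordK\<close> are obtained in this way.
\<close>

(* Generators are indexed by i and i + 1; this keeps i + 1 from being rewritten to Suc i. *)
declare One_nat_def [simp del]

section \<open>Monoid algebras and their quotients\<close>

text \<open>
  Ring records whose operations are the restrictions of those of a type class. Sums over such a ring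
  are ordinary sums, so that type class automation applies to elements of monoid algebras.
\<close>

locale concrete_ring =
  fixes R :: "('r::comm_ring_1, 'x) ring_scheme"
  assumes mult_eq: "monoid.mult R = (*)" and add_eq: "ring.add R = (+)"
    and zero_eq: "\<zero>\<^bsub>R\<^esub> = 0" and one_eq: "\<one>\<^bsub>R\<^esub> = 1"
    and one_mem: "1 \<in> carrier R"
    and add_mem: "a \<in> carrier R \<Longrightarrow> b \<in> carrier R \<Longrightarrow> a + b \<in> carrier R"
    and mult_mem: "a \<in> carrier R \<Longrightarrow> b \<in> carrier R \<Longrightarrow> a * b \<in> carrier R"
    and uminus_mem: "a \<in> carrier R \<Longrightarrow> - a \<in> carrier R"
begin

lemmas ring_ops = mult_eq add_eq zero_eq one_eq

lemma zero_mem: "0 \<in> carrier R"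
  using add_mem[OF one_mem uminus_mem[OF one_mem]] by simp

lemma diff_mem: "a \<in> carrier R \<Longrightarrow> b \<in> carrier R \<Longrightarrow> a - b \<in> carrier R"
  using add_mem[OF _ uminus_mem, of a b] by simp

lemma power_mem: "a \<in> carrier R \<Longrightarrow> a ^ k \<in> carrier R"
  by (induction k) (auto intro: one_mem mult_mem)

lemma sum_mem: "(\<And>a. a \<in> S \<Longrightarrow> f a \<in> carrier R) \<Longrightarrow> sum f S \<in> carrier R"
  by (induction S rule: infinite_finite_induct) (auto intro: zero_mem add_mem)

lemma is_cring: "cring R"
proof (rule cringI)
  show "abelian_group R"
  proof (rule abelian_groupI)
    fix x assume "x \<in> carrier R"
    then show "\<exists>y\<in>carrier R. y \<oplus>\<^bsub>R\<^esub> x = \<zero>\<^bsub>R\<^esub>"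
      by (intro bexI[of _ "- x"]) (auto simp: ring_ops intro: uminus_mem)
  qed (auto simp: ring_ops algebra_simps intro: add_mem zero_mem)
  show "comm_monoid R"
    by (rule comm_monoidI) (auto simp: ring_ops algebra_simps intro: mult_mem one_mem)
qed (auto simp: ring_ops algebra_simps)

lemma finsum_eq: "finite S \<Longrightarrow> f \<in> S \<rightarrow> carrier R \<Longrightarrow> finsum R f S = sum f S"
proof (induction S rule: finite_induct)
  case empty
  interpret cring R by (rule is_cring)
  show ?case by (simp add: ring_ops)
next
  case (insert s S)
  interpret cring R by (rule is_cring)
  from insert show ?case by (simp add: ring_ops)
qed

end

text \<open>
  The linear extension of \<open>\<phi>\<close> from a monoid to its monoid algebra, with coefficients transported along
  \<open>\<rho>\<close>. Testing against all \<open>\<phi>\<close> replaces the convolution product by iterated sums.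
\<close>

definition pairing :: "('r::comm_ring_1 \<Rightarrow> 'k::comm_ring_1) \<Rightarrow> ('m \<Rightarrow> 'r) \<Rightarrow> ('m \<Rightarrow> 'k) \<Rightarrow> 'k"
  where "pairing \<rho> f \<phi> = (\<Sum>m | f m \<noteq> 0. \<rho> (f m) * \<phi> m)"

locale concrete_monoid_algebra = concrete_ring R + M: monoid M
  for R :: "('r::comm_ring_1, 'x) ring_scheme" and M :: "('m, 'y) monoid_scheme"
begin

abbreviation F where "F \<equiv> monoid_algebra R M"

lemma carrier_F: "f \<in> carrier F \<longleftrightarrow>
    (\<forall>m. f m \<in> carrier R) \<and> (\<forall>m. m \<notin> carrier M \<longrightarrow> f m = 0) \<and> finite {m. f m \<noteq> 0}"
  by (simp add: monoid_algebra_def ring_ops)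

lemma add_F: "f \<oplus>\<^bsub>F\<^esub> g = (\<lambda>m. f m + g m)"
  by (simp add: monoid_algebra_def ring_ops)

lemma zero_F: "\<zero>\<^bsub>F\<^esub> = (\<lambda>m. 0)"
  by (simp add: monoid_algebra_def ring_ops)

lemma one_F: "\<one>\<^bsub>F\<^esub> = single R \<one>\<^bsub>M\<^esub>"
  by (simp add: monoid_algebra_def single_def ring_ops)

lemma smult_F: "a \<odot>\<^bsub>F\<^esub> f = (\<lambda>m. a * f m)"
  by (simp add: monoid_algebra_def ring_ops)

lemma finite_support: "f \<in> carrier F \<Longrightarrow> finite {m. f m \<noteq> 0}"
  by (simp add: carrier_F)

lemma support_in: "f \<in> carrier F \<Longrightarrow> f m \<noteq> 0 \<Longrightarrow> m \<in> carrier M"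
  by (auto simp: carrier_F)

lemma mult_F:
  assumes "f \<in> carrier F" "g \<in> carrier F"
  shows "(f \<otimes>\<^bsub>F\<^esub> g) m =
    (\<Sum>p \<in> {p \<in> {a. f a \<noteq> 0} \<times> {b. g b \<noteq> 0}. fst p \<otimes>\<^bsub>M\<^esub> snd p = m}. f (fst p) * g (snd p))"
proof -
  have "{(a, b). f a \<noteq> 0 \<and> g b \<noteq> 0 \<and> a \<otimes>\<^bsub>M\<^esub> b = m}
      = {p \<in> {a. f a \<noteq> 0} \<times> {b. g b \<noteq> 0}. fst p \<otimes>\<^bsub>M\<^esub> snd p = m}" (is "?A = ?B")
    by auto
  moreover have "finite ?B"
    by (rule finite_subset[OF _ finite_cartesian_product[OF assms[THEN finite_support]]]) auto
  moreover have "(\<lambda>p. f (fst p) * g (snd p)) \<in> ?B \<rightarrow> carrier R"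
    using assms by (auto simp: carrier_F intro: mult_mem)
  ultimately show ?thesis
    by (simp add: monoid_algebra_def ring_ops finsum_eq)
qed

lemma single_carrier: "m \<in> carrier M \<Longrightarrow> single R m \<in> carrier F"
proof -
  have "finite {x. (if x = m then 1 else 0 :: 'r) \<noteq> 0}"
    by (rule finite_subset[of _ "{m}"]) auto
  then show "m \<in> carrier M \<Longrightarrow> single R m \<in> carrier F"
    by (auto simp: carrier_F single_def ring_ops intro: one_mem zero_mem)
qed

lemma pairing_superset:
  assumes "\<rho> 0 = 0" "finite S" "{m. f m \<noteq> 0} \<subseteq> S"
  shows "pairing \<rho> f \<phi> = (\<Sum>m\<in>S. \<rho> (f m) * \<phi> m)"
  unfolding pairing_def using assms by (intro sum.mono_neutral_left) auto

lemma pairing_cong: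
  assumes "f \<in> carrier F" "\<And>m. m \<in> carrier M \<Longrightarrow> \<phi> m = \<psi> m"
  shows "pairing \<rho> f \<phi> = pairing \<rho> f \<psi>"
  unfolding pairing_def using assms support_in by (intro sum.cong) auto

end

text \<open>
  The homomorphism \<open>\<rho>\<close> allows for functionals on \<open>\<int>[M]\<close> with values in a field of rational functions.
\<close>

locale monoid_algebra_pairing = concrete_monoid_algebra R M
  for R :: "('r::comm_ring_1, 'x) ring_scheme" and M :: "('m, 'y) monoid_scheme" +
  fixes \<rho> :: "'r \<Rightarrow> 'k::comm_ring_1"
  assumes rho_add: "\<rho> (a + b) = \<rho> a + \<rho> b"
    and rho_mult: "\<rho> (a * b) = \<rho> a * \<rho> b"
    and rho_one: "\<rho> 1 = 1"
begin

lemma rho_zero: "\<rho> 0 = 0"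
  using rho_add[of 0 0] by simp

lemma rho_sum: "\<rho> (sum f S) = (\<Sum>s\<in>S. \<rho> (f s))"
  by (induction S rule: infinite_finite_induct) (auto simp: rho_zero rho_add)

lemma pairing_add:
  assumes "f \<in> carrier F" "g \<in> carrier F"
  shows "pairing \<rho> (f \<oplus>\<^bsub>F\<^esub> g) \<phi> = pairing \<rho> f \<phi> + pairing \<rho> g \<phi>"
proof -
  let ?S = "{m. f m \<noteq> 0} \<union> {m. g m \<noteq> 0}"
  have S: "finite ?S" using assms finite_support by auto
  show ?thesis
    by (subst (1 2 3) pairing_superset[where S = ?S])
       (use S rho_zero in \<open>auto simp: add_F rho_add sum.distrib algebra_simps\<close>)
qed

lemma pairing_zero: "pairing \<rho> \<zero>\<^bsub>F\<^esub> \<phi> = 0"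
  by (simp add: pairing_def zero_F)

lemma pairing_smult:
  assumes "f \<in> carrier F"
  shows "pairing \<rho> (a \<odot>\<^bsub>F\<^esub> f) \<phi> = \<rho> a * pairing \<rho> f \<phi>"
  using assms finite_support
  by (subst (1 2) pairing_superset[where S = "{m. f m \<noteq> 0}"])
     (auto simp: smult_F rho_zero rho_mult sum_distrib_left mult.assoc)

lemma pairing_single: "pairing \<rho> (single R m) \<phi> = \<phi> m"
  by (subst pairing_superset[where S = "{m}"])
     (auto simp: rho_zero single_def ring_ops rho_one)

text \<open>
  Both sides sum over pairs of support elements; on the left the pairs are grouped by their product.
\<close>

lemma pairing_mult:
  assumes f: "f \<in> carrier F" and g: "g \<in> carrier F"
  shows "pairing \<rho> (f \<otimes>\<^bsub>F\<^esub> g) \<phi> = pairing \<rho> f (\<lambda>a. pairing \<rho> g (\<lambda>b. \<phi> (a \<otimes>\<^bsub>M\<^esub> b)))"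
proof -
  let ?A = "{a. f a \<noteq> 0}" and ?B = "{b. g b \<noteq> 0}"
  let ?h = "\<lambda>p. fst p \<otimes>\<^bsub>M\<^esub> snd p"
  let ?C = "?h ` (?A \<times> ?B)"
  have fin: "finite (?A \<times> ?B)" using f g finite_support by auto
  have sub: "{m. (f \<otimes>\<^bsub>F\<^esub> g) m \<noteq> 0} \<subseteq> ?C"
  proof
    fix m assume "m \<in> {m. (f \<otimes>\<^bsub>F\<^esub> g) m \<noteq> 0}"
    then have "(f \<otimes>\<^bsub>F\<^esub> g) m \<noteq> 0" by simp
    then have "{p \<in> ?A \<times> ?B. ?h p = m} \<noteq> {}"
      using mult_F[OF f g, of m] by (metis (no_types, lifting) sum.empty)
    then show "m \<in> ?C" by force
  qed
  have finC: "finite ?C" using fin by (rule finite_imageI)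
  have "pairing \<rho> (f \<otimes>\<^bsub>F\<^esub> g) \<phi> = (\<Sum>m\<in>?C. \<rho> ((f \<otimes>\<^bsub>F\<^esub> g) m) * \<phi> m)"
    by (rule pairing_superset[where \<rho> = \<rho>, OF rho_zero finC sub])
  also have "\<dots> = (\<Sum>m\<in>?C. \<Sum>p\<in>{p \<in> ?A \<times> ?B. ?h p = m}. \<rho> (f (fst p)) * (\<rho> (g (snd p)) * \<phi> (?h p)))"
    by (intro sum.cong refl) (auto simp: mult_F[OF f g] rho_sum rho_mult sum_distrib_right mult.assoc)
  also have "\<dots> = (\<Sum>p\<in>?A \<times> ?B. \<rho> (f (fst p)) * (\<rho> (g (snd p)) * \<phi> (?h p)))"
    by (rule sum.group) (use fin in auto)
  also have "\<dots> = pairing \<rho> f (\<lambda>a. pairing \<rho> g (\<lambda>b. \<phi> (a \<otimes>\<^bsub>M\<^esub> b)))"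
    by (simp add: pairing_def sum.cartesian_product sum_distrib_left case_prod_beta)
  finally show ?thesis .
qed

end

context concrete_monoid_algebra
begin

sublocale idp: monoid_algebra_pairing R M "\<lambda>a. a"
  by unfold_locales auto

lemma pairing_delta:
  assumes "f \<in> carrier F"
  shows "pairing (\<lambda>a. a) f (\<lambda>x. if x = m then 1 else 0) = f m"
  using assms finite_support
  by (subst pairing_superset[of _ "insert m {m. f m \<noteq> 0}"]) (auto simp: if_distrib cong: if_cong)

text \<open>
  Point indicators recover the coefficients. With \<open>pairing_mult\<close> this turns every ring axiom of the
  monoid algebra into an identity between iterated sums.
\<close>

lemma F_eqI:
  assumes "f \<in> carrier F" "g \<in> carrier F"
    and "\<And>\<phi>. pairing (\<lambda>a. a) f \<phi> = pairing (\<lambda>a. a) g (\<phi> :: 'm \<Rightarrow> 'r)"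
  shows "f = g"
proof
  fix m show "f m = g m"
    using pairing_delta[OF assms(1), of m] pairing_delta[OF assms(2), of m] assms(3) by metis
qed

lemma mult_carrier:
  assumes f: "f \<in> carrier F" and g: "g \<in> carrier F"
  shows "f \<otimes>\<^bsub>F\<^esub> g \<in> carrier F"
proof -
  let ?C = "(\<lambda>p. fst p \<otimes>\<^bsub>M\<^esub> snd p) ` ({a. f a \<noteq> 0} \<times> {b. g b \<noteq> 0})"
  have sub: "m \<in> ?C" if "(f \<otimes>\<^bsub>F\<^esub> g) m \<noteq> 0" for m
  proof -
    from that have "{p \<in> {a. f a \<noteq> 0} \<times> {b. g b \<noteq> 0}. fst p \<otimes>\<^bsub>M\<^esub> snd p = m} \<noteq> {}"
      using mult_F[OF f g, of m] by (metis (no_types, lifting) sum.empty)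
    then show ?thesis by force
  qed
  have "finite ?C" using f g finite_support by auto
  then have "finite {m. (f \<otimes>\<^bsub>F\<^esub> g) m \<noteq> 0}" by (rule finite_subset[rotated]) (use sub in blast)
  moreover have "?C \<subseteq> carrier M" using f g support_in by auto
  moreover have "(f \<otimes>\<^bsub>F\<^esub> g) m \<in> carrier R" for m
    using f g by (auto simp: mult_F carrier_F intro!: sum_mem mult_mem)
  ultimately show ?thesis using sub unfolding carrier_F by blast
qed

lemma add_carrier: "f \<in> carrier F \<Longrightarrow> g \<in> carrier F \<Longrightarrow> f \<oplus>\<^bsub>F\<^esub> g \<in> carrier F"
proof -
  assume f: "f \<in> carrier F" and g: "g \<in> carrier F"
  have "finite {m. f m + g m \<noteq> 0}"
    by (rule finite_subset[of _ "{m. f m \<noteq> 0} \<union> {m. g m \<noteq> 0}"])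
       (use f g finite_support in auto)
  with f g show "f \<oplus>\<^bsub>F\<^esub> g \<in> carrier F"
    by (auto simp: carrier_F add_F intro: add_mem)
qed

lemma smult_carrier: "a \<in> carrier R \<Longrightarrow> f \<in> carrier F \<Longrightarrow> a \<odot>\<^bsub>F\<^esub> f \<in> carrier F"
proof -
  assume a: "a \<in> carrier R" and f: "f \<in> carrier F"
  have "finite {m. a * f m \<noteq> 0}"
    by (rule finite_subset[OF _ finite_support[OF f]]) auto
  with f a show "a \<odot>\<^bsub>F\<^esub> f \<in> carrier F"
    by (auto simp: carrier_F smult_F intro: mult_mem)
qed

lemma zero_carrier: "\<zero>\<^bsub>F\<^esub> \<in> carrier F"
  by (simp add: carrier_F zero_F zero_mem)

lemma ring_F: "ring F"
proof (rule ringI)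
  show "abelian_group F"
  proof (rule abelian_groupI)
    fix f assume f: "f \<in> carrier F"
    then show "\<exists>g\<in>carrier F. g \<oplus>\<^bsub>F\<^esub> f = \<zero>\<^bsub>F\<^esub>"
      by (intro bexI[of _ "\<lambda>m. - f m"]) (auto simp: add_F zero_F carrier_F intro: uminus_mem)
  qed (use add_carrier zero_carrier in \<open>auto simp: add_F zero_F algebra_simps\<close>)
  show "Group.monoid F"
  proof (rule monoidI)
    show "\<one>\<^bsub>F\<^esub> \<in> carrier F" by (simp add: one_F single_carrier)
  next
    fix f g h assume fgh: "f \<in> carrier F" "g \<in> carrier F" "h \<in> carrier F"
    then show "f \<otimes>\<^bsub>F\<^esub> g \<otimes>\<^bsub>F\<^esub> h = f \<otimes>\<^bsub>F\<^esub> (g \<otimes>\<^bsub>F\<^esub> h)"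
      by (intro F_eqI) (auto simp: idp.pairing_mult mult_carrier M.m_assoc intro!: pairing_cong)
  next
    fix f assume f: "f \<in> carrier F"
    then show "\<one>\<^bsub>F\<^esub> \<otimes>\<^bsub>F\<^esub> f = f" "f \<otimes>\<^bsub>F\<^esub> \<one>\<^bsub>F\<^esub> = f"
      by (auto intro!: F_eqI pairing_cong
          simp: idp.pairing_mult idp.pairing_single mult_carrier one_F single_carrier)
  qed (rule mult_carrier)
next
  fix f g h assume fgh: "f \<in> carrier F" "g \<in> carrier F" "h \<in> carrier F"
  then show "(f \<oplus>\<^bsub>F\<^esub> g) \<otimes>\<^bsub>F\<^esub> h = f \<otimes>\<^bsub>F\<^esub> h \<oplus>\<^bsub>F\<^esub> g \<otimes>\<^bsub>F\<^esub> h"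
    by (intro F_eqI) (auto simp: idp.pairing_mult idp.pairing_add mult_carrier add_carrier)
  have *: "pairing (\<lambda>a. a) h (\<lambda>a. \<phi> a + \<psi> a) = pairing (\<lambda>a. a) h \<phi> + pairing (\<lambda>a. a) h \<psi>"
    for \<phi> \<psi> :: "'m \<Rightarrow> 'r"
    by (simp add: pairing_def sum.distrib algebra_simps)
  from fgh show "h \<otimes>\<^bsub>F\<^esub> (f \<oplus>\<^bsub>F\<^esub> g) = h \<otimes>\<^bsub>F\<^esub> f \<oplus>\<^bsub>F\<^esub> h \<otimes>\<^bsub>F\<^esub> g"
    by (intro F_eqI) (auto simp: idp.pairing_mult idp.pairing_add mult_carrier add_carrier *)
qed

lemma minus_F: "f \<in> carrier F \<Longrightarrow> g \<in> carrier F \<Longrightarrow> f \<ominus>\<^bsub>F\<^esub> g = (\<lambda>m. f m - g m)"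
proof -
  assume f: "f \<in> carrier F" and g: "g \<in> carrier F"
  interpret ring F by (rule ring_F)
  have "\<ominus>\<^bsub>F\<^esub> g = (\<lambda>m. - g m)"
    using g by (intro minus_equality) (auto simp: add_F zero_F carrier_F intro: uminus_mem)
  then show ?thesis by (simp add: a_minus_def add_F)
qed

lemma single_mult:
  assumes "a \<in> carrier M" "b \<in> carrier M"
  shows "single R a \<otimes>\<^bsub>F\<^esub> single R b = single R (a \<otimes>\<^bsub>M\<^esub> b)"
  using assms by (intro F_eqI)
    (auto simp: idp.pairing_mult idp.pairing_single mult_carrier single_carrier)

lemma smult_mult_left:
  assumes "a \<in> carrier R" "f \<in> carrier F" "g \<in> carrier F"
  shows "(a \<odot>\<^bsub>F\<^esub> f) \<otimes>\<^bsub>F\<^esub> g = a \<odot>\<^bsub>F\<^esub> (f \<otimes>\<^bsub>F\<^esub> g)"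
  using assms by (intro F_eqI)
    (auto simp: idp.pairing_mult idp.pairing_smult mult_carrier smult_carrier)

lemma smult_mult_right:
  assumes "a \<in> carrier R" "f \<in> carrier F" "g \<in> carrier F"
  shows "f \<otimes>\<^bsub>F\<^esub> (a \<odot>\<^bsub>F\<^esub> g) = a \<odot>\<^bsub>F\<^esub> (f \<otimes>\<^bsub>F\<^esub> g)"
proof -
  have "pairing (\<lambda>a. a) f (\<lambda>x. a * \<phi> x) = a * pairing (\<lambda>a. a) f \<phi>" for \<phi> :: "'m \<Rightarrow> 'r"
    by (simp add: pairing_def sum_distrib_left algebra_simps)
  then show ?thesis
    using assms by (intro F_eqI)
      (auto simp: idp.pairing_mult idp.pairing_smult mult_carrier smult_carrier)
qed

text \<open>
  A finitely supported function is a sum of monomials, by induction on its support.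
\<close>

lemma F_induct [consumes 1, case_names single add]:
  assumes f: "f \<in> carrier F"
    and single: "\<And>a m. a \<in> carrier R \<Longrightarrow> m \<in> carrier M \<Longrightarrow> P (a \<odot>\<^bsub>F\<^esub> single R m)"
    and add: "\<And>f g. f \<in> carrier F \<Longrightarrow> g \<in> carrier F \<Longrightarrow> P f \<Longrightarrow> P g \<Longrightarrow> P (f \<oplus>\<^bsub>F\<^esub> g)"
  shows "P f"
proof -
  have "finite S \<Longrightarrow> \<forall>f \<in> carrier F. {m. f m \<noteq> 0} = S \<longrightarrow> P f" for S
  proof (induction S rule: finite_induct)
    case empty
    have "P (0 \<odot>\<^bsub>F\<^esub> single R \<one>\<^bsub>M\<^esub>)" by (rule single) (auto intro: zero_mem)
    moreover have "f = 0 \<odot>\<^bsub>F\<^esub> single R \<one>\<^bsub>M\<^esub>" if "{m. f m \<noteq> 0} = {}" for f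
      using that by (auto simp: smult_F)
    ultimately show ?case by metis
  next
    case (insert s S)
    show ?case
    proof (intro ballI impI)
      fix f assume f: "f \<in> carrier F" and sup: "{m. f m \<noteq> 0} = insert s S"
      let ?g = "f(s := 0)"
      have S: "{m. ?g m \<noteq> 0} = S" using sup insert by auto
      have g: "?g \<in> carrier F" using f S insert(1) by (auto simp: carrier_F zero_mem)
      have s: "s \<in> carrier M" "f s \<in> carrier R" using f sup support_in by (auto simp: carrier_F)
      have "f = (f s \<odot>\<^bsub>F\<^esub> single R s) \<oplus>\<^bsub>F\<^esub> ?g"
        by (auto simp: add_F smult_F single_def ring_ops)
      moreover have "P \<dots>"
        using insert.IH g S s by (intro add single smult_carrier single_carrier) auto
      ultimately show "P f" by metis
    qed
  qed
  with f show ?thesis using finite_support by blast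
qed

end

context monoid_algebra_pairing
begin

lemma pairing_minus:
  assumes f: "f \<in> carrier F" and g: "g \<in> carrier F"
  shows "pairing \<rho> (f \<ominus>\<^bsub>F\<^esub> g) \<phi> = pairing \<rho> f \<phi> - pairing \<rho> g \<phi>"
proof -
  interpret F: ring F by (rule ring_F)
  have "f = (f \<ominus>\<^bsub>F\<^esub> g) \<oplus>\<^bsub>F\<^esub> g" using f g by (auto simp: minus_F add_F)
  then show ?thesis using pairing_add[of "f \<ominus>\<^bsub>F\<^esub> g" g \<phi>] f g by simp
qed

text \<open>
  The elements killed by all translates \<open>m \<mapsto> \<phi> (u m v)\<close> form a two-sided ideal, the largest one in the
  kernel of \<open>\<phi>\<close>. Hence it suffices to test the translates on the generators, and no multiplication
  has to be constructed on the target of \<open>\<phi>\<close>.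
\<close>

lemma pairing_genideal:
  assumes rels: "S \<subseteq> carrier F"
    and kill: "\<And>s u v. s \<in> S \<Longrightarrow> u \<in> carrier M \<Longrightarrow> v \<in> carrier M \<Longrightarrow>
        pairing \<rho> s (\<lambda>m. \<phi> (u \<otimes>\<^bsub>M\<^esub> m \<otimes>\<^bsub>M\<^esub> v)) = 0"
    and z: "z \<in> Idl\<^bsub>F\<^esub> S"
  shows "pairing \<rho> z \<phi> = 0"
proof -
  let ?J = "{z \<in> carrier F. \<forall>u \<in> carrier M. \<forall>v \<in> carrier M.
        pairing \<rho> z (\<lambda>m. \<phi> (u \<otimes>\<^bsub>M\<^esub> m \<otimes>\<^bsub>M\<^esub> v)) = 0}"
  interpret F: ring F by (rule ring_F)
  have "ideal ?J F"
  proof (rule idealI)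
    show "ring F" by (rule ring_F)
    show "subgroup ?J (add_monoid F)"
    proof (rule F.add.subgroupI)
      show "?J \<noteq> {}" using zero_carrier by (auto simp: pairing_zero)
    next
      fix z assume z: "z \<in> ?J"
      have "pairing \<rho> z (\<lambda>m. \<phi> (u \<otimes>\<^bsub>M\<^esub> m \<otimes>\<^bsub>M\<^esub> v))
          + pairing \<rho> (\<ominus>\<^bsub>F\<^esub> z) (\<lambda>m. \<phi> (u \<otimes>\<^bsub>M\<^esub> m \<otimes>\<^bsub>M\<^esub> v)) = 0" for u v
        using z by (subst pairing_add[symmetric]) (auto simp: F.r_neg pairing_zero)
      then have "pairing \<rho> (\<ominus>\<^bsub>F\<^esub> z) (\<lambda>m. \<phi> (u \<otimes>\<^bsub>M\<^esub> m \<otimes>\<^bsub>M\<^esub> v)) = 0"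
        if "u \<in> carrier M" "v \<in> carrier M" for u v
        using z that by (metis (mono_tags, lifting) add_0_left mem_Collect_eq)
      with z show "\<ominus>\<^bsub>F\<^esub> z \<in> ?J" by auto
    qed (auto simp: pairing_add add_carrier)
  next
    fix z x assume z: "z \<in> ?J" and x: "x \<in> carrier F"
    show "x \<otimes>\<^bsub>F\<^esub> z \<in> ?J"
    proof (safe; (rule mult_carrier)?)
      fix u v assume uv: "u \<in> carrier M" "v \<in> carrier M"
      have "pairing \<rho> (x \<otimes>\<^bsub>F\<^esub> z) (\<lambda>m. \<phi> (u \<otimes>\<^bsub>M\<^esub> m \<otimes>\<^bsub>M\<^esub> v))
          = pairing \<rho> x (\<lambda>a. pairing \<rho> z (\<lambda>m. \<phi> ((u \<otimes>\<^bsub>M\<^esub> a) \<otimes>\<^bsub>M\<^esub> m \<otimes>\<^bsub>M\<^esub> v)))"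
        using x z uv by (auto simp: pairing_mult M.m_assoc intro!: pairing_cong)
      also have "\<dots> = pairing \<rho> x (\<lambda>a. 0)"
        using x z uv by (intro pairing_cong) auto
      finally show "pairing \<rho> (x \<otimes>\<^bsub>F\<^esub> z) (\<lambda>m. \<phi> (u \<otimes>\<^bsub>M\<^esub> m \<otimes>\<^bsub>M\<^esub> v)) = 0"
        by (simp add: pairing_def)
    qed (use x z in auto)
    show "z \<otimes>\<^bsub>F\<^esub> x \<in> ?J"
    proof (safe; (rule mult_carrier)?)
      fix u v assume uv: "u \<in> carrier M" "v \<in> carrier M"
      have swap: "pairing \<rho> z (\<lambda>a. pairing \<rho> x (\<lambda>b. \<psi> a b))
          = pairing \<rho> x (\<lambda>b. pairing \<rho> z (\<lambda>a. \<psi> a b))" for \<psi>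
        unfolding pairing_def sum_distrib_left by (subst sum.swap) (simp add: mult.left_commute)
      have "pairing \<rho> (z \<otimes>\<^bsub>F\<^esub> x) (\<lambda>m. \<phi> (u \<otimes>\<^bsub>M\<^esub> m \<otimes>\<^bsub>M\<^esub> v))
          = pairing \<rho> x (\<lambda>b. pairing \<rho> z (\<lambda>m. \<phi> (u \<otimes>\<^bsub>M\<^esub> (m \<otimes>\<^bsub>M\<^esub> b) \<otimes>\<^bsub>M\<^esub> v)))"
        using x z uv by (auto simp: pairing_mult swap)
      also have "\<dots> = pairing \<rho> x (\<lambda>b. pairing \<rho> z (\<lambda>m. \<phi> (u \<otimes>\<^bsub>M\<^esub> m \<otimes>\<^bsub>M\<^esub> (b \<otimes>\<^bsub>M\<^esub> v))))"
        using x z uv by (auto intro!: pairing_cong simp: M.m_assoc)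
      also have "\<dots> = pairing \<rho> x (\<lambda>a. 0)"
        using x z uv by (intro pairing_cong) auto
      finally show "pairing \<rho> (z \<otimes>\<^bsub>F\<^esub> x) (\<lambda>m. \<phi> (u \<otimes>\<^bsub>M\<^esub> m \<otimes>\<^bsub>M\<^esub> v)) = 0"
        by (simp add: pairing_def)
    qed (use x z in auto)
  qed
  moreover have "S \<subseteq> ?J" using rels kill by auto
  ultimately have "z \<in> ?J" using F.genideal_minimal z by blast
  then have "pairing \<rho> z (\<lambda>m. \<phi> (\<one>\<^bsub>M\<^esub> \<otimes>\<^bsub>M\<^esub> m \<otimes>\<^bsub>M\<^esub> \<one>\<^bsub>M\<^esub>)) = 0" by auto
  moreover have "pairing \<rho> z (\<lambda>m. \<phi> (\<one>\<^bsub>M\<^esub> \<otimes>\<^bsub>M\<^esub> m \<otimes>\<^bsub>M\<^esub> \<one>\<^bsub>M\<^esub>)) = pairing \<rho> z \<phi>"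
    using \<open>z \<in> ?J\<close> by (intro pairing_cong) auto
  ultimately show ?thesis by simp
qed

text \<open>
  The functional induced on a quotient, evaluated at an arbitrary representative of the coset.
\<close>

definition coset_pairing :: "('m \<Rightarrow> 'r) set \<Rightarrow> ('m \<Rightarrow> 'k) \<Rightarrow> 'k"
  where "coset_pairing X \<phi> = pairing \<rho> (SOME f. f \<in> X) \<phi>"

lemma coset_pairing:
  assumes J: "ideal J F" and kill: "\<And>z. z \<in> J \<Longrightarrow> pairing \<rho> z \<phi> = 0" and f: "f \<in> carrier F"
  shows "coset_pairing (J +>\<^bsub>F\<^esub> f) \<phi> = pairing \<rho> f \<phi>"
proof -
  interpret J: ideal J F by fact
  have "f \<in> J +>\<^bsub>F\<^esub> f" using f by (rule J.a_rcos_self)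
  then have "(SOME g. g \<in> J +>\<^bsub>F\<^esub> f) \<in> J +>\<^bsub>F\<^esub> f" by (rule someI[where P = "\<lambda>g. g \<in> J +>\<^bsub>F\<^esub> f"])
  then obtain z where "z \<in> J" "(SOME g. g \<in> J +>\<^bsub>F\<^esub> f) = z \<oplus>\<^bsub>F\<^esub> f"
    by (auto simp: a_r_coset_def')
  then show ?thesis using f kill by (simp add: coset_pairing_def pairing_add)
qed

end

lemma KK_concrete: "concrete_ring KK"
  by unfold_locales (auto simp: KK_def)

lemma AA_concrete: "concrete_ring AA"
proof -
  interpret KK: concrete_ring KK by (rule KK_concrete)
  interpret KK: cring KK by (rule KK.is_cring)
  have *: "\<ominus>\<^bsub>KK\<^esub> a = - a" for a
    by (rule KK.minus_equality) (auto simp: KK_def)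
  show ?thesis
    using generate_ring.one[of KK] generate_ring.eng_add[of _ KK] generate_ring.eng_mult[of _ KK]
      generate_ring.a_inv[of _ KK]
    by unfold_locales (auto simp: AA_def KK.ring_ops *)
qed

lemma upsilon_AA: "upsilon \<in> carrier AA" "inverse upsilon \<in> carrier AA"
  by (auto simp: AA_def intro: generate_ring.incl)

lemma qq_AA: "qq \<in> carrier AA"
  unfolding qq_def by (intro concrete_ring.power_mem[OF AA_concrete] upsilon_AA)

lemma upsilon_nonzero: "upsilon \<noteq> 0"
  by (simp add: upsilon_def Zero_fract_def eq_fract)

lemma qq_nonzero: "qq \<noteq> 0"
  by (simp add: qq_def upsilon_nonzero)

section \<open>Inversions and reduced words of permutations\<close>

definition st :: "nat \<Rightarrow> nat \<Rightarrow> nat" where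
  "st i = Transposition.transpose i (i + 1)"

definition inversions :: "(nat \<Rightarrow> nat) \<Rightarrow> (nat \<times> nat) set" where
  "inversions w = {(a, b). a < b \<and> w b < w a}"

text \<open>
  The Coxeter length. No bound on the points is needed: permutations of \<open>{1..r}\<close> have no inversions
  outside of it.
\<close>

definition ell :: "(nat \<Rightarrow> nat) \<Rightarrow> nat" where
  "ell w = card (inversions w)"

lemma st_permutes: "i \<in> {1..<r} \<Longrightarrow> st i permutes {1..r}"
  unfolding st_def by (rule permutes_swap_id) auto

lemma st_st: "st i \<circ> st i = id"
  by (rule ext) (simp add: st_def)

lemma st_apply: "st i i = i + 1" "st i (i + 1) = i" "k \<noteq> i \<Longrightarrow> k \<noteq> i + 1 \<Longrightarrow> st i k = k"
  by (auto simp: st_def)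

lemma st_involutive: "st i (st i k) = k"
  by (simp add: st_def)

lemma st_eq_iff: "st i a = st i b \<longleftrightarrow> a = b"
  by (metis st_involutive)

lemma st_st_comp: "st i \<circ> (st i \<circ> w) = w" "w \<circ> st i \<circ> st i = w"
  by (auto simp: st_involutive)

lemma inv_st: "inv' (st i) = st i"
  by (rule inv_unique_comp) (rule st_st)+

lemma bij_st: "bij (st i)"
  by (simp add: st_def)

lemma inv_st_comp: "w permutes S \<Longrightarrow> inv' (st i \<circ> w) = inv' w \<circ> st i"
  by (subst o_inv_distrib) (auto simp: inv_st permutes_bij bij_st)

lemma st_less: "a < b \<Longrightarrow> (a, b) \<noteq> (i, i + 1) \<Longrightarrow> st i a < st i b"
  by (auto simp: st_def transpose_def)

lemma finite_inversions: "w permutes {1..r} \<Longrightarrow> finite (inversions w)"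
proof (rule finite_subset)
  assume w: "w permutes {1..r}"
  show "inversions w \<subseteq> {1..r} \<times> {1..r}"
  proof
    fix p assume "p \<in> inversions w"
    then obtain a b where p: "p = (a, b)" "a < b" "w b < w a" by (auto simp: inversions_def)
    have "a \<noteq> 0"
    proof
      assume "a = 0"
      then have "w a = 0" using w by (simp add: permutes_def)
      then show False using p by simp
    qed
    moreover have "b \<le> r"
    proof (rule ccontr)
      assume "\<not> b \<le> r"
      then have b: "w b = b" "b > r" using w by (auto simp: permutes_def)
      then have "w a > r" "w a \<noteq> w b" using p by auto
      then have "w a = a" using permutes_in_image[OF w, of a] w by (auto simp: permutes_def)
      then show False using p b by simp
    qed
    ultimately show "p \<in> {1..r} \<times> {1..r}" using p by auto
  qed
qed auto

lemma ell_id: "ell id = 0"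
  by (auto simp: ell_def inversions_def card_eq_0_iff)

lemma ell_inv: "w permutes {1..r} \<Longrightarrow> ell (inv' w) = ell w"
proof -
  assume w: "w permutes {1..r}"
  have "bij_betw (\<lambda>(a, b). (w b, w a)) (inversions w) (inversions (inv' w))"
    by (rule bij_betw_byWitness[where f' = "\<lambda>(a, b). (inv' w b, inv' w a)"])
       (auto simp: inversions_def permutes_inverses[OF w])
  then show ?thesis by (simp add: ell_def bij_betw_same_card)
qed

text \<open>
  Composing with \<open>s\<^sub>i\<close> moves the inversions along \<open>s\<^sub>i \<times> s\<^sub>i\<close>, which preserves the order of all pairs
  except \<open>(i, i + 1)\<close>; this pair becomes an inversion.
\<close>

lemma ell_comp_st_up:
  assumes w: "w permutes {1..r}" and up: "w i < w (i + 1)"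
  shows "ell (w \<circ> st i) = ell w + 1"
proof -
  have "inversions (w \<circ> st i) = insert (i, i + 1) ((\<lambda>(a, b). (st i a, st i b)) ` inversions w)"
    (is "?L = insert ?p (?f ` ?I)")
  proof (rule Set.set_eqI)
    fix p :: "nat \<times> nat"
    obtain a b where p: "p = (a, b)" by force
    show "p \<in> ?L \<longleftrightarrow> p \<in> insert ?p (?f ` ?I)"
    proof (cases "(a, b) = (i, i + 1)")
      case True
      then show ?thesis using up by (auto simp: p inversions_def st_apply)
    next
      case ab: False
      show ?thesis
      proof
        assume "p \<in> ?L"
        then have "(st i a, st i b) \<in> ?I"
          using st_less[OF _ ab] by (auto simp: p inversions_def)
        moreover have "p = ?f (st i a, st i b)" by (simp add: p st_involutive)
        ultimately show "p \<in> insert ?p (?f ` ?I)" by blast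
      next
        assume "p \<in> insert ?p (?f ` ?I)"
        then obtain c d where cd: "(c, d) \<in> ?I" "a = st i c" "b = st i d" using ab p by auto
        then have "(c, d) \<noteq> (i, i + 1)" using up by (auto simp: inversions_def)
        then show "p \<in> ?L" using cd st_less[of c d i] by (auto simp: p inversions_def st_involutive)
      qed
    qed
  qed
  moreover have "?p \<notin> ?f ` ?I"
  proof
    assume "?p \<in> ?f ` ?I"
    then obtain c d where cd: "(c, d) \<in> ?I" "i = st i c" "i + 1 = st i d" by auto
    have "c = st i i" "d = st i (i + 1)"
      using cd(2,3) st_involutive[of i c] st_involutive[of i d] by metis+
    then have "c = i + 1" "d = i" by (simp_all add: st_apply)
    then show False using cd by (auto simp: inversions_def)
  qed
  moreover have "inj_on ?f ?I" by (auto simp: inj_on_def st_eq_iff)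
  ultimately show ?thesis
    using finite_inversions[OF w] by (simp add: ell_def card_image)
qed

lemma ell_comp_st_down:
  assumes w: "w permutes {1..r}" and i: "i \<in> {1..<r}" and down: "\<not> w i < w (i + 1)"
  shows "ell w = ell (w \<circ> st i) + 1"
proof -
  have "w i \<noteq> w (i + 1)" using permutes_inj[OF w] by (simp add: inj_eq)
  then have "(w \<circ> st i) i < (w \<circ> st i) (i + 1)" using down by (simp add: st_apply)
  then have "ell (w \<circ> st i \<circ> st i) = ell (w \<circ> st i) + 1"
    by (intro ell_comp_st_up[where r = r] permutes_compose[OF st_permutes[OF i] w])
  then show ?thesis by (simp only: st_st_comp)
qed

lemma ell_st_comp_up:
  assumes w: "w permutes {1..r}" and i: "i \<in> {1..<r}" and up: "inv' w i < inv' w (i + 1)"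
  shows "ell (st i \<circ> w) = ell w + 1"
  using ell_comp_st_up[OF permutes_inv[OF w] up]
    ell_inv[OF w] ell_inv[OF permutes_compose[OF w st_permutes[OF i]]]
  by (simp add: inv_st_comp[OF w])

lemma ell_st_comp_down:
  assumes w: "w permutes {1..r}" and i: "i \<in> {1..<r}" and down: "\<not> inv' w i < inv' w (i + 1)"
  shows "ell w = ell (st i \<circ> w) + 1"
  using ell_comp_st_down[OF permutes_inv[OF w] i down]
    ell_inv[OF w] ell_inv[OF permutes_compose[OF w st_permutes[OF i]]]
  by (simp add: inv_st_comp[OF w])

lemma ell_st: "i \<in> {1..<r} \<Longrightarrow> ell (st i) = 1"
  using ell_comp_st_up[OF permutes_id, of i] by (simp add: ell_id)

text \<open>
  Without descents both \<open>w\<close> and its inverse are increasing, and an increasing map of \<open>nat\<close> lies above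
  the identity.
\<close>

lemma permutes_no_descent:
  fixes r :: nat
  assumes w: "w permutes {1..r}" and up: "\<And>i. i \<in> {1..<r} \<Longrightarrow> w i < w (i + 1)"
  shows "w = id"
proof -
  have le: "k \<le> u k" if u: "u permutes {1..r}" and up: "\<And>i. i \<in> {1..<r} \<Longrightarrow> u i < u (i + 1)"
    for u k
  proof (induction k)
    case (Suc k)
    have "u k < u (Suc k)"
    proof (cases "k \<in> {1..<r}")
      case True
      then show ?thesis using up[of k] by (simp only: Suc_eq_plus1)
    next
      case False
      then consider "k = 0" "r \<ge> 1" | "k = 0" "r = 0" | "k = r" "r > 0" | "k > r" by force
      then show ?thesis
      proof cases
        case 1
        have "u 1 \<in> {1..r}" using u 1 by (subst permutes_in_image) auto
        then show ?thesis using 1 u by (auto simp: permutes_def One_nat_def)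
      next
        case 3
        have "u k \<in> {1..r}" using u 3 by (subst permutes_in_image) auto
        then show ?thesis using 3 u by (auto simp: permutes_def)
      qed (use u in \<open>auto simp: permutes_def\<close>)
    qed
    then show ?case using Suc by simp
  qed simp
  have "ell (inv' w) = ell w" by (rule ell_inv[OF w])
  have mono: "w a \<le> w b" if "a \<le> b" for a b
  proof (rule lift_Suc_mono_le[OF _ that])
    fix n
    show "w n \<le> w (Suc n)"
    proof (cases "n \<in> {1..<r}")
      case False
      then consider "n = 0" | "n \<ge> r" by force
      then show ?thesis
      proof cases
        case 2
        then have "w (Suc n) = Suc n" using w by (auto simp: permutes_def)
        moreover have "w n \<le> n"
          using permutes_in_image[OF w, of n] w 2 by (cases "n \<in> {1..r}") (auto simp: permutes_def)
        ultimately show ?thesis by simp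
      qed (use w in \<open>auto simp: permutes_def\<close>)
    qed (use up[of n] in \<open>simp add: Suc_eq_plus1 less_imp_le del: add_Suc_right\<close>)
  qed
  have "inv' w i < inv' w (i + 1)" for i
  proof (rule ccontr)
    assume "\<not> inv' w i < inv' w (i + 1)"
    then have "w (inv' w (i + 1)) \<le> w (inv' w i)" by (intro mono) simp
    then show False by (simp add: permutes_inverses[OF w])
  qed
  from le[OF permutes_inv[OF w] this] have "k \<le> inv' w k" for k .
  then have "w k \<le> k" for k by (metis permutes_inverses(2)[OF w])
  then have "w k = k" for k using le[OF w up, of k] by (simp add: order.antisym)
  then show ?thesis by (simp add: fun_eq_iff)
qed

lemma exists_left_descent:
  fixes r :: nat
  assumes w: "w permutes {1..r}" and "w \<noteq> id"
  obtains i where "i \<in> {1..<r}" "\<not> inv' w i < inv' w (i + 1)"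
proof -
  have "inv' w \<noteq> id"
    using \<open>w \<noteq> id\<close> by (metis inv_id inv_inv_eq permutes_bij[OF w])
  with permutes_no_descent[OF permutes_inv[OF w]] that show ?thesis by blast
qed

lemma word_perm_simps [simp]:
  "word_perm [] = id" "word_perm (i # ws) = st i \<circ> word_perm ws"
  by (simp_all add: word_perm_def st_def)

lemma word_perm_append: "word_perm (u @ v) = word_perm u \<circ> word_perm v"
  by (induction u) (simp_all add: comp_assoc)

lemma word_perm_permutes: "ws \<in> lists {1..<r} \<Longrightarrow> word_perm ws permutes {1..r}"
  by (induction ws) (auto simp: permutes_id intro!: permutes_compose st_permutes)

lemma ell_word_perm_le: "ws \<in> lists {1..<r} \<Longrightarrow> ell (word_perm ws) \<le> length ws"
proof (induction ws)
  case (Cons i ws)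
  then have p: "word_perm ws permutes {1..r}" and i: "i \<in> {1..<r}"
    by (auto intro: word_perm_permutes)
  have "ell (st i \<circ> word_perm ws) \<le> ell (word_perm ws) + 1"
    using ell_st_comp_up[OF p i] ell_st_comp_down[OF p i] by fastforce
  moreover have "ell (word_perm ws) \<le> length ws" using Cons by simp
  moreover have "word_perm (i # ws) = st i \<circ> word_perm ws" by (rule word_perm_simps)
  ultimately show ?case by (simp only: list.size)
qed (simp add: ell_id)

definition reduced :: "nat \<Rightarrow> nat list \<Rightarrow> bool" where
  "reduced r ws \<longleftrightarrow> ws \<in> lists {1..<r} \<and> ell (word_perm ws) = length ws"

lemma exists_reduced:
  assumes "w permutes {1..r}"
  shows "\<exists>ws. reduced r ws \<and> word_perm ws = w"
  using assms
proof (induction "ell w" arbitrary: w rule: less_induct)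
  case less
  show ?case
  proof (cases "w = id")
    case True
    then show ?thesis by (intro exI[of _ "[]"]) (simp add: reduced_def ell_id)
  next
    case False
    then obtain i where i: "i \<in> {1..<r}" "\<not> inv' w i < inv' w (i + 1)"
      using exists_left_descent less by metis
    have e: "ell w = ell (st i \<circ> w) + 1" by (rule ell_st_comp_down[OF less(2) i])
    moreover have "st i \<circ> w permutes {1..r}"
      using less(2) i st_permutes by (intro permutes_compose) auto
    ultimately obtain ws where ws: "reduced r ws" "word_perm ws = st i \<circ> w"
      using less(1)[of "st i \<circ> w"] by auto
    then have "word_perm (i # ws) = w" by (simp add: st_st_comp)
    with ws i e show ?thesis by (intro exI[of _ "i # ws"]) (auto simp: reduced_def)
  qed
qed

text \<open>
  Words of length \<open>ell w\<close> exist and shorter ones do not, so a word of least length is reduced in the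
  sense of inversions.
\<close>

lemma reduced_word:
  assumes "w permutes {1..r}"
  shows "reduced r (reduced_word r w)" "word_perm (reduced_word r w) = w"
proof -
  obtain ws where ws: "reduced r ws" "word_perm ws = w" using exists_reduced[OF assms] by auto
  let ?P = "\<lambda>ws. ws \<in> lists {1..<r} \<and> word_perm ws = w"
  have P: "?P ws" using ws by (simp add: reduced_def)
  then have *: "?P (reduced_word r w)" and "length (reduced_word r w) \<le> length ws"
    unfolding reduced_word_def using arg_min_nat_lemma[of ?P ws length] by auto
  with ws show "reduced r (reduced_word r w)"
    using ell_word_perm_le[of "reduced_word r w" r] by (auto simp: reduced_def)
  show "word_perm (reduced_word r w) = w" using * by simp
qed

lemma reduced_Cons:
  assumes "reduced r (i # ws)"
  shows "i \<in> {1..<r}" "reduced r ws" "inv' (word_perm ws) i < inv' (word_perm ws) (i + 1)"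
proof -
  have ws: "ws \<in> lists {1..<r}" and i: "i \<in> {1..<r}" using assms by (auto simp: reduced_def)
  note p = word_perm_permutes[OF ws]
  show "i \<in> {1..<r}" by fact
  show up: "inv' (word_perm ws) i < inv' (word_perm ws) (i + 1)"
    using assms ell_st_comp_down[OF p i] ell_word_perm_le[OF ws] by (auto simp: reduced_def)
  from ell_st_comp_up[OF p i up] assms ws show "reduced r ws" by (simp add: reduced_def)
qed

lemma reduced_ConsI:
  assumes "i \<in> {1..<r}" "reduced r ws" "inv' (word_perm ws) i < inv' (word_perm ws) (i + 1)"
  shows "reduced r (i # ws)"
  using assms ell_st_comp_up[OF word_perm_permutes assms(1,3)] by (auto simp: reduced_def)

lemma st_braid: "st i \<circ> (st (i + 1) \<circ> st i) = st (i + 1) \<circ> (st i \<circ> st (i + 1))"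
  by (rule ext) (auto simp: st_def transpose_def)

lemma st_commute: "i + 1 < j \<or> j + 1 < i \<Longrightarrow> st i \<circ> st j = st j \<circ> st i"
  by (rule ext) (auto simp: st_def transpose_def)

text \<open>
  Matsumoto's theorem, by induction on the length. If the words start with the same letter, it is
  removed. If they start with different letters \<open>i\<close> and \<open>j\<close>, both are left descents of \<open>w\<close>, so \<open>w\<close>
  factors with additive lengths through the longest element of \<open>\<langle>s\<^sub>i, s\<^sub>j\<rangle>\<close>. Hence each of the words can
  be replaced, by the induction hypothesis behind the first letter, by one that starts with a
  reduced word of this longest element, and the two results differ by one relation.
\<close>

theorem matsumoto:
  fixes T :: "nat list \<Rightarrow> 'a"
  assumes cong: "\<And>i u v. i \<in> {1..<r} \<Longrightarrow> u \<in> lists {1..<r} \<Longrightarrow> v \<in> lists {1..<r} \<Longrightarrow>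
      T u = T v \<Longrightarrow> T (i # u) = T (i # v)"
    and braid: "\<And>i u. i \<in> {1..<r} \<Longrightarrow> i + 1 \<in> {1..<r} \<Longrightarrow> u \<in> lists {1..<r} \<Longrightarrow>
      T (i # (i + 1) # i # u) = T ((i + 1) # i # (i + 1) # u)"
    and commute: "\<And>i j u. i \<in> {1..<r} \<Longrightarrow> j \<in> {1..<r} \<Longrightarrow> i + 1 < j \<or> j + 1 < i \<Longrightarrow>
      u \<in> lists {1..<r} \<Longrightarrow> T (i # j # u) = T (j # i # u)"
    and red: "reduced r u" "reduced r v" "word_perm u = word_perm v"
  shows "T u = T v"
  using red
proof (induction "length u" arbitrary: u v rule: less_induct)
  case less
  have len: "length u = length v" using less.prems by (simp add: reduced_def)
  show ?case
  proof (cases u)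
    case Nil
    then show ?thesis using len by simp
  next
    case (Cons i u')
    then obtain j v' where v: "v = j # v'" using len by (cases v) auto
    note u = \<open>u = i # u'\<close>
    define w where "w = word_perm u"
    have w: "w permutes {1..r}"
      unfolding w_def using less.prems by (intro word_perm_permutes) (simp add: reduced_def)
    note iu = reduced_Cons[OF less.prems(1)[unfolded u]]
    note jv = reduced_Cons[OF less.prems(2)[unfolded v]]
    have wi: "st i \<circ> w = word_perm u'" and wj: "st j \<circ> w = word_perm v'"
      unfolding w_def u less.prems(3)[unfolded u v] by (simp_all only: word_perm_simps st_st_comp)
        (simp only: less.prems(3)[unfolded u v word_perm_simps, symmetric] st_st_comp)
    have lists: "u' \<in> lists {1..<r}" "v' \<in> lists {1..<r}" using iu jv by (auto simp: reduced_def)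
    have di: "inv' w (i + 1) < inv' w i"
      using iu(3) w inv_st_comp[OF w, of i] by (simp add: wi[symmetric] st_apply)
    have dj: "inv' w (j + 1) < inv' w j"
      using jv(3) w inv_st_comp[OF w, of j] by (simp add: wj[symmetric] st_apply)
    \<comment> \<open>Replaces one reduced word of \<open>st k \<circ> w\<close> by another one behind the letter \<open>k\<close>.\<close>
    have subst: "T (k # x) = T (k # y)"
      if "k \<in> {1..<r}" "reduced r x" "reduced r y" "word_perm x = word_perm y" "length x < length u" for k x y
      using that less.hyps[of x y] by (intro cong) (auto simp: reduced_def)
    have len': "length u' < length u" "length v' < length u" using u v len by auto
    \<comment> \<open>The case of the braid relation: \<open>w = s\<^sub>k s\<^sub>k\<^sub>+\<^sub>1 s\<^sub>k z\<close>, where \<open>z\<close> is shorter than \<open>w\<close> by three.\<close>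
    have adjacent: "T (k # x) = T ((k + 1) # y)"
      if k: "k \<in> {1..<r}" "k + 1 \<in> {1..<r}" and red: "reduced r x" "reduced r y"
        and w': "st k \<circ> w = word_perm x" "st (k + 1) \<circ> w = word_perm y"
        and less: "length x < length u" "length y < length u"
        and d: "inv' w (k + 1) < inv' w k" "inv' w (k + 1 + 1) < inv' w (k + 1)" for k x y
    proof -
      define z where "z = st k \<circ> (st (k + 1) \<circ> (st k \<circ> w))"
      have z: "z permutes {1..r}"
        unfolding z_def using w st_permutes k by (intro permutes_compose) auto
      obtain zs where zs: "reduced r zs" "word_perm zs = z" using exists_reduced[OF z] by auto
      have p1: "st k \<circ> w permutes {1..r}" and p2: "st (k + 1) \<circ> (st k \<circ> w) permutes {1..r}"
        using w st_permutes k by (auto intro!: permutes_compose)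
      have invz: "inv' z = inv' w \<circ> st k \<circ> st (k + 1) \<circ> st k"
        unfolding z_def by (simp only: inv_st_comp[OF w] inv_st_comp[OF p1] inv_st_comp[OF p2])
      have z': "z = st (k + 1) \<circ> (st k \<circ> (st (k + 1) \<circ> w))"
        using st_braid[of k] by (simp add: z_def comp_assoc[symmetric])
      have e1: "inv' (st k \<circ> z) = inv' z \<circ> st k" "inv' (st (k + 1) \<circ> z) = inv' z \<circ> st (k + 1)"
        by (rule inv_st_comp[OF z])+
      have r1: "reduced r (k # zs)" "reduced r ((k + 1) # zs)"
        using k zs(1) d by (auto intro!: reduced_ConsI simp: zs(2) invz st_def transpose_def)
      then have r2: "reduced r ((k + 1) # k # zs)" "reduced r (k # (k + 1) # zs)"
        using k zs(1) d by (auto intro!: reduced_ConsI simp: zs(2) e1 invz st_apply)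
      have "word_perm ((k + 1) # k # zs) = st k \<circ> w" "word_perm (k # (k + 1) # zs) = st (k + 1) \<circ> w"
        by (simp add: zs z_def st_st_comp, simp add: zs z' st_st_comp[simplified])
      then have "T (k # x) = T (k # (k + 1) # k # zs)"
        and "T ((k + 1) # y) = T ((k + 1) # k # (k + 1) # zs)"
        using k red w' less r2 by (auto intro!: subst)
      with braid[OF k, of zs] zs show ?thesis by (simp add: reduced_def)
    qed
    consider "i = j" | "i + 1 < j \<or> j + 1 < i" | "j = i + 1" | "i = j + 1" by linarith
    then show ?thesis
    proof cases
      case 1
      then have "word_perm u' = word_perm v'" using wi wj by simp
      then have "T (i # u') = T (i # v')" by (rule subst[OF iu(1,2) jv(2) _ len'(1)])
      then show ?thesis by (simp only: u v 1)
    next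
      case 2
      define z where "z = st j \<circ> (st i \<circ> w)"
      have z: "z permutes {1..r}"
        unfolding z_def using w st_permutes iu(1) jv(1) by (intro permutes_compose) auto
      obtain zs where zs: "reduced r zs" "word_perm zs = z" using exists_reduced[OF z] by auto
      have invz: "inv' z = inv' w \<circ> st i \<circ> st j"
        unfolding z_def using w st_permutes iu(1) jv(1)
        by (subst inv_st_comp[of _ "{1..r}"], intro permutes_compose) (auto simp: inv_st_comp)
      have zj: "word_perm (j # zs) = st i \<circ> w" by (simp add: zs z_def st_st_comp)
      have zi: "word_perm (i # zs) = st j \<circ> w"
        using st_commute[OF 2] by (simp add: zs z_def st_st_comp comp_assoc[symmetric])
      have "reduced r (j # zs)"
        using jv(1) zs dj 2 by (intro reduced_ConsI) (auto simp: invz st_def transpose_def)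
      then have a: "T u = T (i # j # zs)" unfolding u
        using iu zj wi len' by (intro subst) auto
      have "reduced r (i # zs)"
        using iu(1) zs di 2 by (intro reduced_ConsI) (auto simp: invz st_def transpose_def)
      then have b: "T v = T (j # i # zs)" unfolding v
        using jv zi wj len' by (intro subst) auto
      show ?thesis
        using a b commute[OF iu(1) jv(1) 2, of zs] zs by (simp add: reduced_def)
    next
      case 3
      then show ?thesis
        using adjacent[OF iu(1) jv(1)[unfolded 3] iu(2) jv(2) wi wj[unfolded 3] len' di
            dj[unfolded 3]]
        by (simp only: u v 3)
    next
      case 4
      then show ?thesis
        using adjacent[OF jv(1) iu(1)[unfolded 4] jv(2) iu(2) wj wi[unfolded 4] len'(2,1) dj
            di[unfolded 4]]
        by (simp only: u v 4)
    qed
  qed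
qed

section \<open>The standard basis of the Hecke algebra\<close>

lemma ring_extend:
  assumes "ring Q"
  shows "ring (ring.extend Q m)"
proof -
  interpret Q: ring Q by fact
  show ?thesis
  proof (rule ringI)
    show "abelian_group (ring.extend Q m)"
    proof (rule abelian_groupI)
      fix x assume "x \<in> carrier (ring.extend Q m)"
      then show "\<exists>y\<in>carrier (ring.extend Q m). y \<oplus>\<^bsub>ring.extend Q m\<^esub> x = \<zero>\<^bsub>ring.extend Q m\<^esub>"
        by (intro bexI[of _ "\<ominus>\<^bsub>Q\<^esub> x"]) (auto simp: ring.defs Q.l_neg)
    qed (auto simp: ring.defs Q.a_assoc intro: Q.a_comm)
    show "Group.monoid (ring.extend Q m)"
      by (rule monoidI) (auto simp: ring.defs Q.m_assoc)
  qed (auto simp: ring.defs Q.l_distr Q.r_distr)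
qed

locale hecke_algebra =
  fixes r :: nat
begin

abbreviation "Fr \<equiv> hecke_free r"
abbreviation "H \<equiv> hecke r"
abbreviation "J \<equiv> hecke_ideal r"
abbreviation "perms \<equiv> {w. w permutes {1..r}}"
abbreviation "words \<equiv> lists {1..<r}"
abbreviation hecke_mult (infixl "\<star>" 70) where "h \<star> k \<equiv> h \<otimes>\<^bsub>H\<^esub> k"

lemma monoid_words: "monoid (free_monoid {1..<r})"
  by (rule monoidI) (auto simp: free_monoid_def)

sublocale hf: concrete_monoid_algebra AA "free_monoid {1..<r}"
  by (intro concrete_monoid_algebra.intro AA_concrete monoid_words)

lemma free_monoid_simps [simp]:
  "carrier (free_monoid {1..<r}) = words" "monoid.mult (free_monoid {1..<r}) = (@)"
  "\<one>\<^bsub>free_monoid {1..<r}\<^esub> = []"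
  by (simp_all add: free_monoid_def)

lemma Fr_eq: "monoid_algebra AA (free_monoid {1..<r}) = Fr"
  by (simp add: hecke_free_def)

lemmas Fr_facts =
  hf.ring_F hf.single_carrier hf.smult_carrier hf.single_mult hf.smult_mult_left
  hf.smult_mult_right hf.one_F hf.idp.pairing_single hf.idp.pairing_smult hf.idp.pairing_add
  hf.idp.pairing_mult hf.idp.pairing_minus hf.mult_carrier hf.add_carrier
lemmas Fr_rules = Fr_facts[unfolded Fr_eq free_monoid_simps]

lemmas smult_Fr = hf.smult_F[unfolded Fr_eq]
lemmas add_Fr = hf.add_F[unfolded Fr_eq]

sublocale Fr: ring Fr
  by (rule Fr_rules)

lemma hecke_rels_carrier: "hecke_rels r \<subseteq> carrier Fr"
proof -
  have "single AA [i] \<in> carrier Fr" if "i \<in> {1..<r}" for i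
    using that by (auto intro: Fr_rules)
  moreover have "qq - 1 \<in> carrier AA" by (intro hf.diff_mem qq_AA hf.one_mem)
  ultimately show ?thesis
    unfolding hecke_rels_def Let_def
    by (auto intro!: Fr.minus_closed Fr.m_closed Fr.a_closed Fr_rules(3) Fr.one_closed qq_AA)
qed

sublocale J: ideal J Fr
  unfolding hecke_ideal_def by (rule Fr.genideal_ideal[OF hecke_rels_carrier])

lemma H_simps:
  "carrier H = carrier (Fr Quot J)" "monoid.mult H = monoid.mult (Fr Quot J)"
  "one H = one (Fr Quot J)" "ring.add H = ring.add (Fr Quot J)" "ring.zero H = ring.zero (Fr Quot J)"
  "a \<odot>\<^bsub>H\<^esub> h = (J +>\<^bsub>Fr\<^esub> (a \<odot>\<^bsub>Fr\<^esub> \<one>\<^bsub>Fr\<^esub>)) \<otimes>\<^bsub>H\<^esub> h"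
  by (simp_all add: hecke_def Let_def ring.defs module.defs)

sublocale H: ring H
  using ring_extend[OF J.quotient_is_ring] by (simp add: hecke_def Let_def)

definition cls :: "(nat list \<Rightarrow> ratfun) \<Rightarrow> hecke_elt" where
  "cls f = J +>\<^bsub>Fr\<^esub> f"

lemma H_cases:
  assumes "h \<in> carrier H"
  obtains f where "f \<in> carrier Fr" "h = cls f"
  using assms by (auto simp: H_simps FactRing_def A_RCOSETS_def' cls_def)

lemma cls_closed [intro, simp]: "f \<in> carrier Fr \<Longrightarrow> cls f \<in> carrier H"
  using ring_hom_closed[OF J.rcos_ring_hom] by (simp add: cls_def H_simps)

lemma cls_add: "f \<in> carrier Fr \<Longrightarrow> g \<in> carrier Fr \<Longrightarrow> cls (f \<oplus>\<^bsub>Fr\<^esub> g) = cls f \<oplus>\<^bsub>H\<^esub> cls g"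
  using ring_hom_add[OF J.rcos_ring_hom] by (simp add: cls_def H_simps)

lemma cls_mult: "f \<in> carrier Fr \<Longrightarrow> g \<in> carrier Fr \<Longrightarrow> cls (f \<otimes>\<^bsub>Fr\<^esub> g) = cls f \<star> cls g"
  using ring_hom_mult[OF J.rcos_ring_hom] by (simp add: cls_def H_simps)

lemma cls_one: "cls \<one>\<^bsub>Fr\<^esub> = \<one>\<^bsub>H\<^esub>"
  using ring_hom_one[OF J.rcos_ring_hom] by (simp add: cls_def H_simps)

lemma cls_eqI: "f \<in> carrier Fr \<Longrightarrow> g \<in> carrier Fr \<Longrightarrow> f \<ominus>\<^bsub>Fr\<^esub> g \<in> J \<Longrightarrow> cls f = cls g"
  using Fr.quotient_eq_iff_same_a_r_cos[OF J.is_ideal] by (simp add: cls_def)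

lemma cls_smult:
  assumes "a \<in> carrier AA" "f \<in> carrier Fr"
  shows "cls (a \<odot>\<^bsub>Fr\<^esub> f) = a \<odot>\<^bsub>H\<^esub> cls f"
  using assms Fr_rules(3)[OF assms(1) Fr.one_closed] Fr_rules(5)[OF assms(1) Fr.one_closed assms(2)]
  by (simp add: H_simps(6) flip: cls_def cls_mult)

lemma smult_closed [intro, simp]:
  "a \<in> carrier AA \<Longrightarrow> h \<in> carrier H \<Longrightarrow> a \<odot>\<^bsub>H\<^esub> h \<in> carrier H"
  by (metis H_cases cls_closed cls_smult Fr_rules(3))

lemma smult_add_right:
  "a \<in> carrier AA \<Longrightarrow> h \<in> carrier H \<Longrightarrow> k \<in> carrier H \<Longrightarrow>
    a \<odot>\<^bsub>H\<^esub> (h \<oplus>\<^bsub>H\<^esub> k) = a \<odot>\<^bsub>H\<^esub> h \<oplus>\<^bsub>H\<^esub> a \<odot>\<^bsub>H\<^esub> k"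
  using Fr_rules(3)[OF _ Fr.one_closed] by (simp add: H_simps(6) H.r_distr flip: cls_def)

lemma smult_mult_left:
  "a \<in> carrier AA \<Longrightarrow> h \<in> carrier H \<Longrightarrow> k \<in> carrier H \<Longrightarrow>
    (a \<odot>\<^bsub>H\<^esub> h) \<star> k = a \<odot>\<^bsub>H\<^esub> (h \<star> k)"
  using Fr_rules(3)[OF _ Fr.one_closed] by (simp add: H_simps(6) H.m_assoc flip: cls_def)

lemma smult_mult_right:
  assumes "a \<in> carrier AA" "h \<in> carrier H" "k \<in> carrier H"
  shows "h \<star> (a \<odot>\<^bsub>H\<^esub> k) = a \<odot>\<^bsub>H\<^esub> (h \<star> k)"
proof -
  obtain f g where "f \<in> carrier Fr" "h = cls f" "g \<in> carrier Fr" "k = cls g"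
    using assms H_cases by metis
  then show ?thesis
    using assms(1) Fr_rules(6)[of a f g]
    by (simp add: Fr_rules(3) flip: cls_smult cls_mult)
qed

lemma smult_one: "h \<in> carrier H \<Longrightarrow> 1 \<odot>\<^bsub>H\<^esub> h = h"
proof -
  assume h: "h \<in> carrier H"
  have "1 \<odot>\<^bsub>Fr\<^esub> \<one>\<^bsub>Fr\<^esub> = \<one>\<^bsub>Fr\<^esub>"
    by (simp add: smult_Fr)
  with h show ?thesis by (simp add: H_simps(6) cls_one flip: cls_def)
qed

lemma smult_assoc:
  assumes "a \<in> carrier AA" "b \<in> carrier AA" "h \<in> carrier H"
  shows "(a * b) \<odot>\<^bsub>H\<^esub> h = a \<odot>\<^bsub>H\<^esub> (b \<odot>\<^bsub>H\<^esub> h)"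
proof -
  obtain f where f: "f \<in> carrier Fr" "h = cls f" using assms H_cases by metis
  have "(a * b) \<odot>\<^bsub>Fr\<^esub> f = a \<odot>\<^bsub>Fr\<^esub> (b \<odot>\<^bsub>Fr\<^esub> f)"
    by (simp add: smult_Fr mult.assoc)
  then show ?thesis using f assms hf.mult_mem[of a b] by (simp add: Fr_rules(3) flip: cls_smult)
qed

lemma smult_add_left:
  assumes "a \<in> carrier AA" "b \<in> carrier AA" "h \<in> carrier H"
  shows "(a + b) \<odot>\<^bsub>H\<^esub> h = a \<odot>\<^bsub>H\<^esub> h \<oplus>\<^bsub>H\<^esub> b \<odot>\<^bsub>H\<^esub> h"
proof -
  obtain f where f: "f \<in> carrier Fr" "h = cls f" using assms H_cases by metis
  have "(a + b) \<odot>\<^bsub>Fr\<^esub> f = a \<odot>\<^bsub>Fr\<^esub> f \<oplus>\<^bsub>Fr\<^esub> b \<odot>\<^bsub>Fr\<^esub> f"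
    by (simp add: smult_Fr add_Fr distrib_right)
  then show ?thesis using f assms hf.add_mem[of a b]
    by (simp add: Fr_rules(3) flip: cls_smult cls_add)
qed

definition Tword :: "nat list \<Rightarrow> hecke_elt" where
  "Tword ws = cls (single AA ws)"

abbreviation T :: "(nat \<Rightarrow> nat) \<Rightarrow> hecke_elt" where
  "T \<equiv> hecke_T r"

lemma Tword_closed [intro, simp]: "ws \<in> words \<Longrightarrow> Tword ws \<in> carrier H"
  unfolding Tword_def by (intro cls_closed Fr_rules)

lemma Tword_append: "u \<in> words \<Longrightarrow> v \<in> words \<Longrightarrow> Tword (u @ v) = Tword u \<star> Tword v"
  using Fr_rules(4)[of u v] by (simp add: Tword_def Fr_rules(2) flip: cls_mult)

lemma Tword_Cons: "i \<in> {1..<r} \<Longrightarrow> u \<in> words \<Longrightarrow> Tword (i # u) = Tword [i] \<star> Tword u"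
  using Tword_append[of "[i]" u] by simp

lemma Tword_Nil: "Tword [] = \<one>\<^bsub>H\<^esub>"
  by (simp add: Tword_def Fr_rules(7)[symmetric] cls_one)

lemma rel_in_J: "x \<in> hecke_rels r \<Longrightarrow> x \<in> J"
  using Fr.genideal_self[OF hecke_rels_carrier] by (auto simp: hecke_ideal_def)

lemma single1: "i \<in> {1..<r} \<Longrightarrow> single AA [i] \<in> carrier Fr"
  by (intro Fr_rules) simp

lemma Tword_braid:
  assumes i: "i \<in> {1..<r}" "i + 1 \<in> {1..<r}"
  shows "Tword [i, i + 1, i] = Tword [i + 1, i, i + 1]"
proof -
  note s = single1[OF i(1)] single1[OF i(2)]
  let ?a = "single AA [i] \<otimes>\<^bsub>Fr\<^esub> single AA [i + 1] \<otimes>\<^bsub>Fr\<^esub> single AA [i]"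
  let ?b = "single AA [i + 1] \<otimes>\<^bsub>Fr\<^esub> single AA [i] \<otimes>\<^bsub>Fr\<^esub> single AA [i + 1]"
  have "?a \<ominus>\<^bsub>Fr\<^esub> ?b \<in> hecke_rels r"
    unfolding hecke_rels_def Let_def using i by blast
  then have "cls ?a = cls ?b"
    by (intro cls_eqI rel_in_J) (auto intro: s)
  then show ?thesis
    using i Fr_rules(4)[of "[i]" "[i + 1]"] Fr_rules(4)[of "[i + 1]" "[i]"]
      Fr_rules(4)[of "[i, i + 1]" "[i]"] Fr_rules(4)[of "[i + 1, i]" "[i + 1]"]
    by (simp add: Tword_def)
qed

lemma Tword_commute:
  assumes i: "i \<in> {1..<r}" "j \<in> {1..<r}" "i + 1 < j \<or> j + 1 < i"
  shows "Tword [i, j] = Tword [j, i]"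
proof -
  note s = single1[OF i(1)] single1[OF i(2)]
  let ?a = "single AA [i] \<otimes>\<^bsub>Fr\<^esub> single AA [j]"
  let ?b = "single AA [j] \<otimes>\<^bsub>Fr\<^esub> single AA [i]"
  have "?a \<ominus>\<^bsub>Fr\<^esub> ?b \<in> hecke_rels r"
    unfolding hecke_rels_def Let_def using i by blast
  then have "cls ?a = cls ?b"
    by (intro cls_eqI rel_in_J) (auto intro: s)
  then show ?thesis
    using i Fr_rules(4)[of "[i]" "[j]"] Fr_rules(4)[of "[j]" "[i]"] by (simp add: Tword_def)
qed

lemma qq1_AA: "qq - 1 \<in> carrier AA"
  by (intro hf.diff_mem qq_AA hf.one_mem)

lemma Tword_quadratic:
  assumes i: "i \<in> {1..<r}"
  shows "Tword [i] \<star> Tword [i] = (qq - 1) \<odot>\<^bsub>H\<^esub> Tword [i] \<oplus>\<^bsub>H\<^esub> qq \<odot>\<^bsub>H\<^esub> \<one>\<^bsub>H\<^esub>"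
proof -
  note s = single1[OF i]
  let ?a = "single AA [i] \<otimes>\<^bsub>Fr\<^esub> single AA [i]"
  let ?b = "(qq - 1) \<odot>\<^bsub>Fr\<^esub> single AA [i] \<oplus>\<^bsub>Fr\<^esub> qq \<odot>\<^bsub>Fr\<^esub> \<one>\<^bsub>Fr\<^esub>"
  have "?a \<ominus>\<^bsub>Fr\<^esub> ?b \<in> hecke_rels r"
    unfolding hecke_rels_def Let_def using i by blast
  then have "cls ?a = cls ?b"
    by (intro cls_eqI rel_in_J) (auto intro!: s Fr_rules(3) qq1_AA qq_AA)
  then show ?thesis
    using s qq1_AA qq_AA
    by (simp add: Tword_def cls_mult cls_add cls_smult Fr_rules(3) cls_one)
qed

text \<open>
  The choice of a reduced word in \<^const>\<open>hecke_T\<close> is immaterial.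
\<close>

lemma Tword_reduced_eq:
  assumes "reduced r u" "reduced r v" "word_perm u = word_perm v"
  shows "Tword u = Tword v"
proof (rule matsumoto[OF _ _ _ assms])
  fix i u v assume "i \<in> {1..<r}" "u \<in> words" "v \<in> words" "Tword u = Tword v"
  then show "Tword (i # u) = Tword (i # v)"
    using Tword_Cons[of i u] Tword_Cons[of i v] by simp
next
  fix i u assume "i \<in> {1..<r}" "i + 1 \<in> {1..<r}" "u \<in> words"
  then show "Tword (i # (i + 1) # i # u) = Tword ((i + 1) # i # (i + 1) # u)"
    using Tword_append[of "[i, i + 1, i]" u] Tword_append[of "[i + 1, i, i + 1]" u] Tword_braid[of i]
    by simp
next
  fix i j u assume "i \<in> {1..<r}" "j \<in> {1..<r}" "i + 1 < j \<or> j + 1 < i" "u \<in> words"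
  then show "Tword (i # j # u) = Tword (j # i # u)"
    using Tword_append[of "[i, j]" u] Tword_append[of "[j, i]" u] Tword_commute[of i j] by simp
qed

lemma T_eq_Tword: "reduced r ws \<Longrightarrow> T (word_perm ws) = Tword ws"
proof -
  assume ws: "reduced r ws"
  have "word_perm ws permutes {1..r}" using ws by (intro word_perm_permutes) (simp add: reduced_def)
  from reduced_word[OF this] ws show ?thesis
    using Tword_reduced_eq[of "reduced_word r (word_perm ws)" ws]
    by (simp add: hecke_T_def Tword_def cls_def)
qed

lemma T_closed [intro, simp]: "w permutes {1..r} \<Longrightarrow> T w \<in> carrier H"
  using reduced_word[of w r] T_eq_Tword[of "reduced_word r w"] by (auto simp: reduced_def)

lemma T_id: "T id = \<one>\<^bsub>H\<^esub>"
  using T_eq_Tword[of "[]"] by (simp add: reduced_def ell_id Tword_Nil)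

lemma T_st: "i \<in> {1..<r} \<Longrightarrow> T (st i) = Tword [i]"
  using T_eq_Tword[of "[i]"] by (simp add: reduced_def ell_st[of i r])

text \<open>
  If the lengths add up, the concatenation of two reduced words is reduced.
\<close>

lemma T_mult:
  assumes u: "u permutes {1..r}" and d: "d permutes {1..r}" and len: "ell (u \<circ> d) = ell u + ell d"
  shows "T u \<star> T d = T (u \<circ> d)"
proof -
  obtain a b where a: "reduced r a" "word_perm a = u" and b: "reduced r b" "word_perm b = d"
    using u d exists_reduced by metis
  then have "reduced r (a @ b)" using len by (simp add: reduced_def word_perm_append)
  from T_eq_Tword[OF this] show ?thesis
    using a b T_eq_Tword[of a] T_eq_Tword[of b]
    by (simp add: reduced_def word_perm_append Tword_append)
qed

lemma T_right_up:
  assumes "i \<in> {1..<r}" "w permutes {1..r}" "w i < w (i + 1)"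
  shows "T w \<star> Tword [i] = T (w \<circ> st i)"
  using T_mult[OF assms(2) st_permutes, of i] ell_comp_st_up[OF assms(2,3)] assms
  by (simp add: T_st ell_st[of i r])

lemma T_right_down:
  assumes i: "i \<in> {1..<r}" and w: "w permutes {1..r}" and down: "\<not> w i < w (i + 1)"
  shows "T w \<star> Tword [i] = (qq - 1) \<odot>\<^bsub>H\<^esub> T w \<oplus>\<^bsub>H\<^esub> qq \<odot>\<^bsub>H\<^esub> T (w \<circ> st i)"
proof -
  let ?v = "w \<circ> st i"
  have v: "?v permutes {1..r}" by (rule permutes_compose[OF st_permutes[OF i] w])
  have "w i \<noteq> w (i + 1)" using permutes_inj[OF w] by (simp add: inj_eq)
  then have up: "?v i < ?v (i + 1)" using down by (simp add: st_apply)
  have Tw: "T ?v \<star> Tword [i] = T w"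
    using T_right_up[OF i v up] by (simp only: st_st_comp)
  have i': "Tword [i] \<in> carrier H" using i by simp
  have "T w \<star> Tword [i] = T ?v \<star> (Tword [i] \<star> Tword [i])"
    using v i' by (simp only: Tw[symmetric] H.m_assoc T_closed)
  also have "\<dots> = (qq - 1) \<odot>\<^bsub>H\<^esub> (T ?v \<star> Tword [i]) \<oplus>\<^bsub>H\<^esub> qq \<odot>\<^bsub>H\<^esub> T ?v"
    using v i' qq1_AA qq_AA T_closed[OF v]
    by (simp only: Tword_quadratic[OF i] H.r_distr smult_closed H.one_closed smult_mult_right H.r_one)
  finally show ?thesis by (simp only: Tw)
qed

subsection \<open>Coefficients\<close>

text \<open>
  Left multiplication by \<open>T\<^sub>i\<close> on coefficient functions. The argument is \<open>v = w\<^sup>-\<^sup>1\<close>, so that \<open>s\<^sub>i w\<close>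
  becomes \<open>v \<circ> s\<^sub>i\<close> and the lengths of \<open>w\<close> and \<open>s\<^sub>i w\<close> are compared through \<open>v i\<close> and \<open>v (i + 1)\<close>. The
  formula makes sense for an arbitrary map \<open>v\<close>, and the Hecke relations hold for all of them, which
  keeps permutations out of their verification.
\<close>

definition opL :: "nat \<Rightarrow> ((nat \<Rightarrow> nat) \<Rightarrow> ratfun) \<Rightarrow> (nat \<Rightarrow> nat) \<Rightarrow> ratfun" where
  "opL i f v = (if v i < v (i + 1) then qq * f (v \<circ> st i) else f (v \<circ> st i) + (qq - 1) * f v)"

lemma comp_st_eq: "v i = v (i + 1) \<Longrightarrow> v \<circ> st i = v"
  by (auto simp: fun_eq_iff st_def transpose_def)

lemma opL_quadratic: "opL i (opL i f) v = (qq - 1) * opL i f v + qq * f v"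
proof -
  define j where "j = i + 1"
  note op = opL_def[of i, folded j_def]
  have s: "st i i = j" "st i j = i" by (simp_all add: st_apply j_def)
  have e: "v i = v j \<Longrightarrow> v \<circ> st i = v" using comp_st_eq[of v i] by (simp only: j_def)
  show ?thesis
    by (cases "v i" "v j" rule: linorder_cases)
       (simp_all add: op st_st_comp s e algebra_simps)
qed

lemma opL_commute:
  assumes "i + 1 < j \<or> j + 1 < i"
  shows "opL i (opL j f) v = opL j (opL i f) v"
proof -
  define i' j' where "i' = i + 1" and "j' = j + 1"
  note op = opL_def[of i, folded i'_def] opL_def[of j, folded j'_def]
  have "v \<circ> st i \<circ> st j = v \<circ> st j \<circ> st i" using st_commute[OF assms] by (simp add: comp_assoc)
  moreover have "st i j = j" "st i j' = j'" "st j i = i" "st j i' = i'"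
    using assms by (auto simp: st_apply i'_def j'_def)
  ultimately show ?thesis by (simp add: op algebra_simps)
qed

text \<open>
  Both sides depend only on the relative order of the three values of \<open>v\<close> at \<open>i\<close>, \<open>i + 1\<close>, \<open>i + 2\<close>; if
  two of them agree, some of the six rearrangements of \<open>v\<close> coincide.
\<close>

lemma opL_braid: "opL i (opL (i + 1) (opL i f)) v = opL (i + 1) (opL i (opL (i + 1) f)) v"
proof -
  define j k where "j = i + 1" and "k = i + 1 + 1"
  let ?s = "st i" and ?t = "st j"
  note op = opL_def[of i, folded j_def] opL_def[of j, unfolded j_def, folded k_def, folded j_def]
  have b: "v \<circ> ?t \<circ> ?s \<circ> ?t = v \<circ> ?s \<circ> ?t \<circ> ?s"
    using st_braid[of i] by (simp add: comp_assoc j_def)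
  have s: "?s i = j" "?s j = i" "?s k = k" "?t i = i" "?t j = k" "?t k = j"
    by (auto simp: st_apply j_def k_def)
  have eq: "v i = v j \<Longrightarrow> v \<circ> ?s = v" "v j = v k \<Longrightarrow> v \<circ> ?t = v"
    using comp_st_eq[of v i] comp_st_eq[of v j] by (simp_all only: j_def k_def)
  have eq': "v \<circ> ?s \<circ> ?t = v \<circ> ?s" "v \<circ> ?t \<circ> ?s = v \<circ> ?t" if "v i = v k"
    using comp_st_eq[of "v \<circ> ?s" j] comp_st_eq[of "v \<circ> ?t" i] that s
    by (simp_all add: j_def k_def)
  have eq'': "v \<circ> ?s \<circ> ?t \<circ> ?s = v \<circ> ?s \<circ> ?t" if "v j = v k"
    using comp_st_eq[of "v \<circ> ?s \<circ> ?t" i] that s by (simp add: j_def k_def)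
  have "opL i (opL j (opL i f)) v = opL j (opL i (opL j f)) v"
    by (cases "v i" "v j" rule: linorder_cases;
        cases "v j" "v k" rule: linorder_cases;
        cases "v i" "v k" rule: linorder_cases;
        simp add: op s b eq eq' eq'' st_st_comp; simp add: algebra_simps)
  then show ?thesis by (simp only: j_def)
qed

definition opW :: "nat list \<Rightarrow> ((nat \<Rightarrow> nat) \<Rightarrow> ratfun) \<Rightarrow> (nat \<Rightarrow> nat) \<Rightarrow> ratfun" where
  "opW ws f = foldr opL ws f"

lemma opW_simps [simp]: "opW [] f = f" "opW (i # ws) f = opL i (opW ws f)"
  by (simp_all add: opW_def)

lemma opW_append: "opW (u @ v) f = opW u (opW v f)"
  by (simp add: opW_def)

lemma opL_linear: "opL i (\<lambda>v. a * f v + b * g v) v = a * opL i f v + b * opL i g v"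
  by (simp add: opL_def algebra_simps)

lemma opW_linear: "opW u (\<lambda>v. a * f v + b * g v) v = a * opW u f v + b * opW u g v"
proof (induction u arbitrary: v)
  case (Cons i u)
  then have "opW u (\<lambda>v. a * f v + b * g v) = (\<lambda>v. a * opW u f v + b * opW u g v)" by auto
  then show ?case by (simp add: opL_linear)
qed simp

text \<open>
  The coefficient of \<open>T\<^sub>w\<close> in the product of the generators named by a word: the operators are applied to
  the coefficient function of \<open>1\<close>.
\<close>

definition coef_fun :: "(nat \<Rightarrow> nat) \<Rightarrow> nat list \<Rightarrow> ratfun" where
  "coef_fun w ws = opW ws (\<lambda>v. if v = id then 1 else 0) (inv' w)"

lemma coef_fun_rels:
  assumes s: "s \<in> hecke_rels r" and uv: "u \<in> words" "v \<in> words"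
  shows "pairing (\<lambda>a. a) s (\<lambda>m. coef_fun w (u @ m @ v)) = 0"
proof -
  define f where "f = opW v (\<lambda>v. if v = id then 1 else (0::ratfun))"
  let ?\<phi> = "\<lambda>m. opW u (opW m f) (inv' w)"
  have \<phi>: "coef_fun w (u @ m @ v) = ?\<phi> m" for m
    by (simp add: coef_fun_def opW_append f_def)
  consider (q) i where "i \<in> {1..<r}"
      "s = single AA [i] \<otimes>\<^bsub>Fr\<^esub> single AA [i] \<ominus>\<^bsub>Fr\<^esub>
          ((qq - 1) \<odot>\<^bsub>Fr\<^esub> single AA [i] \<oplus>\<^bsub>Fr\<^esub> qq \<odot>\<^bsub>Fr\<^esub> \<one>\<^bsub>Fr\<^esub>)"
    | (b) i where "i \<in> {1..<r}" "i + 1 \<in> {1..<r}"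
      "s = single AA [i] \<otimes>\<^bsub>Fr\<^esub> single AA [i + 1] \<otimes>\<^bsub>Fr\<^esub> single AA [i] \<ominus>\<^bsub>Fr\<^esub>
           single AA [i + 1] \<otimes>\<^bsub>Fr\<^esub> single AA [i] \<otimes>\<^bsub>Fr\<^esub> single AA [i + 1]"
    | (c) i j where "i \<in> {1..<r}" "j \<in> {1..<r}" "i + 1 < j \<or> j + 1 < i"
      "s = single AA [i] \<otimes>\<^bsub>Fr\<^esub> single AA [j] \<ominus>\<^bsub>Fr\<^esub> single AA [j] \<otimes>\<^bsub>Fr\<^esub> single AA [i]"
    using s unfolding hecke_rels_def Let_def by blast
  then have "pairing (\<lambda>a. a) s ?\<phi> = 0"
  proof cases
    case q
    have e: "opL i (opL i f) = (\<lambda>v. (qq - 1) * opL i f v + qq * f v)"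
      by (rule ext) (rule opL_quadratic)
    note s = single1[OF q(1)]
    show ?thesis
      unfolding q(2) Fr_rules(7)
      using s qq1_AA qq_AA Fr_rules(2)[of "[]"]
      by (simp add: Fr_rules e opW_linear)
  next
    case b
    have e: "opL i (opL (i + 1) (opL i f)) = opL (i + 1) (opL i (opL (i + 1) f))"
      by (rule ext) (rule opL_braid)
    note s = single1[OF b(1)] single1[OF b(2)]
    show ?thesis
      unfolding b(3) using s by (simp add: Fr_rules e)
  next
    case c
    have e: "opL i (opL j f) = opL j (opL i f)"
      by (rule ext) (rule opL_commute[OF c(3)])
    note s = single1[OF c(1)] single1[OF c(2)]
    show ?thesis
      unfolding c(4) using s by (simp add: Fr_rules e)
  qed
  then show ?thesis by (simp add: \<phi>)
qed

text \<open>
  The value \<open>0\<close> outside \<open>\<SS>\<^sub>r\<close> makes the coefficient function of an element unique.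
\<close>

definition coef :: "hecke_elt \<Rightarrow> (nat \<Rightarrow> nat) \<Rightarrow> ratfun" where
  "coef h w = (if w permutes {1..r} then hf.idp.coset_pairing h (coef_fun w) else 0)"

lemma coef_cls:
  assumes "f \<in> carrier Fr" "w permutes {1..r}"
  shows "coef (cls f) w = pairing (\<lambda>a. a) f (coef_fun w)"
proof -
  have "pairing (\<lambda>a. a) z (coef_fun w) = 0" if "z \<in> J" for z
    using hf.idp.pairing_genideal[of "hecke_rels r" "coef_fun w" z] hecke_rels_carrier
      coef_fun_rels that by (simp add: Fr_eq hecke_ideal_def)
  then show ?thesis
    using hf.idp.coset_pairing[of J "coef_fun w" f] assms J.is_ideal
    by (simp add: Fr_eq coef_def cls_def)
qed

lemma coef_outside: "\<not> w permutes {1..r} \<Longrightarrow> coef h w = 0"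
  by (simp add: coef_def)

lemma coef_add: "h \<in> carrier H \<Longrightarrow> k \<in> carrier H \<Longrightarrow> coef (h \<oplus>\<^bsub>H\<^esub> k) w = coef h w + coef k w"
proof (cases "w permutes {1..r}")
  case True
  assume "h \<in> carrier H" "k \<in> carrier H"
  then obtain f g where "f \<in> carrier Fr" "h = cls f" "g \<in> carrier Fr" "k = cls g"
    using H_cases by metis
  with True show ?thesis by (simp add: coef_cls Fr_rules flip: cls_add)
qed (simp add: coef_outside)

lemma coef_smult: "a \<in> carrier AA \<Longrightarrow> h \<in> carrier H \<Longrightarrow> coef (a \<odot>\<^bsub>H\<^esub> h) w = a * coef h w"
proof (cases "w permutes {1..r}")
  case True
  assume "a \<in> carrier AA" "h \<in> carrier H"
  moreover then obtain f where "f \<in> carrier Fr" "h = cls f" using H_cases by metis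
  ultimately show ?thesis using True by (simp add: coef_cls Fr_rules flip: cls_smult)
qed (simp add: coef_outside)

lemma coef_zero: "coef \<zero>\<^bsub>H\<^esub> w = 0"
  using coef_add[of "\<zero>\<^bsub>H\<^esub>" "\<zero>\<^bsub>H\<^esub>" w] by simp

lemma coef_left:
  assumes i: "i \<in> {1..<r}" and h: "h \<in> carrier H" and w: "w permutes {1..r}"
  shows "coef (Tword [i] \<star> h) w =
    (if inv' w i < inv' w (i + 1) then qq * coef h (st i \<circ> w)
     else coef h (st i \<circ> w) + (qq - 1) * coef h w)"
proof -
  obtain f where f: "f \<in> carrier Fr" "h = cls f" using h H_cases by metis
  have sw: "st i \<circ> w permutes {1..r}" by (rule permutes_compose[OF w st_permutes[OF i]])
  have "coef (Tword [i] \<star> h) w = pairing (\<lambda>a. a) f (\<lambda>m. coef_fun w (i # m))"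
    using f w single1[OF i] by (simp add: Tword_def coef_cls Fr_rules flip: cls_mult)
  also have "(\<lambda>m. coef_fun w (i # m)) =
    (\<lambda>m. if inv' w i < inv' w (i + 1) then qq * coef_fun (st i \<circ> w) m
      else coef_fun (st i \<circ> w) m + (qq - 1) * coef_fun w m)"
    by (rule ext) (simp add: coef_fun_def opL_def inv_st_comp[OF w])
  finally show ?thesis
    using f w sw
    by (cases "inv' w i < inv' w (i + 1)")
       (simp_all add: coef_cls pairing_def sum_distrib_left sum.distrib[symmetric]
          sum_subtractf[symmetric] algebra_simps)
qed

text \<open>
  Along a reduced word every letter increases the length, so \<open>opL\<close> turns the indicator of one
  permutation into the indicator of the next one.
\<close>

lemma coef_T:
  assumes "u permutes {1..r}"
  shows "coef (T u) w = (if w = u then 1 else 0)"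
proof (cases "w permutes {1..r}")
  case w: True
  have *: "coef (Tword ws) w = (if w = word_perm ws then 1 else 0)"
    if "reduced r ws" "w permutes {1..r}" for ws w
    using that
  proof (induction ws arbitrary: w)
    case Nil
    have "inv' w = id \<longleftrightarrow> w = id"
      by (metis Nil.prems(2) inv_id inv_inv_eq permutes_bij)
    moreover have "coef (Tword []) w = coef_fun w []"
      using Nil.prems Fr_rules(2)[of "[]"] by (simp add: Tword_def coef_cls Fr_rules)
    ultimately show ?case by (simp only: coef_fun_def opW_simps word_perm_simps)
  next
    case (Cons i ws)
    note red = reduced_Cons[OF Cons.prems(1)]
    have ws: "ws \<in> words" using red by (simp add: reduced_def)
    have sw: "st i \<circ> w permutes {1..r}"
      by (rule permutes_compose[OF Cons.prems(2) st_permutes[OF red(1)]])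
    have e: "st i \<circ> w = word_perm ws \<longleftrightarrow> w = st i \<circ> word_perm ws"
      by (metis st_st_comp(1))
    have no: "w \<noteq> word_perm ws" if "\<not> inv' w i < inv' w (i + 1)" using that red(3) by auto
    have no': "w \<noteq> st i \<circ> word_perm ws" if "inv' w i < inv' w (i + 1)"
    proof
      assume w': "w = st i \<circ> word_perm ws"
      have "inv' w = inv' (word_perm ws) \<circ> st i"
        unfolding w' by (rule inv_st_comp[OF word_perm_permutes[OF ws]])
      with that red(3) show False by (simp add: st_apply)
    qed
    have p: "word_perm (i # ws) = st i \<circ> word_perm ws" by (rule word_perm_simps)
    note coefs = Tword_Cons[OF red(1) ws] coef_left[OF red(1) Tword_closed[OF ws] Cons.prems(2)]
      Cons.IH[OF red(2) sw] Cons.IH[OF red(2) Cons.prems(2)] e p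
    show ?case
    proof (cases "inv' w i < inv' w (i + 1)")
      case True
      then show ?thesis by (simp only: coefs no'[OF True] if_True if_False mult_zero_right)
    next
      case False
      then show ?thesis
        by (simp only: coefs no[OF False] if_False mult_zero_right add_0_right)
    qed
  qed
  show ?thesis
    using *[OF _ w] reduced_word[OF assms] T_eq_Tword[of "reduced_word r u"] by metis
qed (use assms in \<open>auto simp: coef_outside\<close>)

lemma finite_perms: "finite perms"
  by (rule finite_permutations) simp

lemma coef_finsum:
  assumes "finite S" "g \<in> S \<rightarrow> carrier H"
  shows "coef (finsum H g S) w = (\<Sum>s\<in>S. coef (g s) w)"
  using assms by (induction S rule: finite_induct) (auto simp: coef_zero coef_add)

definition elt :: "((nat \<Rightarrow> nat) \<Rightarrow> ratfun) \<Rightarrow> hecke_elt" where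
  "elt a = (\<Oplus>\<^bsub>H\<^esub>w\<in>perms. a w \<odot>\<^bsub>H\<^esub> T w)"

lemma elt_closed: "(\<And>w. w permutes {1..r} \<Longrightarrow> a w \<in> carrier AA) \<Longrightarrow> elt a \<in> carrier H"
  unfolding elt_def by (rule H.finsum_closed) auto

lemma coef_elt:
  assumes "\<And>w. w permutes {1..r} \<Longrightarrow> a w \<in> carrier AA" "w permutes {1..r}"
  shows "coef (elt a) w = a w"
proof -
  have "coef (elt a) w = (\<Sum>u\<in>perms. a u * (if w = u then 1 else 0))"
    unfolding elt_def using assms(1)
    by (subst coef_finsum[OF finite_perms]) (auto simp: coef_smult coef_T)
  also have "\<dots> = a w" using assms(2) finite_perms by (simp add: if_distrib cong: if_cong)
  finally show ?thesis .
qed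

definition spanned :: "hecke_elt set" where
  "spanned = {elt a | a. \<forall>w. w permutes {1..r} \<longrightarrow> a w \<in> carrier AA}"

lemma spanned_add:
  assumes "h \<in> spanned" "k \<in> spanned"
  shows "h \<oplus>\<^bsub>H\<^esub> k \<in> spanned"
proof -
  obtain a b where ab: "h = elt a" "k = elt b"
    "\<And>w. w permutes {1..r} \<Longrightarrow> a w \<in> carrier AA" "\<And>w. w permutes {1..r} \<Longrightarrow> b w \<in> carrier AA"
    using assms by (auto simp: spanned_def)
  have "h \<oplus>\<^bsub>H\<^esub> k = (\<Oplus>\<^bsub>H\<^esub>w\<in>perms. a w \<odot>\<^bsub>H\<^esub> T w \<oplus>\<^bsub>H\<^esub> b w \<odot>\<^bsub>H\<^esub> T w)"
    unfolding ab elt_def using ab by (intro H.finsum_addf[symmetric]) auto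
  also have "\<dots> = elt (\<lambda>w. a w + b w)"
    unfolding elt_def using ab by (intro H.finsum_cong') (auto simp: smult_add_left hf.add_mem)
  finally show ?thesis using ab hf.add_mem unfolding spanned_def by blast
qed

lemma spanned_smult:
  assumes "h \<in> spanned" and c: "c \<in> carrier AA"
  shows "c \<odot>\<^bsub>H\<^esub> h \<in> spanned"
proof -
  obtain a where a: "h = elt a" "\<And>w. w permutes {1..r} \<Longrightarrow> a w \<in> carrier AA"
    using assms by (auto simp: spanned_def)
  have c1: "cls (c \<odot>\<^bsub>Fr\<^esub> \<one>\<^bsub>Fr\<^esub>) \<in> carrier H" using c by (intro cls_closed Fr_rules(3)) auto
  have "c \<odot>\<^bsub>H\<^esub> h = (\<Oplus>\<^bsub>H\<^esub>w\<in>perms. c \<odot>\<^bsub>H\<^esub> (a w \<odot>\<^bsub>H\<^esub> T w))"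
    unfolding a elt_def H_simps(6)[of c] using a c1
    by (intro H.finsum_rdistr finite_perms) (auto simp flip: cls_def)
  also have "\<dots> = elt (\<lambda>w. c * a w)"
    unfolding elt_def using a c by (intro H.finsum_cong') (auto simp: smult_assoc hf.mult_mem)
  finally show ?thesis using a c hf.mult_mem unfolding spanned_def by blast
qed

lemma spanned_T:
  assumes u: "u permutes {1..r}"
  shows "T u \<in> spanned"
proof -
  let ?a = "\<lambda>w. if w = u then 1 else 0 :: ratfun"
  have "elt ?a = (\<Oplus>\<^bsub>H\<^esub>w\<in>perms. if u = w then T u else \<zero>\<^bsub>H\<^esub>)"
    unfolding elt_def
  proof (rule H.finsum_cong')
    fix w assume "w \<in> perms"
    moreover have "0 \<odot>\<^bsub>H\<^esub> T w = \<zero>\<^bsub>H\<^esub>" if "w permutes {1..r}"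
      using smult_add_left[of 0 0 "T w"] that hf.zero_mem by simp
    ultimately show "?a w \<odot>\<^bsub>H\<^esub> T w = (if u = w then T u else \<zero>\<^bsub>H\<^esub>)"
      by (simp add: smult_one)
  qed (use u in auto)
  also have "\<dots> = T u"
    using u finite_perms H.add.finprod_singleton[of u perms "\<lambda>_. T u"] by (simp add: finsum_def)
  finally show ?thesis
    unfolding spanned_def using hf.one_mem hf.zero_mem by (intro CollectI exI[of _ ?a]) auto
qed

lemma spanned_finsum:
  "finite S \<Longrightarrow> (\<And>s. s \<in> S \<Longrightarrow> g s \<in> spanned) \<Longrightarrow> finsum H g S \<in> spanned"
proof (induction S rule: finite_induct)
  case empty
  have "0 \<odot>\<^bsub>H\<^esub> T id \<in> spanned"
    using hf.zero_mem by (intro spanned_smult spanned_T) (auto simp: permutes_id)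
  moreover have "0 \<odot>\<^bsub>H\<^esub> T id = \<zero>\<^bsub>H\<^esub>"
    using smult_add_left[of 0 0 "T id"] hf.zero_mem permutes_id by simp
  ultimately show ?case by simp
next
  case (insert s S)
  have "spanned \<subseteq> carrier H" by (auto simp: spanned_def intro: elt_closed)
  with insert show ?case by (subst H.finsum_insert) (auto intro: spanned_add)
qed

text \<open>
  The span of the \<open>T\<^sub>w\<close> contains \<open>1\<close> and is stable under right multiplication by the generators.
\<close>

lemma spanned_all: "carrier H = spanned"
proof
  show "spanned \<subseteq> carrier H" by (auto simp: spanned_def intro: elt_closed)
  have right: "h \<star> Tword [i] \<in> spanned" if h: "h \<in> spanned" and i: "i \<in> {1..<r}" for h i
  proof -
    obtain a where a: "h = elt a" "\<And>w. w permutes {1..r} \<Longrightarrow> a w \<in> carrier AA"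
      using h by (auto simp: spanned_def)
    have "h \<star> Tword [i] = (\<Oplus>\<^bsub>H\<^esub>w\<in>perms. (a w \<odot>\<^bsub>H\<^esub> T w) \<star> Tword [i])"
      unfolding a elt_def using a i by (intro H.finsum_ldistr finite_perms) auto
    also have "\<dots> \<in> spanned"
    proof (rule spanned_finsum[OF finite_perms])
      fix w assume w: "w \<in> perms"
      have ws: "w \<circ> st i permutes {1..r}" using w permutes_compose[OF st_permutes[OF i]] by auto
      have "T w \<star> Tword [i] \<in> spanned"
        using w ws i T_right_up[of i w] T_right_down[of i w] qq_AA qq1_AA
        by (cases "w i < w (i + 1)") (auto intro: spanned_T spanned_add spanned_smult)
      then show "(a w \<odot>\<^bsub>H\<^esub> T w) \<star> Tword [i] \<in> spanned"
        using w a i by (subst smult_mult_left) (auto intro: spanned_smult)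
    qed
    finally show ?thesis .
  qed
  have word: "Tword ws \<in> spanned" if "ws \<in> words" for ws
    using that
  proof (induction ws rule: rev_induct)
    case Nil
    then show ?case using spanned_T[OF permutes_id] by (simp add: T_id Tword_Nil)
  next
    case (snoc i ws)
    then show ?case by (auto simp: Tword_append intro!: right)
  qed
  show "carrier H \<subseteq> spanned"
  proof
    fix h assume "h \<in> carrier H"
    then obtain f where "f \<in> carrier Fr" and h: "h = cls f" by (rule H_cases)
    then have "f \<in> carrier (monoid_algebra AA (free_monoid {1..<r}))" by (simp add: Fr_eq)
    then have "cls f \<in> spanned"
    proof (induction f rule: hf.F_induct)
      case (single a m)
      then show ?case
        using word[of m] by (simp add: Fr_eq cls_smult Fr_rules(2) Tword_def[symmetric] spanned_smult)
    next
      case (add f g)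
      then show ?case by (simp add: Fr_eq cls_add spanned_add)
    qed
    then show "h \<in> spanned" by (simp add: h)
  qed
qed

lemma elt_coef:
  assumes "h \<in> carrier H"
  shows "elt (coef h) = h"
proof -
  obtain a where a: "h = elt a" "\<And>w. w permutes {1..r} \<Longrightarrow> a w \<in> carrier AA"
    using assms by (auto simp: spanned_all spanned_def)
  have "coef h w = a w" if "w permutes {1..r}" for w
    unfolding a(1) using a(2) that by (rule coef_elt)
  then have "elt (coef h) = elt a"
    unfolding elt_def by (intro H.finsum_cong') (use a(2) in auto)
  then show ?thesis by (simp only: a(1))
qed

lemma coef_AA: "h \<in> carrier H \<Longrightarrow> coef h w \<in> carrier AA"
  by (cases "w permutes {1..r}")
     (auto simp: spanned_all spanned_def coef_elt coef_outside hf.zero_mem)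

lemma H_eqI:
  assumes "h \<in> carrier H" "k \<in> carrier H" "\<And>w. w permutes {1..r} \<Longrightarrow> coef h w = coef k w"
  shows "h = k"
proof -
  have "coef h = coef k" using assms(3) by (auto simp: fun_eq_iff coef_def)
  then show ?thesis using elt_coef[OF assms(1)] elt_coef[OF assms(2)] by metis
qed

lemma coef_right:
  assumes i: "i \<in> {1..<r}" and h: "h \<in> carrier H" and w: "w permutes {1..r}"
  shows "coef (h \<star> Tword [i]) w =
    (if w i < w (i + 1) then qq * coef h (w \<circ> st i)
     else coef h (w \<circ> st i) + (qq - 1) * coef h w)"
proof -
  let ?R = "\<lambda>f. if w i < w (i + 1) then qq * f (w \<circ> st i) else f (w \<circ> st i) + (qq - 1) * f w"
  have T: "coef (T u \<star> Tword [i]) w = ?R (coef (T u))" if u: "u permutes {1..r}" for u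
  proof -
    have us: "u \<circ> st i permutes {1..r}" using u permutes_compose[OF st_permutes[OF i]] by auto
    have e: "w \<circ> st i = u \<longleftrightarrow> w = u \<circ> st i" by (metis st_st_comp(2))
    have ne: "u i \<noteq> u (i + 1)" using permutes_inj[OF u] by (simp add: inj_eq)
    have ne': "u \<circ> st i \<noteq> u" using ne by (metis comp_apply st_apply(1))
    show ?thesis
    proof (cases "u i < u (i + 1)")
      case True
      then show ?thesis using T_right_up[OF i u] us u e ne' by (auto simp: coef_T st_apply)
    next
      case False
      have *: "coef (T u \<star> Tword [i]) w
          = (qq - 1) * (if w = u then 1 else 0) + qq * (if w = u \<circ> st i then 1 else 0)"
        using T_right_down[OF i u False] us u qq_AA qq1_AA
        by (simp add: coef_T coef_add coef_smult)
      consider "w = u" | "w = u \<circ> st i" | "w \<noteq> u" "w \<noteq> u \<circ> st i" by blast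
      then show ?thesis
      proof cases
        case 1
        show ?thesis unfolding * using False ne' by (simp add: 1 coef_T[OF u] ne'[symmetric])
      next
        case 2
        have "w i < w (i + 1)" using False ne by (simp add: 2 st_apply)
        moreover have "w \<circ> st i = u" by (simp only: 2 st_st_comp)
        ultimately show ?thesis unfolding * using ne' by (simp add: 2 coef_T[OF u])
      next
        case 3
        then show ?thesis unfolding * by (simp add: e coef_T[OF u])
      qed
    qed
  qed
  have "elt (coef h) \<star> Tword [i] = (\<Oplus>\<^bsub>H\<^esub>u\<in>perms. (coef h u \<odot>\<^bsub>H\<^esub> T u) \<star> Tword [i])"
    unfolding elt_def using i coef_AA[OF h] by (intro H.finsum_ldistr finite_perms) auto
  then have "coef (h \<star> Tword [i]) w
      = (\<Sum>u\<in>perms. coef ((coef h u \<odot>\<^bsub>H\<^esub> T u) \<star> Tword [i]) w)"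
    unfolding elt_coef[OF h] using i coef_AA[OF h]
    by (simp only:, intro coef_finsum finite_perms) auto
  also have "\<dots> = (\<Sum>u\<in>perms. coef h u * ?R (coef (T u)))"
  proof (rule sum.cong[OF refl])
    fix u assume u: "u \<in> perms"
    then have "coef ((coef h u \<odot>\<^bsub>H\<^esub> T u) \<star> Tword [i]) w = coef h u * coef (T u \<star> Tword [i]) w"
      using i coef_AA[OF h] by (subst smult_mult_left) (auto intro!: coef_smult)
    then show "coef ((coef h u \<odot>\<^bsub>H\<^esub> T u) \<star> Tword [i]) w = coef h u * ?R (coef (T u))"
      using T u by simp
  qed
  also have "\<dots> = ?R (\<lambda>v. \<Sum>u\<in>perms. coef h u * coef (T u) v)"
    by (cases "w i < w (i + 1)")
       (simp_all add: sum_distrib_left sum.distrib[symmetric] sum_subtractf[symmetric] algebra_simps)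
  also have "(\<lambda>v. \<Sum>u\<in>perms. coef h u * coef (T u) v) = coef h"
  proof
    fix v
    have "(\<Sum>u\<in>perms. coef h u * coef (T u) v) = coef (elt (coef h)) v"
      unfolding elt_def using h coef_AA
      by (subst coef_finsum[OF finite_perms]) (auto simp: coef_smult)
    then show "(\<Sum>u\<in>perms. coef h u * coef (T u) v) = coef h v" by (simp add: elt_coef[OF h])
  qed
  finally show ?thesis .
qed

text \<open>
  The coefficient of \<open>T\<^sub>i y\<close> at \<open>w\<close> is \<open>q\<close> times that of \<open>y\<close> at \<open>s\<^sub>i w\<close> if \<open>s\<^sub>i w\<close> is longer than \<open>w\<close>, and
  differs from it by \<open>q - 1\<close> times the coefficient at \<open>w\<close> otherwise. In both cases \<open>T\<^sub>i y = q y\<close> says that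
  the two coefficients of \<open>y\<close> agree.
\<close>

lemma left_eigen_iff:
  assumes i: "i \<in> {1..<r}" and h: "h \<in> carrier H"
  shows "Tword [i] \<star> h = qq \<odot>\<^bsub>H\<^esub> h \<longleftrightarrow>
    (\<forall>w. w permutes {1..r} \<longrightarrow> coef h (st i \<circ> w) = coef h w)"
proof
  assume e: "Tword [i] \<star> h = qq \<odot>\<^bsub>H\<^esub> h"
  show "\<forall>w. w permutes {1..r} \<longrightarrow> coef h (st i \<circ> w) = coef h w"
  proof (intro allI impI)
    fix w assume "w permutes {1..r}"
    from coef_left[OF i h this] show "coef h (st i \<circ> w) = coef h w"
      using qq_nonzero h qq_AA by (simp add: e coef_smult algebra_simps split: if_splits)
  qed
next
  assume "\<forall>w. w permutes {1..r} \<longrightarrow> coef h (st i \<circ> w) = coef h w"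
  then show "Tword [i] \<star> h = qq \<odot>\<^bsub>H\<^esub> h"
    using i h qq_AA by (intro H_eqI) (auto simp: coef_left coef_smult algebra_simps)
qed

lemma right_eigen_iff:
  assumes i: "i \<in> {1..<r}" and h: "h \<in> carrier H"
  shows "h \<star> Tword [i] = qq \<odot>\<^bsub>H\<^esub> h \<longleftrightarrow>
    (\<forall>w. w permutes {1..r} \<longrightarrow> coef h (w \<circ> st i) = coef h w)"
proof
  assume e: "h \<star> Tword [i] = qq \<odot>\<^bsub>H\<^esub> h"
  show "\<forall>w. w permutes {1..r} \<longrightarrow> coef h (w \<circ> st i) = coef h w"
  proof (intro allI impI)
    fix w assume "w permutes {1..r}"
    from coef_right[OF i h this] show "coef h (w \<circ> st i) = coef h w"
      using qq_nonzero h qq_AA by (simp add: e coef_smult algebra_simps split: if_splits)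
  qed
next
  assume "\<forall>w. w permutes {1..r} \<longrightarrow> coef h (w \<circ> st i) = coef h w"
  then show "h \<star> Tword [i] = qq \<odot>\<^bsub>H\<^esub> h"
    using i h qq_AA by (intro H_eqI) (auto simp: coef_right coef_smult algebra_simps)
qed

end

section \<open>Young subgroups\<close>

text \<open>
  A Young subgroup is given by a monotone labelling \<open>\<kappa>\<close> of the points. It consists of the permutations
  that preserve labels, and by monotonicity it is generated by those \<open>s\<^sub>i\<close> that exchange points with the
  same label.
\<close>

locale young = hecke_algebra r for r :: nat +
  fixes \<kappa> :: "nat \<Rightarrow> nat"
  assumes mono: "a \<in> {1..r} \<Longrightarrow> b \<in> {1..r} \<Longrightarrow> a \<le> b \<Longrightarrow> \<kappa> a \<le> \<kappa> b"
begin

definition Y :: "(nat \<Rightarrow> nat) set" where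
  "Y = {w. w permutes {1..r} \<and> (\<forall>x\<in>{1..r}. \<kappa> (w x) = \<kappa> x)}"

lemma Y_perm: "u \<in> Y \<Longrightarrow> u permutes {1..r}"
  by (simp add: Y_def)

lemma Y_kappa: "u \<in> Y \<Longrightarrow> x \<in> {1..r} \<Longrightarrow> \<kappa> (u x) = \<kappa> x"
  by (simp add: Y_def)

lemma finite_Y: "finite Y"
  by (rule finite_subset[OF _ finite_perms]) (auto simp: Y_def)

lemma Y_id: "id \<in> Y"
  by (simp add: Y_def permutes_id)

lemma Y_comp: "u \<in> Y \<Longrightarrow> v \<in> Y \<Longrightarrow> u \<circ> v \<in> Y"
  unfolding Y_def using permutes_compose[of v "{1..r}" u] permutes_in_image[of v "{1..r}"] by auto

lemma Y_inv: "u \<in> Y \<Longrightarrow> inv' u \<in> Y"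
proof -
  assume u: "u \<in> Y"
  then have "\<kappa> (inv' u x) = \<kappa> x" if "x \<in> {1..r}" for x
    using that permutes_in_image[OF permutes_inv[OF Y_perm[OF u]], of x]
      Y_kappa[OF u, of "inv' u x"] permutes_inverses(1)[OF Y_perm[OF u], of x] by simp
  then show ?thesis using permutes_inv[OF Y_perm[OF u]] by (simp add: Y_def)
qed

lemma Y_st: "i \<in> {1..<r} \<Longrightarrow> \<kappa> i = \<kappa> (i + 1) \<Longrightarrow> st i \<in> Y"
  unfolding Y_def using st_permutes[of i r] by (auto simp: st_def transpose_def)

lemma Y_st_comp_iff:
  assumes "i \<in> {1..<r}" "\<kappa> i = \<kappa> (i + 1)"
  shows "st i \<circ> w \<in> Y \<longleftrightarrow> w \<in> Y" "w \<circ> st i \<in> Y \<longleftrightarrow> w \<in> Y"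
  using Y_comp[OF Y_st[OF assms]] Y_comp[OF _ Y_st[OF assms]] st_st_comp by metis+

text \<open>
  The inverse of \<open>u\<close> preserves labels, so at a descent the label of \<open>i + 1\<close> is at most that of \<open>i\<close>.
\<close>

lemma Y_descent:
  assumes u: "u \<in> Y" and i: "i \<in> {1..<r}" and down: "\<not> inv' u i < inv' u (i + 1)"
  shows "\<kappa> i = \<kappa> (i + 1)"
proof -
  have ir: "i \<in> {1..r}" "i + 1 \<in> {1..r}" using i by auto
  note p = Y_perm[OF Y_inv[OF u]]
  have "\<kappa> (i + 1) = \<kappa> (inv' u (i + 1))" using Y_kappa[OF Y_inv[OF u] ir(2)] by simp
  also have "\<dots> \<le> \<kappa> (inv' u i)"
    using down permutes_in_image[OF p] ir by (intro mono) auto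
  also have "\<dots> = \<kappa> i" using Y_kappa[OF Y_inv[OF u] ir(1)] by simp
  finally show ?thesis using mono[OF ir] by simp
qed

lemma Y_induct [consumes 1, case_names id st]:
  assumes "u \<in> Y" and id: "P id"
    and st: "\<And>i u. i \<in> {1..<r} \<Longrightarrow> \<kappa> i = \<kappa> (i + 1) \<Longrightarrow> u \<in> Y \<Longrightarrow>
      inv' u i < inv' u (i + 1) \<Longrightarrow> P u \<Longrightarrow> P (st i \<circ> u)"
  shows "P u"
  using assms(1)
proof (induction "ell u" arbitrary: u rule: less_induct)
  case less
  show ?case
  proof (cases "u = id")
    case False
    then obtain i where i: "i \<in> {1..<r}" "\<not> inv' u i < inv' u (i + 1)"
      using exists_left_descent[OF Y_perm[OF less(2)]] by metis
    let ?v = "st i \<circ> u"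
    have k: "\<kappa> i = \<kappa> (i + 1)" by (rule Y_descent[OF less(2) i])
    have v: "?v \<in> Y" using less(2) by (simp only: Y_st_comp_iff[OF i(1) k])
    have ne: "inv' u i \<noteq> inv' u (i + 1)"
      using permutes_inj[OF permutes_inv[OF Y_perm[OF less(2)]]] by (simp add: inj_eq)
    have "P ?v" using ell_st_comp_down[OF Y_perm[OF less(2)] i] v by (intro less(1)) auto
    moreover have "inv' ?v i < inv' ?v (i + 1)"
      using i ne by (simp add: inv_st_comp[OF Y_perm[OF less(2)]] st_apply)
    ultimately have "P (st i \<circ> ?v)" by (intro st[OF i(1) k v])
    then show ?thesis by (simp only: st_st_comp)
  qed (simp add: id)
qed

lemma left_invariant:
  assumes f: "\<And>i w. i \<in> {1..<r} \<Longrightarrow> \<kappa> i = \<kappa> (i + 1) \<Longrightarrow> w permutes {1..r} \<Longrightarrow> f (st i \<circ> w) = f w"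
    and u: "u \<in> Y" and w: "w permutes {1..r}"
  shows "f (u \<circ> w) = f w"
  using u
proof (induction u rule: Y_induct)
  case (st i u)
  then show ?case using f[OF st(1,2) permutes_compose[OF w Y_perm[OF st(3)]]] by (simp add: comp_def)
qed simp

lemma right_invariant:
  assumes f: "\<And>i w. i \<in> {1..<r} \<Longrightarrow> \<kappa> i = \<kappa> (i + 1) \<Longrightarrow> w permutes {1..r} \<Longrightarrow> f (w \<circ> st i) = f w"
    and u: "u \<in> Y" and w: "w permutes {1..r}"
  shows "f (w \<circ> u) = f w"
proof -
  have "f (inv' (inv' u \<circ> inv' w)) = f (inv' (inv' w))"
    by (rule left_invariant[where f = "\<lambda>w. f (inv' w)"])
       (auto simp: inv_st_comp f permutes_inv w Y_inv u)
  moreover have "inv' (inv' u \<circ> inv' w) = w \<circ> u"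
    using w Y_perm[OF u] by (subst o_inv_distrib) (auto simp: permutes_bij bij_imp_bij_inv inv_inv_eq)
  ultimately show ?thesis using w by (simp add: inv_inv_eq permutes_bij)
qed

text \<open>
  The representatives of minimal length of the cosets \<open>Y w\<close>.
\<close>

definition min_reps :: "(nat \<Rightarrow> nat) set" where
  "min_reps = {d. d permutes {1..r} \<and>
     (\<forall>i\<in>{1..<r}. \<kappa> i = \<kappa> (i + 1) \<longrightarrow> inv' d i < inv' d (i + 1))}"

lemma min_reps_perm: "d \<in> min_reps \<Longrightarrow> d permutes {1..r}"
  by (simp add: min_reps_def)

lemma finite_min_reps: "finite min_reps"
  by (rule finite_subset[OF _ finite_perms]) (auto simp: min_reps_def)

lemma min_reps_increasing:
  assumes d: "d \<in> min_reps" and ab: "1 \<le> a" "a < b" "b \<le> r" and k: "\<kappa> a = \<kappa> b"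
  shows "inv' d a < inv' d b"
proof -
  have "a + Suc m \<le> r \<Longrightarrow> \<kappa> a = \<kappa> (a + Suc m) \<Longrightarrow> inv' d a < inv' d (a + Suc m)" for m
  proof (induction m)
    case 0
    have e: "a + Suc 0 = a + 1" by simp
    show ?case using 0 d ab unfolding e min_reps_def by auto
  next
    case (Suc m)
    let ?c = "a + Suc m"
    have c: "?c + 1 = a + Suc (Suc m)" by simp
    have "\<kappa> a \<le> \<kappa> ?c" by (rule mono) (use Suc.prems ab in auto)
    moreover have "\<kappa> ?c \<le> \<kappa> (?c + 1)" by (rule mono) (use Suc.prems ab in auto)
    ultimately have eq: "\<kappa> ?c = \<kappa> a" "\<kappa> ?c = \<kappa> (?c + 1)" using Suc.prems(2) unfolding c by linarith+
    have "inv' d a < inv' d ?c" using Suc eq by auto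
    also have "\<dots> < inv' d (?c + 1)" proof -
      have "?c \<in> {1..<r}" using Suc.prems ab by auto
      then show ?thesis using d eq(2) unfolding min_reps_def by blast
    qed
    finally show ?case by (simp only: c)
  qed
  from this[of "b - a - 1"] ab k show ?thesis by simp
qed

text \<open>
  The inverse of \<open>d\<close> is increasing on every block, so a letter that increases the length of \<open>u\<close> also
  increases the length of \<open>u \<circ> d\<close>.
\<close>

lemma ell_min_rep:
  assumes u: "u \<in> Y" and d: "d \<in> min_reps"
  shows "ell (u \<circ> d) = ell u + ell d"
  using u
proof (induction u rule: Y_induct)
  case id
  then show ?case using ell_id by (simp add: id_def comp_def)
next
  case (st i u)
  note p = Y_perm[OF st(3)] and q = min_reps_perm[OF d]
  have ud: "u \<circ> d permutes {1..r}" by (rule permutes_compose[OF q p])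
  have r: "inv' u i \<in> {1..r}" "inv' u (i + 1) \<in> {1..r}"
    using permutes_in_image[OF permutes_inv[OF p]] st(1) by auto
  have "\<kappa> (inv' u i) = \<kappa> (inv' u (i + 1))"
    using Y_kappa[OF Y_inv[OF st(3)]] st(1,2) by simp
  then have "inv' d (inv' u i) < inv' d (inv' u (i + 1))"
    using r st(4) by (intro min_reps_increasing[OF d]) auto
  moreover have "inv' (u \<circ> d) = inv' d \<circ> inv' u"
    using p q by (intro o_inv_distrib) (auto simp: permutes_bij)
  ultimately have "ell (st i \<circ> (u \<circ> d)) = ell (u \<circ> d) + 1"
    by (intro ell_st_comp_up[OF ud st(1)]) simp
  then show ?case using st ell_st_comp_up[OF p st(1,4)] by (simp add: comp_def)
qed

lemma exists_min_rep:
  assumes "w permutes {1..r}"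
  shows "\<exists>u\<in>Y. \<exists>d\<in>min_reps. w = u \<circ> d"
  using assms
proof (induction "ell w" arbitrary: w rule: less_induct)
  case less
  show ?case
  proof (cases "w \<in> min_reps")
    case True
    then show ?thesis using Y_id by (intro bexI[of _ id] bexI[of _ w]) auto
  next
    case False
    then obtain i where i: "i \<in> {1..<r}" "\<not> inv' w i < inv' w (i + 1)" "\<kappa> i = \<kappa> (i + 1)"
      using less(2) by (auto simp: min_reps_def)
    have "st i \<circ> w permutes {1..r}" by (rule permutes_compose[OF less(2) st_permutes[OF i(1)]])
    with ell_st_comp_down[OF less(2) i(1,2)] less(1)[of "st i \<circ> w"]
    obtain u d where ud: "u \<in> Y" "d \<in> min_reps" "st i \<circ> w = u \<circ> d" by auto
    then have "w = (st i \<circ> u) \<circ> d" by (metis comp_assoc st_st_comp(1))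
    then show ?thesis using ud Y_st_comp_iff[OF i(1,3)] by blast
  qed
qed

lemma ell_0_Y: "u \<in> Y \<Longrightarrow> ell u = 0 \<Longrightarrow> u = id"
  using exists_left_descent[of u r] ell_st_comp_down[of u r] Y_perm by (metis add_is_0 zero_neq_one)

text \<open>
  If \<open>d\<close> and \<open>d'\<close> represent the same coset, the length of each one is the sum of the length of the
  other and of the element of \<open>Y\<close> between them, which therefore has length \<open>0\<close>.
\<close>

lemma min_rep_unique:
  assumes u: "u \<in> Y" "u' \<in> Y" and d: "d \<in> min_reps" "d' \<in> min_reps" and eq: "u \<circ> d = u' \<circ> d'"
  shows "u = u'" "d = d'"
proof -
  let ?v = "inv' u' \<circ> u"
  have v: "?v \<in> Y" "inv' u \<circ> u' \<in> Y" using u by (auto intro: Y_comp Y_inv)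
  have "inv' ?v = inv' u \<circ> u'"
    using Y_perm[OF u(1)] Y_perm[OF u(2)]
    by (subst o_inv_distrib) (auto simp: permutes_bij bij_imp_bij_inv inv_inv_eq)
  then have l: "ell (inv' u \<circ> u') = ell ?v" using ell_inv[OF Y_perm[OF v(1)]] by simp
  have d': "?v \<circ> d = d'" "(inv' u \<circ> u') \<circ> d' = d"
    using eq permutes_inv_o(2)[OF Y_perm[OF u(1)]] permutes_inv_o(2)[OF Y_perm[OF u(2)]]
    by (metis comp_assoc id_comp)+
  have "ell d' = ell ?v + ell d" "ell d = ell ?v + ell d'"
    using ell_min_rep[OF v(1) d(1)] ell_min_rep[OF v(2) d(2)] l by (simp_all add: d')
  then have "?v = id" using ell_0_Y[OF v(1)] by simp
  then show "d = d'" using d'(1) by simp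
  show "u = u'" using \<open>?v = id\<close> permutes_inv_o(1)[OF Y_perm[OF u(2)]] by (metis comp_assoc comp_id id_comp)
qed

definition x_sum :: hecke_elt where
  "x_sum = (\<Oplus>\<^bsub>H\<^esub>w\<in>Y. T w)"

lemma x_sum_closed [intro, simp]: "x_sum \<in> carrier H"
  unfolding x_sum_def by (rule H.finsum_closed) (auto intro: Y_perm)

lemma coef_x: "coef x_sum w = (if w \<in> Y then 1 else 0)"
proof -
  have "coef x_sum w = (\<Sum>u\<in>Y. if w = u then 1 else 0)"
    unfolding x_sum_def using Y_perm by (subst coef_finsum[OF finite_Y]) (auto simp: coef_T)
  then show ?thesis using finite_Y by simp
qed

lemma x_sum_left_eigen:
  assumes "i \<in> {1..<r}" "\<kappa> i = \<kappa> (i + 1)"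
  shows "Tword [i] \<star> x_sum = qq \<odot>\<^bsub>H\<^esub> x_sum"
  using assms by (subst left_eigen_iff) (auto simp: coef_x Y_st_comp_iff)

lemma x_sum_right_eigen:
  assumes "i \<in> {1..<r}" "\<kappa> i = \<kappa> (i + 1)"
  shows "x_sum \<star> Tword [i] = qq \<odot>\<^bsub>H\<^esub> x_sum"
  using assms by (subst right_eigen_iff) (auto simp: coef_x Y_st_comp_iff)

lemma left_ideal_eigen:
  assumes i: "i \<in> {1..<r}" "\<kappa> i = \<kappa> (i + 1)" and h: "h \<in> carrier H"
  shows "Tword [i] \<star> (x_sum \<star> h) = qq \<odot>\<^bsub>H\<^esub> (x_sum \<star> h)"
proof -
  have "Tword [i] \<star> (x_sum \<star> h) = (Tword [i] \<star> x_sum) \<star> h"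
    using i(1) h by (intro H.m_assoc[symmetric]) auto
  also have "\<dots> = qq \<odot>\<^bsub>H\<^esub> (x_sum \<star> h)"
    unfolding x_sum_left_eigen[OF i] by (intro smult_mult_left qq_AA x_sum_closed h)
  finally show ?thesis .
qed

text \<open>
  The common part of the next two factorisations: \<open>pr d u\<close> is the product of a representative and an
  element of \<open>Y\<close>, in either order, and \<open>rep d\<close> is the representative itself.
\<close>

lemma coset_expansion:
  assumes y: "y \<in> carrier H" and z: "z \<in> carrier H"
    and cover: "\<And>w. w permutes {1..r} \<Longrightarrow> \<exists>d\<in>min_reps. \<exists>u\<in>Y. w = pr d u"
    and unique: "\<And>d u d' u'. d \<in> min_reps \<Longrightarrow> u \<in> Y \<Longrightarrow> d' \<in> min_reps \<Longrightarrow> u' \<in> Y \<Longrightarrow>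
      pr d u = pr d' u' \<Longrightarrow> d = d' \<and> u = u'"
    and inv: "\<And>d u. d \<in> min_reps \<Longrightarrow> u \<in> Y \<Longrightarrow> coef y (pr d u) = coef y (rep d)"
    and coef_z: "\<And>w. coef z w
      = (\<Sum>d\<in>min_reps. coef y (rep d) * (\<Sum>u\<in>Y. if w = pr d u then 1 else 0))"
  shows "y = z"
proof (rule H_eqI[OF y z])
  fix w assume "w permutes {1..r}"
  then obtain d0 u0 where du: "d0 \<in> min_reps" "u0 \<in> Y" "w = pr d0 u0" using cover by blast
  have "coef z w = (\<Sum>d\<in>min_reps. \<Sum>u\<in>Y. coef y (rep d) * (if w = pr d u then 1 else 0))"
    by (simp only: coef_z sum_distrib_left)
  also have "\<dots> = (\<Sum>p\<in>min_reps \<times> Y. if p = (d0, u0) then coef y (rep d0) else 0)"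
    unfolding sum.cartesian_product
  proof (intro sum.cong refl)
    fix p assume "p \<in> min_reps \<times> Y"
    then obtain d u where p: "p = (d, u)" "d \<in> min_reps" "u \<in> Y" by auto
    have "w = pr d u \<longleftrightarrow> p = (d0, u0)"
      using unique[OF p(2,3) du(1,2)] by (auto simp: du(3) p(1))
    then show "(case p of (d, u) \<Rightarrow> coef y (rep d) * (if w = pr d u then 1 else 0))
        = (if p = (d0, u0) then coef y (rep d0) else 0)"
      by (auto simp: p(1))
  qed
  also have "\<dots> = coef y w"
    using du finite_Y finite_min_reps inv by (subst sum.delta) auto
  finally show "coef y w = coef z w" ..
qed

text \<open>
  The cofactor collects the terms of \<open>y\<close> at the minimal representatives, because \<open>x_sum T\<^sub>d\<close> is the sum
  of \<open>T\<^sub>w\<close> over the coset \<open>Y d\<close>. No division by the number \<open>\<Sum> q\<^sup>\<ell>\<^sup>(\<^sup>u\<^sup>)\<close>, which is not invertible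
  over \<open>\<int>[\<upsilon>, \<upsilon>\<^sup>-\<^sup>1]\<close>, is involved.
\<close>

lemma left_invariant_factor:
  assumes y: "y \<in> carrier H"
    and inv: "\<And>u w. u \<in> Y \<Longrightarrow> w permutes {1..r} \<Longrightarrow> coef y (u \<circ> w) = coef y w"
  shows "\<exists>h\<in>carrier H. y = x_sum \<star> h"
proof
  let ?h = "\<Oplus>\<^bsub>H\<^esub>d\<in>min_reps. coef y d \<odot>\<^bsub>H\<^esub> T d"
  have cT: "coef y d \<odot>\<^bsub>H\<^esub> T d \<in> carrier H" "T d \<in> carrier H" if "d \<in> min_reps" for d
    using that coef_AA[OF y] min_reps_perm by auto
  show h: "?h \<in> carrier H" using cT by (intro H.finsum_closed) auto
  have xT: "coef (x_sum \<star> T d) w = (\<Sum>u\<in>Y. if w = u \<circ> d then 1 else 0)" if d: "d \<in> min_reps" for d w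
  proof -
    note p = min_reps_perm[OF d]
    have "x_sum \<star> T d = (\<Oplus>\<^bsub>H\<^esub>u\<in>Y. T u \<star> T d)"
      unfolding x_sum_def using p Y_perm by (intro H.finsum_ldistr finite_Y) auto
    also have "\<dots> = (\<Oplus>\<^bsub>H\<^esub>u\<in>Y. T (u \<circ> d))"
      using p Y_perm permutes_compose[OF p] ell_min_rep[OF _ d]
      by (intro H.finsum_cong' T_mult) auto
    finally show ?thesis
      using permutes_compose[OF p] Y_perm
      by (simp only:, subst coef_finsum[OF finite_Y]) (auto simp: coef_T)
  qed
  have "x_sum \<star> ?h = (\<Oplus>\<^bsub>H\<^esub>d\<in>min_reps. x_sum \<star> (coef y d \<odot>\<^bsub>H\<^esub> T d))"
    using cT by (intro H.finsum_rdistr finite_min_reps) auto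
  also have "\<dots> = (\<Oplus>\<^bsub>H\<^esub>d\<in>min_reps. coef y d \<odot>\<^bsub>H\<^esub> (x_sum \<star> T d))"
    using cT coef_AA[OF y] by (intro H.finsum_cong') (auto simp: smult_mult_right)
  finally have xh: "coef (x_sum \<star> ?h) w = (\<Sum>d\<in>min_reps. coef y d * coef (x_sum \<star> T d) w)" for w
    using cT coef_AA[OF y]
    by (simp only:, subst coef_finsum[OF finite_min_reps]) (auto intro!: sum.cong coef_smult)
  have coef_xh: "coef (x_sum \<star> ?h) w
      = (\<Sum>d\<in>min_reps. coef y d * (\<Sum>u\<in>Y. if w = u \<circ> d then 1 else 0))" for w
    unfolding xh by (intro sum.cong refl) (simp add: xT)
  show "y = x_sum \<star> ?h"
  proof (rule coset_expansion[OF y _ _ _ _ coef_xh])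
    show "\<exists>d\<in>min_reps. \<exists>u\<in>Y. w = u \<circ> d" if "w permutes {1..r}" for w
      using exists_min_rep[OF that] by blast
  qed (use h min_rep_unique inv min_reps_perm in auto)
qed

text \<open>
  The inverses of the minimal representatives of the cosets \<open>Y w\<close> represent the cosets \<open>w Y\<close>, and
  lengths are invariant under inversion.
\<close>

lemma right_invariant_factor:
  assumes y: "y \<in> carrier H"
    and inv: "\<And>u w. u \<in> Y \<Longrightarrow> w permutes {1..r} \<Longrightarrow> coef y (w \<circ> u) = coef y w"
  shows "\<exists>h\<in>carrier H. y = h \<star> x_sum"
proof
  let ?T = "\<lambda>d. T (inv' d)"
  let ?c = "\<lambda>d. coef y (inv' d)"
  let ?h = "\<Oplus>\<^bsub>H\<^esub>d\<in>min_reps. ?c d \<odot>\<^bsub>H\<^esub> ?T d"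
  have cT: "?c d \<odot>\<^bsub>H\<^esub> ?T d \<in> carrier H" "?T d \<in> carrier H" if "d \<in> min_reps" for d
    using that coef_AA[OF y] permutes_inv[OF min_reps_perm] by auto
  show h: "?h \<in> carrier H" using cT by (intro H.finsum_closed) auto
  have Tx: "coef (?T d \<star> x_sum) w = (\<Sum>u\<in>Y. if w = inv' d \<circ> u then 1 else 0)" if d: "d \<in> min_reps" for d w
  proof -
    note p = permutes_inv[OF min_reps_perm[OF d]]
    have len: "ell (inv' d \<circ> u) = ell (inv' d) + ell u" if u: "u \<in> Y" for u
    proof -
      have "inv' (inv' d \<circ> u) = inv' u \<circ> d"
        using p Y_perm[OF u] min_reps_perm[OF d]
        by (subst o_inv_distrib) (auto simp: permutes_bij bij_imp_bij_inv inv_inv_eq)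
      then show ?thesis
        using ell_min_rep[OF Y_inv[OF u] d] ell_inv[OF permutes_compose[OF Y_perm[OF u] p]]
          ell_inv[OF Y_perm[OF u]] ell_inv[OF min_reps_perm[OF d]] by simp
    qed
    have "?T d \<star> x_sum = (\<Oplus>\<^bsub>H\<^esub>u\<in>Y. ?T d \<star> T u)"
      unfolding x_sum_def using p Y_perm by (intro H.finsum_rdistr finite_Y) auto
    also have "\<dots> = (\<Oplus>\<^bsub>H\<^esub>u\<in>Y. T (inv' d \<circ> u))"
      using p Y_perm permutes_compose[OF _ p] len
      by (intro H.finsum_cong' T_mult) auto
    finally show ?thesis
      using permutes_compose[OF _ p] Y_perm
      by (simp only:, subst coef_finsum[OF finite_Y]) (auto simp: coef_T)
  qed
  have "?h \<star> x_sum = (\<Oplus>\<^bsub>H\<^esub>d\<in>min_reps. (?c d \<odot>\<^bsub>H\<^esub> ?T d) \<star> x_sum)"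
    using cT by (intro H.finsum_ldistr finite_min_reps) auto
  also have "\<dots> = (\<Oplus>\<^bsub>H\<^esub>d\<in>min_reps. ?c d \<odot>\<^bsub>H\<^esub> (?T d \<star> x_sum))"
    using cT coef_AA[OF y] by (intro H.finsum_cong') (auto simp: smult_mult_left)
  finally have hx: "coef (?h \<star> x_sum) w = (\<Sum>d\<in>min_reps. ?c d * coef (?T d \<star> x_sum) w)" for w
    using cT coef_AA[OF y]
    by (simp only:, subst coef_finsum[OF finite_min_reps]) (auto intro!: sum.cong coef_smult)
  have coef_hx: "coef (?h \<star> x_sum) w
      = (\<Sum>d\<in>min_reps. ?c d * (\<Sum>u\<in>Y. if w = inv' d \<circ> u then 1 else 0))" for w
    unfolding hx by (intro sum.cong refl) (simp add: Tx)
  have inv_comp: "inv' (inv' d \<circ> u) = inv' u \<circ> d" if "d \<in> min_reps" "u \<in> Y" for d u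
    using min_reps_perm[OF that(1)] Y_perm[OF that(2)] permutes_inv[OF min_reps_perm[OF that(1)]]
    by (subst o_inv_distrib) (auto simp: permutes_bij inv_inv_eq)
  show "y = ?h \<star> x_sum"
  proof (rule coset_expansion[OF y _ _ _ _ coef_hx])
    show "\<exists>d\<in>min_reps. \<exists>u\<in>Y. w = inv' d \<circ> u" if w: "w permutes {1..r}" for w
    proof -
      obtain u d where ud: "u \<in> Y" "d \<in> min_reps" "inv' w = u \<circ> d"
        using exists_min_rep[OF permutes_inv[OF w]] by blast
      have "inv' (inv' w) = inv' d \<circ> inv' u"
        unfolding ud(3) using Y_perm[OF ud(1)] min_reps_perm[OF ud(2)]
        by (intro o_inv_distrib) (auto simp: permutes_bij)
      moreover have "inv' (inv' w) = w" using w by (simp add: inv_inv_eq permutes_bij)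
      ultimately have "w = inv' d \<circ> inv' u" by simp
      then show ?thesis using ud Y_inv by blast
    qed
  next
    fix d u d' u'
    assume d: "d \<in> min_reps" "d' \<in> min_reps" and u: "u \<in> Y" "u' \<in> Y"
      and eq: "inv' d \<circ> u = inv' d' \<circ> u'"
    have "inv' u \<circ> d = inv' u' \<circ> d'"
      using inv_comp[OF d(1) u(1)] inv_comp[OF d(2) u(2)] eq by simp
    from min_rep_unique[OF Y_inv[OF u(1)] Y_inv[OF u(2)] d this]
    show "d = d' \<and> u = u'" using u Y_perm by (metis inv_inv_eq permutes_bij)
  qed (use h inv permutes_inv[OF min_reps_perm] in auto)
qed

end

section \<open>Blocks of a composition\<close>

text \<open>
  On \<open>{1..r}\<close> this is a monotone labelling of the points by their blocks.
\<close>

definition block_index :: "nat vec \<Rightarrow> nat \<Rightarrow> nat" where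
  "block_index l a = (LEAST i. a \<le> (\<Sum>j\<le>i. l $ j))"

context
  fixes n r :: nat and l :: "nat vec"
  assumes l: "l \<in> Lambda n r"
begin

lemma dim_Lambda: "dim_vec l = n"
  using l by (simp add: Lambda_def)

lemma sum_Lambda: "(\<Sum>i<n. l $ i) = r"
  using l by (simp add: Lambda_def)

lemma partial_sum_mono: "i \<le> k \<Longrightarrow> (\<Sum>j<i. l $ j) \<le> (\<Sum>j<k. l $ j)"
  by (rule sum_mono2) auto

lemma block_index_exists:
  assumes "a \<in> {1..r}"
  shows "\<exists>i<n. a \<le> (\<Sum>j\<le>i. l $ j)"
proof (cases n)
  case 0
  then show ?thesis using assms sum_Lambda by simp
next
  case (Suc m)
  then show ?thesis using assms sum_Lambda by (intro exI[of _ m]) (simp add: lessThan_Suc_atMost)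
qed

lemma block_index_less: "a \<in> {1..r} \<Longrightarrow> block_index l a < n"
  using block_index_exists[of a] Least_le[of "\<lambda>i. a \<le> (\<Sum>j\<le>i. l $ j)"]
  unfolding block_index_def by (meson le_less_trans)

lemma block_index_le:
  assumes "a \<in> {1..r}"
  shows "a \<le> (\<Sum>j\<le>block_index l a. l $ j)"
  using block_index_exists[OF assms] LeastI[of "\<lambda>i. a \<le> (\<Sum>j\<le>i. l $ j)"]
  unfolding block_index_def by metis

lemma block_index_mono: "b \<in> {1..r} \<Longrightarrow> a \<le> b \<Longrightarrow> block_index l a \<le> block_index l b"
  using block_index_le[of b] unfolding block_index_def[of l a] by (intro Least_le) simp

lemma mem_block_iff:
  assumes a: "a \<in> {1..r}"
  shows "a \<in> block l i \<longleftrightarrow> block_index l a = i"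
proof
  assume b: "a \<in> block l i"
  show "block_index l a = i"
    unfolding block_index_def
  proof (rule Least_equality)
    show "a \<le> (\<Sum>j\<le>i. l $ j)" using b by (simp add: block_def)
    fix k assume k: "a \<le> (\<Sum>j\<le>k. l $ j)"
    show "i \<le> k"
    proof (rule ccontr)
      assume "\<not> i \<le> k"
      then have "(\<Sum>j\<le>k. l $ j) \<le> (\<Sum>j<i. l $ j)"
        using partial_sum_mono[of "Suc k" i] by (simp add: lessThan_Suc_atMost)
      then show False using k b by (simp add: block_def)
    qed
  qed
next
  assume i: "block_index l a = i"
  have "(\<Sum>j<i. l $ j) < a"
  proof (cases i)
    case 0
    then show ?thesis using a by simp
  next
    case (Suc k)
    then have "\<not> a \<le> (\<Sum>j\<le>k. l $ j)"
      using not_less_Least[of k "\<lambda>i. a \<le> (\<Sum>j\<le>i. l $ j)"] i by (simp add: block_index_def)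
    then show ?thesis by (simp add: Suc lessThan_Suc_atMost)
  qed
  then show "a \<in> block l i" using block_index_le[OF a] i by (simp add: block_def)
qed

lemma block_subset: "i < n \<Longrightarrow> block l i \<subseteq> {1..r}"
  using partial_sum_mono[of "Suc i" n] sum_Lambda
  by (auto simp: block_def lessThan_Suc_atMost)

lemma block_eq: "i < n \<Longrightarrow> block l i = {a\<in>{1..r}. block_index l a = i}"
  using block_subset mem_block_iff by blast

lemma card_block_index: "i < n \<Longrightarrow> card {a\<in>{1..r}. block_index l a = i} = l $ i"
proof -
  assume i: "i < n"
  have "card (block l i) = l $ i" by (simp add: block_def flip: lessThan_Suc_atMost)
  then show ?thesis by (simp only: block_eq[OF i])
qed

lemma young_subgroup_eq:
  "young_subgroup r l = {w. w permutes {1..r} \<and> (\<forall>a\<in>{1..r}. block_index l (w a) = block_index l a)}"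
proof -
  have "(\<forall>i<n. w ` block l i = block l i) \<longleftrightarrow> (\<forall>a\<in>{1..r}. block_index l (w a) = block_index l a)"
    (is "?L \<longleftrightarrow> ?R") if w: "w permutes {1..r}" for w
  proof
    assume ?L
    show ?R
    proof
      fix a assume a: "a \<in> {1..r}"
      then have "a \<in> block l (block_index l a)" by (simp add: mem_block_iff)
      then have "w a \<in> block l (block_index l a)" using \<open>?L\<close> block_index_less[OF a] by blast
      moreover have "w a \<in> {1..r}" using permutes_in_image[OF w] a by simp
      ultimately show "block_index l (w a) = block_index l a" by (simp add: mem_block_iff)
    qed
  next
    assume ?R
    show ?L
    proof (intro allI impI)
      fix i assume i: "i < n"
      show "w ` block l i = block l i"
      proof (rule endo_inj_surj)
        show "finite (block l i)" by (simp add: block_def)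
        show "w ` block l i \<subseteq> block l i"
          using \<open>?R\<close> permutes_in_image[OF w] by (auto simp: block_eq[OF i])
        show "inj_on w (block l i)" using permutes_inj[OF w] by (rule inj_on_subset) simp
      qed
    qed
  qed
  then show ?thesis by (auto simp: young_subgroup_def sym_group_carrier dim_Lambda)
qed

end

section \<open>Double cosets and matrices\<close>

lemma count_image_mset_set:
  "finite S \<Longrightarrow> count (image_mset f (mset_set S)) y = card {a\<in>S. f a = y}"
  by (simp add: count_image_mset vimage_def Int_def conj_commute)

text \<open>
  Two colourings with equally large colour classes differ by a permutation.
\<close>

lemma permutes_matching_fibres:
  assumes "finite S" "\<And>y. card {a\<in>S. f a = y} = card {a\<in>S. g a = y}"
  shows "\<exists>p. p permutes S \<and> (\<forall>a\<in>S. f a = g (p a))"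
proof -
  have "image_mset f (mset_set S) = image_mset g (mset_set S)"
    by (rule multiset_eqI) (simp only: count_image_mset_set assms)
  from image_mset_eq_implies_permutes[OF assms(1) this] show ?thesis by blast
qed

definition coset_matrix :: "nat \<Rightarrow> nat vec \<Rightarrow> nat vec \<Rightarrow> (nat \<Rightarrow> nat) \<Rightarrow> nat \<Rightarrow> nat \<Rightarrow> nat" where
  "coset_matrix r l m w i j = card {a\<in>{1..r}. block_index l a = i \<and> block_index m (inv' w a) = j}"

lemma card_pullback:
  assumes p: "p permutes S"
  shows "card {a\<in>S. Q (p a)} = card {a\<in>S. Q a}"
proof -
  have "{a\<in>S. Q a} = p ` {a\<in>S. Q (p a)}"
  proof (rule Set.set_eqI)
    fix b
    show "b \<in> {a\<in>S. Q a} \<longleftrightarrow> b \<in> p ` {a\<in>S. Q (p a)}"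
      using permutes_in_image[OF p] permutes_inverses[OF p] permutes_in_image[OF permutes_inv[OF p]]
      by (auto intro!: image_eqI[of _ _ "inv' p b"])
  qed
  then show ?thesis using permutes_inj_on[OF p] by (simp add: card_image)
qed

lemma ro_co_Lambda:
  assumes "A \<in> Theta n r"
  shows "ro A \<in> Lambda n r" "co A \<in> Lambda n r"
proof -
  have A: "A \<in> carrier_mat n n" "(\<Sum>i<n. \<Sum>j<n. A $$ (i, j)) = r"
    using assms by (auto simp: Theta_def)
  have "(\<Sum>j<n. \<Sum>i<n. A $$ (i, j)) = r" using A(2) by (subst sum.swap)
  then show "ro A \<in> Lambda n r" "co A \<in> Lambda n r"
    using A by (auto simp: Lambda_def ro_def co_def)
qed

context
  fixes n r :: nat and l m :: "nat vec"
  assumes l: "l \<in> Lambda n r" and m: "m \<in> Lambda n r"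
begin

text \<open>
  If \<open>w\<close> and \<open>w'\<close> have the same matrix, a permutation \<open>p\<close> matches the points by their row block and by
  the column block of their preimages under \<open>w\<close> and \<open>w'\<close>. Then \<open>p\<close> lies in the row subgroup and
  \<open>w'\<^sup>-\<^sup>1 p w\<close> in the column subgroup.
\<close>

lemma double_coset_eq:
  assumes w: "w permutes {1..r}"
  shows "(young_subgroup r l #>\<^bsub>sym_group r\<^esub> w) <#>\<^bsub>sym_group r\<^esub> young_subgroup r m
    = {w'. w' permutes {1..r} \<and> (\<forall>i<n. \<forall>j<n. coset_matrix r l m w' i j = coset_matrix r l m w i j)}"
    (is "?L = ?R")
proof
  have L: "?L = {u \<circ> w \<circ> v | u v. u \<in> young_subgroup r l \<and> v \<in> young_subgroup r m}"
    by (auto simp: r_coset_def set_mult_def sym_group_mult)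
  show "?L \<subseteq> ?R"
  proof
    fix w' assume "w' \<in> ?L"
    then obtain u v where w': "w' = u \<circ> w \<circ> v" and u: "u \<in> young_subgroup r l"
      and v: "v \<in> young_subgroup r m" by (auto simp: L)
    then have pu: "u permutes {1..r}" and ku: "\<And>a. a \<in> {1..r} \<Longrightarrow> block_index l (u a) = block_index l a"
      and pv: "v permutes {1..r}" and kv: "\<And>a. a \<in> {1..r} \<Longrightarrow> block_index m (v a) = block_index m a"
      by (auto simp: young_subgroup_eq[OF l] young_subgroup_eq[OF m])
    have p': "w' permutes {1..r}" unfolding w' by (intro permutes_compose w pu pv)
    have "inv' w' (u a) = inv' v (inv' w a)" for a
      by (rule inv_f_eq[OF permutes_inj[OF p']])
         (simp add: w' permutes_inverses[OF pv] permutes_inverses[OF w])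
    moreover have "block_index m (inv' v b) = block_index m b" if "b \<in> {1..r}" for b
      using kv[of "inv' v b"] that permutes_in_image[OF permutes_inv[OF pv]]
      by (simp add: permutes_inverses[OF pv])
    ultimately have "coset_matrix r l m w' i j = coset_matrix r l m w i j" for i j
      unfolding coset_matrix_def
      by (subst card_pullback[OF pu, symmetric], intro arg_cong[of _ _ card])
         (use ku permutes_in_image[OF permutes_inv[OF w]] in auto)
    then show "w' \<in> ?R" using p' by simp
  qed
  show "?R \<subseteq> ?L"
  proof
    fix w' assume "w' \<in> ?R"
    then have w': "w' permutes {1..r}"
      and eq: "\<And>i j. i < n \<Longrightarrow> j < n \<Longrightarrow> coset_matrix r l m w' i j = coset_matrix r l m w i j" by auto
    let ?f = "\<lambda>w a. (block_index l a, block_index m (inv' w a))"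
    have "card {a\<in>{1..r}. ?f w a = y} = card {a\<in>{1..r}. ?f w' a = y}" for y
    proof (cases "fst y < n \<and> snd y < n")
      case True
      then show ?thesis using eq[of "fst y" "snd y"] by (cases y) (simp add: coset_matrix_def)
    next
      case False
      have "?f v a \<noteq> y" if "a \<in> {1..r}" "v permutes {1..r}" for v a
        using False block_index_less[OF l that(1)]
          block_index_less[OF m, of "inv' v a"] that permutes_in_image[OF permutes_inv[OF that(2)], of a]
        by (cases y) auto
      then have "{a\<in>{1..r}. ?f w a = y} = {}" "{a\<in>{1..r}. ?f w' a = y} = {}" using w w' by auto
      then show ?thesis by (simp only:)
    qed
    then obtain p where p: "p permutes {1..r}" "\<forall>a\<in>{1..r}. ?f w a = ?f w' (p a)"
      using permutes_matching_fibres[of "{1..r}" "?f w" "?f w'"] by auto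
    define v where "v = inv' w' \<circ> p \<circ> w"
    have v: "v permutes {1..r}" unfolding v_def by (intro permutes_compose w p permutes_inv w')
    have "p \<in> young_subgroup r l" using p by (auto simp: young_subgroup_eq[OF l])
    moreover have "inv' v \<in> young_subgroup r m"
    proof -
      have key: "block_index m (v b) = block_index m b" if "b \<in> {1..r}" for b
      proof -
        have "w b \<in> {1..r}" using permutes_in_image[OF w, of b] that by simp
        then have "?f w (w b) = ?f w' (p (w b))" using p(2) by blast
        then show ?thesis by (simp add: v_def permutes_inverses[OF w])
      qed
      have "block_index m (inv' v b) = block_index m b" if "b \<in> {1..r}" for b
      proof -
        have "inv' v b \<in> {1..r}" using permutes_in_image[OF permutes_inv[OF v]] that by simp
        from key[OF this] show ?thesis by (simp add: permutes_inverses[OF v])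
      qed
      then show ?thesis using permutes_inv[OF v] by (simp add: young_subgroup_eq[OF m])
    qed
    moreover have "w' = p \<circ> w \<circ> inv' v"
    proof
      fix b
      have "w' b = w' (v (inv' v b))" by (simp add: permutes_inverses[OF v])
      also have "\<dots> = (p \<circ> w \<circ> inv' v) b"
        by (simp add: v_def permutes_inverses[OF w'] del: inv_inv_eq)
      finally show "w' b = (p \<circ> w \<circ> inv' v) b" .
    qed
    ultimately show "w' \<in> ?L" unfolding L by blast
  qed
qed

lemma row_sum_coset_matrix:
  assumes w: "w permutes {1..r}" and "i < n"
  shows "(\<Sum>j<n. coset_matrix r l m w i j) = l $ i"
proof -
  have "{a\<in>{1..r}. block_index l a = i}
      = (\<Union>j<n. {a\<in>{1..r}. block_index l a = i \<and> block_index m (inv' w a) = j})"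
    using block_index_less[OF m] permutes_in_image[OF permutes_inv[OF w]] by auto
  then have "l $ i = card (\<Union>j<n. {a\<in>{1..r}. block_index l a = i \<and> block_index m (inv' w a) = j})"
    using card_block_index[OF l \<open>i < n\<close>] by simp
  also have "\<dots> = (\<Sum>j<n. coset_matrix r l m w i j)"
    unfolding coset_matrix_def by (subst card_UN_disjoint) auto
  finally show ?thesis ..
qed

lemma col_sum_coset_matrix:
  assumes w: "w permutes {1..r}" and "j < n"
  shows "(\<Sum>i<n. coset_matrix r l m w i j) = m $ j"
proof -
  have "{a\<in>{1..r}. block_index m (inv' w a) = j}
      = (\<Union>i<n. {a\<in>{1..r}. block_index l a = i \<and> block_index m (inv' w a) = j})"
    using block_index_less[OF l] by auto
  then have "m $ j = card (\<Union>i<n. {a\<in>{1..r}. block_index l a = i \<and> block_index m (inv' w a) = j})"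
    using card_block_index[OF m \<open>j < n\<close>]
      card_pullback[OF permutes_inv[OF w], of "\<lambda>a. block_index m a = j"] by simp
  also have "\<dots> = (\<Sum>i<n. coset_matrix r l m w i j)"
    unfolding coset_matrix_def by (subst card_UN_disjoint) auto
  finally show ?thesis ..
qed

lemma coset_matrix_Theta:
  assumes w: "w permutes {1..r}"
  defines "A \<equiv> mat n n (\<lambda>(i, j). coset_matrix r l m w i j)"
  shows "A \<in> Theta n r" "ro A = l" "co A = m"
proof -
  have "(\<Sum>i<n. \<Sum>j<n. A $$ (i, j)) = (\<Sum>i<n. l $ i)"
    by (intro sum.cong refl) (simp add: A_def row_sum_coset_matrix[OF w])
  then show "A \<in> Theta n r" by (simp add: Theta_def sum_Lambda[OF l] A_def)
  show "ro A = l"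
    by (rule eq_vecI) (simp_all add: ro_def A_def row_sum_coset_matrix[OF w] dim_Lambda[OF l])
  show "co A = m"
    by (rule eq_vecI) (simp_all add: co_def A_def col_sum_coset_matrix[OF w] dim_Lambda[OF m])
qed

end

text \<open>
  Colour \<open>{1..r}\<close> with the pairs \<open>(i, j)\<close>, using \<open>(i, j)\<close> exactly \<open>A $$ (i, j)\<close> times. The first
  components have the same class sizes as the row blocks, the second ones as the column blocks. If
  \<open>p\<close> and \<open>q\<close> are permutations realising these two matchings, then \<open>p q\<^sup>-\<^sup>1\<close> has matrix \<open>A\<close>.
\<close>

lemma exists_coset_matrix:
  assumes A: "A \<in> Theta n r"
  shows "\<exists>w. w permutes {1..r} \<and> (\<forall>i<n. \<forall>j<n. coset_matrix r (ro A) (co A) w i j = A $$ (i, j))"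
proof -
  note l = ro_co_Lambda(1)[OF A] and m = ro_co_Lambda(2)[OF A]
  have dim: "dim_row A = n" "dim_col A = n" using A by (auto simp: Theta_def)
  let ?P = "SIGMA p:{..<n} \<times> {..<n}. {..<A $$ p}"
  have "card ?P = (\<Sum>p\<in>{..<n} \<times> {..<n}. A $$ p)" by (subst card_SigmaI) auto
  also have "\<dots> = (\<Sum>i<n. \<Sum>j<n. A $$ (i, j))" by (simp add: sum.cartesian_product)
  also have "\<dots> = card {1..r}" using A by (simp add: Theta_def)
  finally have "card {1..r} = card ?P" ..
  then obtain b where b: "bij_betw b {1..r} ?P"
    using finite_same_card_bij[of "{1..r}" ?P] by auto
  define c where "c = fst \<circ> b"
  have fibre: "card {a\<in>{1..r}. Q (c a)} = (\<Sum>p\<in>{p\<in>{..<n} \<times> {..<n}. Q p}. A $$ p)" for Q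
  proof -
    have "b ` {a\<in>{1..r}. Q (c a)} = {y \<in> b ` {1..r}. Q (fst y)}"
      unfolding c_def comp_apply by blast
    also have "\<dots> = (SIGMA p:{p\<in>{..<n} \<times> {..<n}. Q p}. {..<A $$ p})"
      unfolding bij_betw_imp_surj_on[OF b] by auto
    finally have im: "b ` {a\<in>{1..r}. Q (c a)} = (SIGMA p:{p\<in>{..<n} \<times> {..<n}. Q p}. {..<A $$ p})" .
    have inj: "inj_on b {a\<in>{1..r}. Q (c a)}"
      by (rule inj_on_subset[OF bij_betw_imp_inj_on[OF b]]) auto
    have "card {a\<in>{1..r}. Q (c a)} = card (SIGMA p:{p\<in>{..<n} \<times> {..<n}. Q p}. {..<A $$ p})"
      using card_image[OF inj] by (simp only: im)
    then show ?thesis by (subst (asm) card_SigmaI) auto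
  qed
  have c: "fst (c a) < n" "snd (c a) < n" if "a \<in> {1..r}" for a
    using bspec[OF bij_betwE[OF b] that] by (cases "b a"; force simp: c_def)+
  have "card {a\<in>{1..r}. fst (c a) = i} = card {a\<in>{1..r}. block_index (ro A) a = i}" for i
  proof (cases "i < n")
    case True
    have "{p\<in>{..<n} \<times> {..<n}. fst p = i} = Pair i ` {..<n}" using True by auto
    then show ?thesis
      using card_block_index[OF l True] fibre[of "\<lambda>p. fst p = i"] True
      by (simp add: sum.reindex inj_on_def ro_def dim)
  next
    case False
    then have "{a\<in>{1..r}. fst (c a) = i} = {}" "{a\<in>{1..r}. block_index (ro A) a = i} = {}"
      using c block_index_less[OF l] by auto
    then show ?thesis by (simp only:)
  qed
  then obtain p where p: "p permutes {1..r}" "\<forall>a\<in>{1..r}. fst (c a) = block_index (ro A) (p a)"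
    using permutes_matching_fibres[of "{1..r}" "\<lambda>a. fst (c a)" "block_index (ro A)"] by auto
  have "card {a\<in>{1..r}. snd (c a) = j} = card {a\<in>{1..r}. block_index (co A) a = j}" for j
  proof (cases "j < n")
    case True
    have "{p\<in>{..<n} \<times> {..<n}. snd p = j} = (\<lambda>i. (i, j)) ` {..<n}" using True by auto
    then show ?thesis
      using card_block_index[OF m True] fibre[of "\<lambda>p. snd p = j"] True
      by (simp add: sum.reindex inj_on_def co_def dim)
  next
    case False
    then have "{a\<in>{1..r}. snd (c a) = j} = {}" "{a\<in>{1..r}. block_index (co A) a = j} = {}"
      using c block_index_less[OF m] by auto
    then show ?thesis by (simp only:)
  qed
  then obtain q where q: "q permutes {1..r}" "\<forall>a\<in>{1..r}. snd (c a) = block_index (co A) (q a)"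
    using permutes_matching_fibres[of "{1..r}" "\<lambda>a. snd (c a)" "block_index (co A)"] by auto
  define w where "w = p \<circ> inv' q"
  have w: "w permutes {1..r}" unfolding w_def by (intro permutes_compose permutes_inv p q)
  have iw: "inv' w (p a) = q a" for a
    by (rule inv_f_eq[OF permutes_inj[OF w]]) (simp add: w_def permutes_inverses[OF q(1)])
  have "coset_matrix r (ro A) (co A) w i j = A $$ (i, j)" if "i < n" "j < n" for i j
  proof -
    have "coset_matrix r (ro A) (co A) w i j = card {a\<in>{1..r}. c a = (i, j)}"
      unfolding coset_matrix_def
      by (subst card_pullback[OF p(1), symmetric], intro arg_cong[of _ _ card])
         (use p(2) q(2) in \<open>auto simp: iw prod_eq_iff\<close>)
    also have "\<dots> = (\<Sum>p\<in>{p\<in>{..<n} \<times> {..<n}. p = (i, j)}. A $$ p)" by (rule fibre)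
    also have "{p\<in>{..<n} \<times> {..<n}. p = (i, j)} = {(i, j)}" using that by auto
    finally show ?thesis by simp
  qed
  then show ?thesis using w by blast
qed

lemma double_coset_iff:
  assumes A: "A \<in> Theta n r"
  shows "w \<in> double_coset r A \<longleftrightarrow> w permutes {1..r} \<and>
    (\<forall>i<n. \<forall>j<n. coset_matrix r (ro A) (co A) w i j = A $$ (i, j))"
proof -
  note l = ro_co_Lambda(1)[OF A] and m = ro_co_Lambda(2)[OF A]
  have dim: "dim_row A = n" "dim_col A = n" using A by (auto simp: Theta_def)
  let ?D = "\<lambda>w. (young_subgroup r (ro A) #>\<^bsub>sym_group r\<^esub> w) <#>\<^bsub>sym_group r\<^esub> young_subgroup r (co A)"
  let ?R = "{w. w permutes {1..r} \<and> (\<forall>i<n. \<forall>j<n. coset_matrix r (ro A) (co A) w i j = A $$ (i, j))}"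
  have card: "card (block (ro A) i \<inter> w ` block (co A) j) = coset_matrix r (ro A) (co A) w i j"
    if w: "w permutes {1..r}" and ij: "i < n" "j < n" for w i j
  proof -
    have "w ` block (co A) j = {a\<in>{1..r}. block_index (co A) (inv' w a) = j}"
    proof (rule Set.set_eqI)
      fix b
      show "b \<in> w ` block (co A) j \<longleftrightarrow> b \<in> {a\<in>{1..r}. block_index (co A) (inv' w a) = j}"
        unfolding block_eq[OF m ij(2)]
        using permutes_in_image[OF w] permutes_inverses[OF w] permutes_in_image[OF permutes_inv[OF w]]
        by (auto intro!: image_eqI[of _ _ "inv' w b"])
    qed
    then show ?thesis
      unfolding coset_matrix_def block_eq[OF l ij(1)]
      by (intro arg_cong[of _ _ card]) auto
  qed
  obtain w0 where w0: "w0 permutes {1..r}"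
    "\<And>i j. i < n \<Longrightarrow> j < n \<Longrightarrow> coset_matrix r (ro A) (co A) w0 i j = A $$ (i, j)"
    using exists_coset_matrix[OF A] by blast
  have D: "?D w = ?R"
    if "w permutes {1..r}" "\<forall>i<n. \<forall>j<n. coset_matrix r (ro A) (co A) w i j = A $$ (i, j)" for w
    unfolding double_coset_eq[OF l m that(1)] using that(2) by auto
  have "double_coset r A = ?R"
    unfolding double_coset_def
  proof (rule the_equality)
    show "\<exists>w\<in>carrier (sym_group r). (\<forall>i<dim_row A. \<forall>j<dim_col A.
        A $$ (i, j) = card (block (ro A) i \<inter> w ` block (co A) j)) \<and> ?R = ?D w"
      using w0 D[of w0] by (intro bexI[of _ w0]) (auto simp: sym_group_carrier dim card)
  next
    fix E assume "\<exists>w\<in>carrier (sym_group r). (\<forall>i<dim_row A. \<forall>j<dim_col A.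
        A $$ (i, j) = card (block (ro A) i \<inter> w ` block (co A) j)) \<and> E = ?D w"
    then obtain w where w: "w permutes {1..r}"
      "\<forall>i<n. \<forall>j<n. A $$ (i, j) = card (block (ro A) i \<inter> w ` block (co A) j)" "E = ?D w"
      by (auto simp: sym_group_carrier dim)
    then show "E = ?R" using D[of w] card[OF w(1)] by simp
  qed
  then show ?thesis by simp
qed

lemma double_coset_nonempty: "A \<in> Theta n r \<Longrightarrow> \<exists>w. w \<in> double_coset r A"
  using exists_coset_matrix double_coset_iff by blast

lemma double_coset_perm: "A \<in> Theta n r \<Longrightarrow> w \<in> double_coset r A \<Longrightarrow> w permutes {1..r}"
  by (simp add: double_coset_iff)

lemma double_coset_disjoint:
  assumes "A \<in> Theta n r" "B \<in> Theta n r" "ro A = ro B" "co A = co B"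
    "w \<in> double_coset r A" "w \<in> double_coset r B"
  shows "A = B"
  using assms by (intro eq_matI) (auto simp: double_coset_iff Theta_def)

lemma double_coset_cover:
  assumes "l \<in> Lambda n r" "m \<in> Lambda n r" "w permutes {1..r}"
  shows "\<exists>A\<in>Theta n r. ro A = l \<and> co A = m \<and> w \<in> double_coset r A"
  using coset_matrix_Theta[OF assms] assms(3)
  by (intro bexI[of _ "mat n n (\<lambda>(i, j). coset_matrix r l m w i j)"]) (auto simp: double_coset_iff)

lemma double_coset_orbit:
  assumes A: "A \<in> Theta n r" and w: "w \<in> double_coset r A"
  shows "double_coset r A
    = {u \<circ> w \<circ> v | u v. u \<in> young_subgroup r (ro A) \<and> v \<in> young_subgroup r (co A)}"
proof -
  note l = ro_co_Lambda(1)[OF A] and m = ro_co_Lambda(2)[OF A]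
  have "double_coset r A = (young_subgroup r (ro A) #>\<^bsub>sym_group r\<^esub> w) <#>\<^bsub>sym_group r\<^esub> young_subgroup r (co A)"
    unfolding double_coset_eq[OF l m double_coset_perm[OF A w]]
    using w by (auto simp: double_coset_iff[OF A])
  also have "\<dots> = {u \<circ> w \<circ> v | u v. u \<in> young_subgroup r (ro A) \<and> v \<in> young_subgroup r (co A)}"
    by (auto simp: r_coset_def set_mult_def sym_group_mult)
  finally show ?thesis .
qed

section \<open>The q-Schur algebra and its basis\<close>

lemma finite_Lambda: "finite (Lambda n r)"
proof (rule finite_subset)
  show "Lambda n r \<subseteq> vec n ` ({..<n} \<rightarrow>\<^sub>E {..r})"
  proof
    fix l assume l: "l \<in> Lambda n r"
    then have dim: "dim_vec l = n" and sum: "(\<Sum>i<n. l $ i) = r" by (auto simp: Lambda_def)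
    have "l $ i \<le> r" if "i < n" for i
      using member_le_sum[of i "{..<n}" "\<lambda>i. l $ i"] that sum by simp
    then have "restrict (\<lambda>i. l $ i) {..<n} \<in> {..<n} \<rightarrow>\<^sub>E {..r}" by auto
    moreover have "l = vec n (restrict (\<lambda>i. l $ i) {..<n})" using dim by auto
    ultimately show "l \<in> vec n ` ({..<n} \<rightarrow>\<^sub>E {..r})" by blast
  qed
qed (auto intro!: finite_PiE)

lemma finite_Theta: "finite (Theta n r)"
proof (rule finite_subset)
  show "Theta n r \<subseteq> mat n n ` ({..<n} \<times> {..<n} \<rightarrow>\<^sub>E {..r})"
  proof
    fix A assume A: "A \<in> Theta n r"
    then have dim: "dim_row A = n" "dim_col A = n" and sum: "(\<Sum>p\<in>{..<n} \<times> {..<n}. A $$ p) = r"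
      by (auto simp: Theta_def sum.cartesian_product)
    have "A $$ p \<le> r" if "p \<in> {..<n} \<times> {..<n}" for p
      using member_le_sum[OF that, of "\<lambda>p. A $$ p"] sum by simp
    then have "restrict (\<lambda>p. A $$ p) ({..<n} \<times> {..<n}) \<in> {..<n} \<times> {..<n} \<rightarrow>\<^sub>E {..r}" by auto
    moreover have "A = mat n n (restrict (\<lambda>p. A $$ p) ({..<n} \<times> {..<n}))" using dim by auto
    ultimately show "A \<in> mat n n ` ({..<n} \<times> {..<n} \<rightarrow>\<^sub>E {..r})" by blast
  qed
qed (auto intro!: finite_PiE)

locale schur_algebra = hecke_algebra r for r :: nat +
  fixes n :: nat
begin

abbreviation "X \<equiv> x_elt r"
abbreviation "L \<equiv> Lambda n r"

lemma young_block_index: "l \<in> L \<Longrightarrow> young r (block_index l)"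
  by unfold_locales (rule block_index_mono)

lemma young_Y_eq: "l \<in> L \<Longrightarrow> young.Y r (block_index l) = young_subgroup r l"
  by (simp add: young.Y_def[OF young_block_index] young_subgroup_eq)

lemma young_x_eq: "l \<in> L \<Longrightarrow> young.x_sum r (block_index l) = X l"
  by (simp add: young.x_sum_def[OF young_block_index] x_elt_def young_Y_eq)

lemma X_closed [intro, simp]: "l \<in> L \<Longrightarrow> X l \<in> carrier H"
  using young.x_sum_closed[OF young_block_index] by (simp add: young_x_eq)

definition same_block :: "nat vec \<Rightarrow> nat \<Rightarrow> bool" where
  "same_block l i \<longleftrightarrow> i \<in> {1..<r} \<and> block_index l i = block_index l (i + 1)"

lemma X_right_eigen:
  "l \<in> L \<Longrightarrow> same_block l i \<Longrightarrow> X l \<star> Tword [i] = qq \<odot>\<^bsub>H\<^esub> X l"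
  using young.x_sum_right_eigen[OF young_block_index] by (simp add: young_x_eq same_block_def)

lemma X_left_eigen:
  "l \<in> L \<Longrightarrow> same_block l i \<Longrightarrow> h \<in> carrier H \<Longrightarrow>
    Tword [i] \<star> (X l \<star> h) = qq \<odot>\<^bsub>H\<^esub> (X l \<star> h)"
  using young.left_ideal_eigen[OF young_block_index] by (simp add: young_x_eq same_block_def)

lemma left_factor:
  assumes "l \<in> L" "y \<in> carrier H"
    "\<And>u w. u \<in> young_subgroup r l \<Longrightarrow> w permutes {1..r} \<Longrightarrow> coef y (u \<circ> w) = coef y w"
  shows "\<exists>h\<in>carrier H. y = X l \<star> h"
  using young.left_invariant_factor[OF young_block_index, of l y] assms
  by (simp add: young_x_eq young_Y_eq)

lemma right_factor:
  assumes "l \<in> L" "y \<in> carrier H"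
    "\<And>u w. u \<in> young_subgroup r l \<Longrightarrow> w permutes {1..r} \<Longrightarrow> coef y (w \<circ> u) = coef y w"
  shows "\<exists>h\<in>carrier H. y = h \<star> X l"
  using young.right_invariant_factor[OF young_block_index, of l y] assms
  by (simp add: young_x_eq young_Y_eq)

lemma left_eigen_invariant:
  assumes l: "l \<in> L" and y: "y \<in> carrier H"
    and eig: "\<And>i. same_block l i \<Longrightarrow> Tword [i] \<star> y = qq \<odot>\<^bsub>H\<^esub> y"
    and u: "u \<in> young_subgroup r l" and w: "w permutes {1..r}"
  shows "coef y (u \<circ> w) = coef y w"
proof (rule young.left_invariant[OF young_block_index[OF l] _ _ w])
  fix i w assume "i \<in> {1..<r}" "block_index l i = block_index l (i + 1)" "w permutes {1..r}"
  then show "coef y (st i \<circ> w) = coef y w"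
    using left_eigen_iff[of i y] eig[of i] y by (simp add: same_block_def)
qed (simp add: u young_Y_eq[OF l])

lemma right_eigen_invariant:
  assumes l: "l \<in> L" and y: "y \<in> carrier H"
    and eig: "\<And>i. same_block l i \<Longrightarrow> y \<star> Tword [i] = qq \<odot>\<^bsub>H\<^esub> y"
    and u: "u \<in> young_subgroup r l" and w: "w permutes {1..r}"
  shows "coef y (w \<circ> u) = coef y w"
proof (rule young.right_invariant[OF young_block_index[OF l] _ _ w])
  fix i w assume "i \<in> {1..<r}" "block_index l i = block_index l (i + 1)" "w permutes {1..r}"
  then show "coef y (w \<circ> st i) = coef y w"
    using right_eigen_iff[of i y] eig[of i] y by (simp add: same_block_def)
qed (simp add: u young_Y_eq[OF l])

subsection \<open>The module and its endomorphisms\<close>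

definition XH :: "nat vec \<Rightarrow> hecke_elt set" where
  "XH l = X l <#\<^bsub>H\<^esub> carrier H"

abbreviation "M \<equiv> schur_mod n r"
abbreviation "S \<equiv> schur n r"

lemma XH_iff: "y \<in> XH l \<longleftrightarrow> (\<exists>h\<in>carrier H. y = X l \<star> h)"
  by (auto simp: XH_def l_coset_def)

lemma XH_carrier: "l \<in> L \<Longrightarrow> y \<in> XH l \<Longrightarrow> y \<in> carrier H"
  by (auto simp: XH_iff)

lemma XH_add: "l \<in> L \<Longrightarrow> y \<in> XH l \<Longrightarrow> z \<in> XH l \<Longrightarrow> y \<oplus>\<^bsub>H\<^esub> z \<in> XH l"
  by (auto simp: XH_iff H.r_distr[symmetric] intro!: bexI[of _ "_ \<oplus>\<^bsub>H\<^esub> _"])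

lemma XH_mult: "l \<in> L \<Longrightarrow> y \<in> XH l \<Longrightarrow> h \<in> carrier H \<Longrightarrow> y \<star> h \<in> XH l"
  by (auto simp: XH_iff H.m_assoc intro!: bexI[of _ "_ \<star> _"])

lemma XH_zero: "l \<in> L \<Longrightarrow> \<zero>\<^bsub>H\<^esub> \<in> XH l"
  unfolding XH_iff by (rule bexI[of _ "\<zero>\<^bsub>H\<^esub>"]) auto

lemma XH_X: "l \<in> L \<Longrightarrow> X l \<in> XH l"
  unfolding XH_iff by (rule bexI[of _ "\<one>\<^bsub>H\<^esub>"]) auto

lemma smult_eq_mult: "a \<in> carrier AA \<Longrightarrow> y \<in> carrier H \<Longrightarrow> a \<odot>\<^bsub>H\<^esub> y = y \<star> (a \<odot>\<^bsub>H\<^esub> \<one>\<^bsub>H\<^esub>)"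
  by (simp add: smult_mult_right)

lemma XH_smult: "l \<in> L \<Longrightarrow> a \<in> carrier AA \<Longrightarrow> y \<in> XH l \<Longrightarrow> a \<odot>\<^bsub>H\<^esub> y \<in> XH l"
  by (subst smult_eq_mult) (auto intro: XH_mult XH_carrier)

lemma M_iff: "m \<in> M \<longleftrightarrow> (\<forall>l\<in>L. m l \<in> XH l) \<and> m \<in> extensional L"
  by (auto simp: schur_mod_def XH_def PiE_def)

lemma M_app: "m \<in> M \<Longrightarrow> l \<in> L \<Longrightarrow> m l \<in> XH l"
  by (simp add: M_iff)

lemma M_app_H [simp]: "m \<in> M \<Longrightarrow> l \<in> L \<Longrightarrow> m l \<in> carrier H"
  by (simp add: M_app XH_carrier)

lemma M_eqI: "m \<in> M \<Longrightarrow> m' \<in> M \<Longrightarrow> (\<And>l. l \<in> L \<Longrightarrow> m l = m' l) \<Longrightarrow> m = m'"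
  unfolding M_iff by (auto intro: extensionalityI)

abbreviation "addM \<equiv> schur_mod_add n r"
abbreviation "actM \<equiv> schur_mod_act n r"
abbreviation "injM \<equiv> schur_mod_inj n r"

lemma addM_closed [simp]: "m \<in> M \<Longrightarrow> m' \<in> M \<Longrightarrow> addM m m' \<in> M"
  by (simp add: M_iff schur_mod_add_def XH_add)

lemma addM_app [simp]: "l \<in> L \<Longrightarrow> addM m m' l = m l \<oplus>\<^bsub>H\<^esub> m' l"
  by (simp add: schur_mod_add_def)

lemma actM_closed [simp]: "m \<in> M \<Longrightarrow> h \<in> carrier H \<Longrightarrow> actM m h \<in> M"
  by (simp add: M_iff schur_mod_act_def XH_mult)

lemma actM_app [simp]: "l \<in> L \<Longrightarrow> actM m h l = m l \<star> h"
  by (simp add: schur_mod_act_def)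

lemma injM_closed [simp]: "l \<in> L \<Longrightarrow> y \<in> XH l \<Longrightarrow> injM l y \<in> M"
  by (simp add: M_iff schur_mod_inj_def XH_zero)

lemma injM_app [simp]: "k \<in> L \<Longrightarrow> injM l y k = (if k = l then y else \<zero>\<^bsub>H\<^esub>)"
  by (simp add: schur_mod_inj_def)

definition zeroM :: schur_mod_elt where
  "zeroM = (\<lambda>l\<in>L. \<zero>\<^bsub>H\<^esub>)"

lemma zeroM_closed [simp]: "zeroM \<in> M"
  by (simp add: zeroM_def M_iff XH_zero)

lemma zeroM_app [simp]: "l \<in> L \<Longrightarrow> zeroM l = \<zero>\<^bsub>H\<^esub>"
  by (simp add: zeroM_def)

definition smultM :: "ratfun \<Rightarrow> schur_mod_elt \<Rightarrow> schur_mod_elt" where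
  "smultM a m = (\<lambda>l\<in>L. a \<odot>\<^bsub>H\<^esub> m l)"

lemma smultM_closed [simp]: "a \<in> carrier AA \<Longrightarrow> m \<in> M \<Longrightarrow> smultM a m \<in> M"
  by (simp add: smultM_def M_iff XH_smult)

lemma smultM_app [simp]: "l \<in> L \<Longrightarrow> smultM a m l = a \<odot>\<^bsub>H\<^esub> m l"
  by (simp add: smultM_def)

lemma smultM_eq_act: "a \<in> carrier AA \<Longrightarrow> m \<in> M \<Longrightarrow> smultM a m = actM m (a \<odot>\<^bsub>H\<^esub> \<one>\<^bsub>H\<^esub>)"
  by (rule M_eqI) (simp_all add: smult_mult_right)

lemma S_iff: "f \<in> carrier S \<longleftrightarrow> f \<in> M \<rightarrow>\<^sub>E M \<and>
    (\<forall>m\<in>M. \<forall>m'\<in>M. f (addM m m') = addM (f m) (f m')) \<and>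
    (\<forall>m\<in>M. \<forall>h\<in>carrier H. f (actM m h) = actM (f m) h)"
  by (simp add: schur_def)

lemma S_intro:
  assumes "\<And>m. m \<in> M \<Longrightarrow> f m \<in> M" "f \<in> extensional M"
    "\<And>m m'. m \<in> M \<Longrightarrow> m' \<in> M \<Longrightarrow> f (addM m m') = addM (f m) (f m')"
    "\<And>m h. m \<in> M \<Longrightarrow> h \<in> carrier H \<Longrightarrow> f (actM m h) = actM (f m) h"
  shows "f \<in> carrier S"
  using assms by (auto simp: S_iff PiE_def)

lemma S_app [simp]: "f \<in> carrier S \<Longrightarrow> m \<in> M \<Longrightarrow> f m \<in> M"
  by (auto simp: S_iff)

lemma S_addM: "f \<in> carrier S \<Longrightarrow> m \<in> M \<Longrightarrow> m' \<in> M \<Longrightarrow> f (addM m m') = addM (f m) (f m')"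
  by (simp add: S_iff)

lemma S_actM: "f \<in> carrier S \<Longrightarrow> m \<in> M \<Longrightarrow> h \<in> carrier H \<Longrightarrow> f (actM m h) = actM (f m) h"
  by (simp add: S_iff)

text \<open>
  Scalars are central in the Hecke algebra, so they act through its right action.
\<close>

lemma S_smultM: "f \<in> carrier S \<Longrightarrow> a \<in> carrier AA \<Longrightarrow> m \<in> M \<Longrightarrow> f (smultM a m) = smultM a (f m)"
  by (simp add: smultM_eq_act S_actM)

lemma S_zeroM: "f \<in> carrier S \<Longrightarrow> f zeroM = zeroM"
proof -
  assume f: "f \<in> carrier S"
  have "actM m \<zero>\<^bsub>H\<^esub> = zeroM" if "m \<in> M" for m using that by (intro M_eqI) auto
  then show ?thesis using S_actM[OF f zeroM_closed, of "\<zero>\<^bsub>H\<^esub>"] f by simp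
qed

lemma S_eqI': "f \<in> carrier S \<Longrightarrow> g \<in> carrier S \<Longrightarrow> (\<And>m. m \<in> M \<Longrightarrow> f m = g m) \<Longrightarrow> f = g"
  unfolding S_iff PiE_def by (auto intro: extensionalityI)

lemma S_mult_app [simp]: "m \<in> M \<Longrightarrow> (f \<otimes>\<^bsub>S\<^esub> g) m = f (g m)"
  by (simp add: schur_def compose_def)

lemma S_one_app [simp]: "m \<in> M \<Longrightarrow> \<one>\<^bsub>S\<^esub> m = m"
  by (simp add: schur_def)

lemma S_add_app [simp]: "m \<in> M \<Longrightarrow> (f \<oplus>\<^bsub>S\<^esub> g) m = addM (f m) (g m)"
  by (simp add: schur_def)

lemma S_zero_app [simp]: "m \<in> M \<Longrightarrow> \<zero>\<^bsub>S\<^esub> m = zeroM"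
  by (simp add: schur_def zeroM_def)

lemma S_smult_app [simp]: "m \<in> M \<Longrightarrow> (a \<odot>\<^bsub>S\<^esub> f) m = smultM a (f m)"
  by (simp add: schur_def smultM_def)

lemma addM_interchange:
  "m1 \<in> M \<Longrightarrow> m2 \<in> M \<Longrightarrow> m3 \<in> M \<Longrightarrow> m4 \<in> M \<Longrightarrow>
    addM (addM m1 m2) (addM m3 m4) = addM (addM m1 m3) (addM m2 m4)"
  by (rule M_eqI) (simp_all add: H.a_ac)

lemma S_mult_closed [simp]: "f \<in> carrier S \<Longrightarrow> g \<in> carrier S \<Longrightarrow> f \<otimes>\<^bsub>S\<^esub> g \<in> carrier S"
  by (rule S_intro) (simp_all add: S_addM S_actM, simp add: schur_def compose_def)

lemma S_one_closed [simp]: "\<one>\<^bsub>S\<^esub> \<in> carrier S"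
  by (rule S_intro) (simp_all, simp add: schur_def)

lemma S_add_closed [simp]: "f \<in> carrier S \<Longrightarrow> g \<in> carrier S \<Longrightarrow> f \<oplus>\<^bsub>S\<^esub> g \<in> carrier S"
proof (rule S_intro)
  fix m h assume "f \<in> carrier S" "g \<in> carrier S" "m \<in> M" "h \<in> carrier H"
  then show "(f \<oplus>\<^bsub>S\<^esub> g) (actM m h) = actM ((f \<oplus>\<^bsub>S\<^esub> g) m) h"
    by (intro M_eqI) (simp_all add: S_actM H.l_distr)
qed (simp_all add: S_addM addM_interchange, simp add: schur_def)

lemma S_zero_closed [simp]: "\<zero>\<^bsub>S\<^esub> \<in> carrier S"
proof (rule S_intro)
  fix m m' assume "m \<in> M" "m' \<in> M"
  then show "\<zero>\<^bsub>S\<^esub> (addM m m') = addM (\<zero>\<^bsub>S\<^esub> m) (\<zero>\<^bsub>S\<^esub> m')" by (intro M_eqI) simp_all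
next
  fix m h assume "m \<in> M" "h \<in> carrier H"
  then show "\<zero>\<^bsub>S\<^esub> (actM m h) = actM (\<zero>\<^bsub>S\<^esub> m) h" by (intro M_eqI) simp_all
qed (simp_all, simp add: schur_def)

lemma S_smult_closed [simp]: "a \<in> carrier AA \<Longrightarrow> f \<in> carrier S \<Longrightarrow> a \<odot>\<^bsub>S\<^esub> f \<in> carrier S"
proof (rule S_intro)
  assume a: "a \<in> carrier AA" and f: "f \<in> carrier S"
  show "(a \<odot>\<^bsub>S\<^esub> f) (addM m m') = addM ((a \<odot>\<^bsub>S\<^esub> f) m) ((a \<odot>\<^bsub>S\<^esub> f) m')"
    if "m \<in> M" "m' \<in> M" for m m'
    using a f that by (intro M_eqI) (simp_all add: S_addM smult_add_right)
  show "(a \<odot>\<^bsub>S\<^esub> f) (actM m h) = actM ((a \<odot>\<^bsub>S\<^esub> f) m) h" if "m \<in> M" "h \<in> carrier H" for m h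
    using a f that by (intro M_eqI) (simp_all add: S_actM smult_mult_left)
qed (simp_all, simp add: schur_def)

lemma S_monoid: "Group.monoid S"
  by (rule monoidI) (auto intro!: S_eqI')

sublocale S: abelian_monoid S
proof (rule abelian_monoidI)
  fix f g h assume "f \<in> carrier S" "g \<in> carrier S" "h \<in> carrier S"
  then show "f \<oplus>\<^bsub>S\<^esub> g \<oplus>\<^bsub>S\<^esub> h = f \<oplus>\<^bsub>S\<^esub> (g \<oplus>\<^bsub>S\<^esub> h)" "f \<oplus>\<^bsub>S\<^esub> g = g \<oplus>\<^bsub>S\<^esub> f"
    by (auto intro!: S_eqI' M_eqI simp: H.a_ac)
next
  fix f assume "f \<in> carrier S"
  then show "\<zero>\<^bsub>S\<^esub> \<oplus>\<^bsub>S\<^esub> f = f" by (intro S_eqI' M_eqI) simp_all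
qed simp_all

lemma S_distr:
  assumes "f \<in> carrier S" "g \<in> carrier S" "h \<in> carrier S"
  shows "f \<otimes>\<^bsub>S\<^esub> (g \<oplus>\<^bsub>S\<^esub> h) = f \<otimes>\<^bsub>S\<^esub> g \<oplus>\<^bsub>S\<^esub> f \<otimes>\<^bsub>S\<^esub> h"
    "(g \<oplus>\<^bsub>S\<^esub> h) \<otimes>\<^bsub>S\<^esub> f = g \<otimes>\<^bsub>S\<^esub> f \<oplus>\<^bsub>S\<^esub> h \<otimes>\<^bsub>S\<^esub> f"
  using assms by (auto intro!: S_eqI' simp: S_addM)

lemma S_smult_mult:
  assumes "a \<in> carrier AA" "f \<in> carrier S" "g \<in> carrier S"
  shows "(a \<odot>\<^bsub>S\<^esub> f) \<otimes>\<^bsub>S\<^esub> g = a \<odot>\<^bsub>S\<^esub> (f \<otimes>\<^bsub>S\<^esub> g)"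
    "f \<otimes>\<^bsub>S\<^esub> (a \<odot>\<^bsub>S\<^esub> g) = a \<odot>\<^bsub>S\<^esub> (f \<otimes>\<^bsub>S\<^esub> g)"
  using assms by (auto intro!: S_eqI' simp: S_smultM)

lemma S_smult_assoc:
  assumes "a \<in> carrier AA" "b \<in> carrier AA" "f \<in> carrier S"
  shows "(a * b) \<odot>\<^bsub>S\<^esub> f = a \<odot>\<^bsub>S\<^esub> (b \<odot>\<^bsub>S\<^esub> f)"
  using assms hf.mult_mem[of a b] by (auto intro!: S_eqI' M_eqI simp: smult_assoc)

lemma S_smult_one: "f \<in> carrier S \<Longrightarrow> 1 \<odot>\<^bsub>S\<^esub> f = f"
  using hf.one_mem by (auto intro!: S_eqI' M_eqI simp: smult_one)

definition gen :: "nat vec \<Rightarrow> schur_mod_elt" where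
  "gen l = injM l (X l)"

lemma gen_closed [simp]: "l \<in> L \<Longrightarrow> gen l \<in> M"
  by (simp add: gen_def XH_X)

lemma gen_app: "k \<in> L \<Longrightarrow> gen l k = (if k = l then X l else \<zero>\<^bsub>H\<^esub>)"
  by (simp add: gen_def)

text \<open>
  The module is generated by the elements \<open>x\<^sub>\<lambda>\<close> of its summands.
\<close>

lemma S_eqI:
  assumes f: "f \<in> carrier S" and g: "g \<in> carrier S" and eq: "\<And>l. l \<in> L \<Longrightarrow> f (gen l) = g (gen l)"
  shows "f = g"
proof (rule S_eqI'[OF f g])
  fix m assume m: "m \<in> M"
  have inj: "f (injM l y) = g (injM l y)" if l: "l \<in> L" and y: "y \<in> XH l" for l y
  proof -
    obtain h where h: "h \<in> carrier H" "y = X l \<star> h" using y by (auto simp: XH_iff)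
    have "injM l y = actM (gen l) h"
      using l y h XH_X by (intro M_eqI) (simp_all add: gen_def)
    then show ?thesis using l h eq f g by (simp add: S_actM)
  qed
  define part where "part K = (\<lambda>l\<in>L. if l \<in> K then m l else \<zero>\<^bsub>H\<^esub>)" for K
  have part_app: "part K l = (if l \<in> K then m l else \<zero>\<^bsub>H\<^esub>)" if "l \<in> L" for K l
    using that by (simp add: part_def)
  have part: "part K \<in> M" for K using m by (simp add: part_def M_iff XH_zero)
  have "finite K \<Longrightarrow> K \<subseteq> L \<Longrightarrow> f (part K) = g (part K)" for K
  proof (induction K rule: finite_induct)
    case empty
    have "part {} = zeroM" by (simp add: part_def zeroM_def)
    then show ?case using f g by (simp add: S_zeroM)
  next
    case (insert k K)
    then have k: "k \<in> L" by simp
    have kM: "injM k (m k) \<in> M" using k m by (simp add: M_app)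
    have "part (insert k K) = addM (part K) (injM k (m k))"
      using insert(2) m k kM by (intro M_eqI part addM_closed) (auto simp: part_app)
    then show ?case
      using insert inj[OF k M_app[OF m k]] by (simp add: S_addM[OF f part kM] S_addM[OF g part kM])
  qed
  from this[OF finite_Lambda] have "f (part L) = g (part L)" by simp
  moreover have "part L = m" using m by (intro M_eqI part) (auto simp: part_app)
  ultimately show "f m = g m" by simp
qed

subsection \<open>The basis elements\<close>

definition dc_sum :: "nat mat \<Rightarrow> hecke_elt" where
  "dc_sum A = (\<Oplus>\<^bsub>H\<^esub>w\<in>double_coset r A. T w)"

abbreviation "\<Theta> \<equiv> Theta n r"

lemma finite_double_coset: "A \<in> \<Theta> \<Longrightarrow> finite (double_coset r A)"
  by (rule finite_subset[OF _ finite_perms]) (auto simp: double_coset_perm)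

lemma dc_sum_closed [simp]: "A \<in> \<Theta> \<Longrightarrow> dc_sum A \<in> carrier H"
  unfolding dc_sum_def by (rule H.finsum_closed) (auto simp: double_coset_perm)

lemma coef_dc_sum: "A \<in> \<Theta> \<Longrightarrow> coef (dc_sum A) w = (if w \<in> double_coset r A then 1 else 0)"
proof -
  assume A: "A \<in> \<Theta>"
  have "coef (dc_sum A) w = (\<Sum>u\<in>double_coset r A. if w = u then 1 else 0)"
    unfolding dc_sum_def using double_coset_perm[OF A]
    by (subst coef_finsum[OF finite_double_coset[OF A]]) (auto simp: coef_T)
  then show ?thesis using finite_double_coset[OF A] by simp
qed

lemma young_group:
  assumes "l \<in> L"
  shows "u \<in> young_subgroup r l \<Longrightarrow> u permutes {1..r}"
    "u \<in> young_subgroup r l \<Longrightarrow> v \<in> young_subgroup r l \<Longrightarrow> u \<circ> v \<in> young_subgroup r l"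
    "u \<in> young_subgroup r l \<Longrightarrow> inv' u \<in> young_subgroup r l"
    "id \<in> young_subgroup r l"
  using young.Y_perm[OF young_block_index[OF assms]] young.Y_comp[OF young_block_index[OF assms]]
    young.Y_inv[OF young_block_index[OF assms]] young.Y_id[OF young_block_index[OF assms]]
  by (simp_all add: young_Y_eq[OF assms])

lemma double_coset_left:
  assumes A: "A \<in> \<Theta>" and u: "u \<in> young_subgroup r (ro A)" and w: "w \<in> double_coset r A"
  shows "u \<circ> w \<in> double_coset r A"
proof -
  have "u \<circ> w \<circ> id \<in> double_coset r A"
    unfolding double_coset_orbit[OF A w]
    using u young_group(4)[OF ro_co_Lambda(2)[OF A]] by blast
  then show ?thesis by simp
qed

lemma double_coset_right:
  assumes A: "A \<in> \<Theta>" and u: "u \<in> young_subgroup r (co A)" and w: "w \<in> double_coset r A"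
  shows "w \<circ> u \<in> double_coset r A"
proof -
  have "id \<circ> w \<circ> u \<in> double_coset r A"
    unfolding double_coset_orbit[OF A w]
    using u young_group(4)[OF ro_co_Lambda(1)[OF A]] by blast
  then show ?thesis by simp
qed

text \<open>
  A double coset is invariant under both Young subgroups, and so is its indicator function.
\<close>

lemma dc_sum_factors:
  assumes A: "A \<in> \<Theta>"
  shows "\<exists>h\<in>carrier H. dc_sum A = X (ro A) \<star> h" "\<exists>h\<in>carrier H. dc_sum A = h \<star> X (co A)"
proof -
  note l = ro_co_Lambda[OF A]
  have "u \<circ> w \<in> double_coset r A \<longleftrightarrow> w \<in> double_coset r A" if u: "u \<in> young_subgroup r (ro A)" for u w
  proof
    assume "u \<circ> w \<in> double_coset r A"
    then have "inv' u \<circ> (u \<circ> w) \<in> double_coset r A"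
      by (rule double_coset_left[OF A young_group(3)[OF l(1) u]])
    then show "w \<in> double_coset r A"
      using permutes_inv_o(2)[OF young_group(1)[OF l(1) u]] by (simp add: comp_assoc[symmetric])
  qed (rule double_coset_left[OF A u])
  then show "\<exists>h\<in>carrier H. dc_sum A = X (ro A) \<star> h"
    by (intro left_factor l dc_sum_closed A) (simp add: coef_dc_sum[OF A])
  have "w \<circ> u \<in> double_coset r A \<longleftrightarrow> w \<in> double_coset r A" if u: "u \<in> young_subgroup r (co A)" for u w
  proof
    assume "w \<circ> u \<in> double_coset r A"
    then have "w \<circ> u \<circ> inv' u \<in> double_coset r A"
      by (rule double_coset_right[OF A young_group(3)[OF l(2) u]])
    then show "w \<in> double_coset r A"
      using permutes_inv_o(1)[OF young_group(1)[OF l(2) u]] by (simp add: comp_assoc)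
  qed (rule double_coset_right[OF A u])
  then show "\<exists>h\<in>carrier H. dc_sum A = h \<star> X (co A)"
    by (intro right_factor l dc_sum_closed A) (simp add: coef_dc_sum[OF A])
qed

text \<open>
  If the sum over the double coset is \<open>h' x\<^sub>\<mu> = x\<^sub>\<lambda> k\<close>, then left multiplication by \<open>h'\<close> maps \<open>x\<^sub>\<mu> h\<close>
  to \<open>h' x\<^sub>\<mu> h = x\<^sub>\<lambda> k h\<close>. This gives a homomorphism \<open>x\<^sub>\<mu> H \<rightarrow> x\<^sub>\<lambda> H\<close>.
\<close>

lemma e_elt_props:
  assumes A: "A \<in> \<Theta>"
  shows "e_elt n r A \<in> carrier S"
    and "l \<in> L \<Longrightarrow> e_elt n r A (gen l) = injM (ro A) (if l = co A then dc_sum A else \<zero>\<^bsub>H\<^esub>)"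
proof -
  note ro = ro_co_Lambda(1)[OF A] and co = ro_co_Lambda(2)[OF A]
  obtain k where k: "k \<in> carrier H" "dc_sum A = X (ro A) \<star> k" using dc_sum_factors(1)[OF A] by auto
  obtain h' where h': "h' \<in> carrier H" "dc_sum A = h' \<star> X (co A)" using dc_sum_factors(2)[OF A] by auto
  let ?P = "\<lambda>f. f \<in> carrier S \<and> (\<forall>l\<in>L. \<forall>h\<in>carrier H. f (injM l (X l \<star> h)) =
      injM (ro A) (if l = co A then dc_sum A \<star> h else \<zero>\<^bsub>H\<^esub>))"
  define f where "f = (\<lambda>m\<in>M. injM (ro A) (h' \<star> m (co A)))"
  have XHr: "dc_sum A \<star> h \<in> XH (ro A)" if "h \<in> carrier H" for h
    using that k ro by (auto simp: XH_iff H.m_assoc)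
  have in_XH: "h' \<star> m (co A) \<in> XH (ro A)" if m: "m \<in> M" for m
  proof -
    obtain h where h: "h \<in> carrier H" "m (co A) = X (co A) \<star> h"
      using M_app[OF m co] by (auto simp: XH_iff)
    then have "h' \<star> m (co A) = dc_sum A \<star> h" using h' co by (simp add: H.m_assoc)
    then show ?thesis using XHr h by simp
  qed
  have f: "f \<in> carrier S"
  proof (rule S_intro)
    fix m m' assume mm: "m \<in> M" "m' \<in> M"
    then show "f (addM m m') = addM (f m) (f m')"
      using h' in_XH in_XH[OF addM_closed[OF mm]] ro co
      by (intro M_eqI) (auto simp: f_def H.r_distr)
  next
    fix m h assume mh: "m \<in> M" "h \<in> carrier H"
    then show "f (actM m h) = actM (f m) h"
      using h' in_XH in_XH[OF actM_closed[OF mh]] ro co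
      by (intro M_eqI) (auto simp: f_def H.m_assoc)
  qed (use ro in_XH in \<open>auto simp: f_def\<close>)
  have Pf: "?P f"
  proof (intro conjI f ballI)
    fix l h assume l: "l \<in> L" and h: "h \<in> carrier H"
    have "X l \<star> h \<in> XH l" using l h by (auto simp: XH_iff)
    then show "f (injM l (X l \<star> h)) = injM (ro A) (if l = co A then dc_sum A \<star> h else \<zero>\<^bsub>H\<^esub>)"
      using l h h' co by (auto simp: f_def H.m_assoc)
  qed
  have gen: "g (gen l) = injM (ro A) (if l = co A then dc_sum A else \<zero>\<^bsub>H\<^esub>)"
    if "?P g" "l \<in> L" for g l
    using that(1)[THEN conjunct2, THEN bspec[OF _ that(2)], THEN bspec[OF _ H.one_closed]] that(2) A
    by (simp add: gen_def)
  have "e_elt n r A = (THE f. ?P f)" by (simp only: e_elt_def dc_sum_def)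
  also have "\<dots> = f"
  proof (rule the_equality)
    show "?P f" by (rule Pf)
    fix g assume g: "?P g"
    then have gS: "g \<in> carrier S" by blast
    show "g = f" by (rule S_eqI[OF gS f]) (simp only: gen[OF g] gen[OF Pf])
  qed
  finally have e: "e_elt n r A = f" .
  show "e_elt n r A \<in> carrier S" unfolding e by (rule f)
  show "l \<in> L \<Longrightarrow> e_elt n r A (gen l) = injM (ro A) (if l = co A then dc_sum A else \<zero>\<^bsub>H\<^esub>)"
    unfolding e by (rule gen[OF Pf])
qed

definition coord :: "nat vec \<Rightarrow> nat vec \<Rightarrow> (nat \<Rightarrow> nat) \<Rightarrow> schur_elt \<Rightarrow> ratfun" where
  "coord l m w f = coef (f (gen m) l) w"

lemma coord_add:
  "l \<in> L \<Longrightarrow> m \<in> L \<Longrightarrow> f \<in> carrier S \<Longrightarrow> g \<in> carrier S \<Longrightarrow>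
    coord l m w (f \<oplus>\<^bsub>S\<^esub> g) = coord l m w f + coord l m w g"
  by (simp add: coord_def coef_add)

lemma coord_smult:
  "l \<in> L \<Longrightarrow> m \<in> L \<Longrightarrow> f \<in> carrier S \<Longrightarrow> a \<in> carrier AA \<Longrightarrow>
    coord l m w (a \<odot>\<^bsub>S\<^esub> f) = a * coord l m w f"
  by (simp add: coord_def coef_smult)

lemma coord_zero: "l \<in> L \<Longrightarrow> m \<in> L \<Longrightarrow> coord l m w \<zero>\<^bsub>S\<^esub> = 0"
  by (simp add: coord_def coef_zero)

lemma coord_e_elt:
  assumes "A \<in> \<Theta>" "l \<in> L" "m \<in> L"
  shows "coord l m w (e_elt n r A) = (if ro A = l \<and> co A = m \<and> w \<in> double_coset r A then 1 else 0)"
  using assms by (auto simp: coord_def e_elt_props coef_dc_sum coef_zero)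

lemma coord_finsum:
  "finite K \<Longrightarrow> g \<in> K \<rightarrow> carrier S \<Longrightarrow> l \<in> L \<Longrightarrow> m \<in> L \<Longrightarrow>
    coord l m w (finsum S g K) = (\<Sum>k\<in>K. coord l m w (g k))"
  by (induction K rule: finite_induct) (auto simp: coord_zero coord_add)

lemma coord_eqI:
  assumes f: "f \<in> carrier S" and g: "g \<in> carrier S"
    and eq: "\<And>l m w. l \<in> L \<Longrightarrow> m \<in> L \<Longrightarrow> w permutes {1..r} \<Longrightarrow> coord l m w f = coord l m w g"
  shows "f = g"
proof (rule S_eqI[OF f g])
  fix m assume m: "m \<in> L"
  show "f (gen m) = g (gen m)"
    using f g m eq[OF _ m] by (intro M_eqI H_eqI) (auto simp: coord_def)
qed

lemma coord_AA: "l \<in> L \<Longrightarrow> m \<in> L \<Longrightarrow> f \<in> carrier S \<Longrightarrow> coord l m w f \<in> carrier AA"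
  by (simp add: coord_def coef_AA)

text \<open>
  The \<open>\<lambda>\<close>-component \<open>y\<close> of \<open>f (x\<^sub>\<mu>)\<close> is a left eigenvector as an element of \<open>x\<^sub>\<lambda> H\<close>, and a right
  eigenvector as the image of the right eigenvector \<open>x\<^sub>\<mu>\<close>.
\<close>

lemma coord_double_coset:
  assumes f: "f \<in> carrier S" and A: "A \<in> \<Theta>"
    and w: "w \<in> double_coset r A" "w' \<in> double_coset r A"
  shows "coord (ro A) (co A) w' f = coord (ro A) (co A) w f"
proof -
  note l = ro_co_Lambda(1)[OF A] and m = ro_co_Lambda(2)[OF A]
  let ?y = "f (gen (co A)) (ro A)"
  have fM: "f (gen (co A)) \<in> M" using f m by simp
  have y: "?y \<in> carrier H" using M_app_H[OF fM l] .
  have left: "coef ?y (u \<circ> v) = coef ?y v" if "u \<in> young_subgroup r (ro A)" "v permutes {1..r}" for u v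
  proof (rule left_eigen_invariant[OF l y _ that])
    obtain h where "h \<in> carrier H" "?y = X (ro A) \<star> h" using M_app[OF fM l] by (auto simp: XH_iff)
    then show "Tword [i] \<star> ?y = qq \<odot>\<^bsub>H\<^esub> ?y" if "same_block (ro A) i" for i
      using X_left_eigen[OF l that] by simp
  qed
  have right: "coef ?y (v \<circ> u) = coef ?y v" if "u \<in> young_subgroup r (co A)" "v permutes {1..r}" for u v
  proof (rule right_eigen_invariant[OF m y _ that])
    fix i assume i: "same_block (co A) i"
    then have Ti: "Tword [i] \<in> carrier H" by (simp add: same_block_def)
    have "actM (gen (co A)) (Tword [i]) = smultM qq (gen (co A))"
      using m Ti X_right_eigen[OF m i] qq_AA smult_eq_mult[OF qq_AA H.zero_closed]
      by (intro M_eqI) (auto simp: gen_app)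
    then have "actM (f (gen (co A))) (Tword [i]) = smultM qq (f (gen (co A)))"
      using f m Ti qq_AA by (simp flip: S_actM S_smultM)
    then have "actM (f (gen (co A))) (Tword [i]) (ro A) = smultM qq (f (gen (co A))) (ro A)" by simp
    then show "?y \<star> Tword [i] = qq \<odot>\<^bsub>H\<^esub> ?y" using l by simp
  qed
  obtain u v where uv: "u \<in> young_subgroup r (ro A)" "v \<in> young_subgroup r (co A)" "w' = u \<circ> w \<circ> v"
    using w(2) double_coset_orbit[OF A w(1)] by auto
  have "w permutes {1..r}" "u \<circ> w permutes {1..r}"
    using double_coset_perm[OF A w(1)] young_group(1)[OF l uv(1)] by (auto intro: permutes_compose)
  then show ?thesis using left[OF uv(1)] right[OF uv(2)] by (simp add: coord_def uv(3))
qed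

text \<open>
  The coefficient of \<open>e\<^sub>A\<close> is the common value of the coordinates of \<open>f\<close> on the double coset of \<open>A\<close>.
\<close>

lemma S_spanned:
  assumes f: "f \<in> carrier S"
  shows "\<exists>c. (\<forall>A\<in>\<Theta>. c A \<in> carrier AA) \<and> f = (\<Oplus>\<^bsub>S\<^esub>A\<in>\<Theta>. c A \<odot>\<^bsub>S\<^esub> e_elt n r A)"
proof -
  define c where "c A = coord (ro A) (co A) (SOME w. w \<in> double_coset r A) f" for A
  have cA: "c A \<in> carrier AA" if "A \<in> \<Theta>" for A
    unfolding c_def using that f by (intro coord_AA ro_co_Lambda)
  have c: "c A = coord (ro A) (co A) w f" if "A \<in> \<Theta>" "w \<in> double_coset r A" for A w
    unfolding c_def using that by (intro coord_double_coset f someI[of "\<lambda>w. w \<in> double_coset r A"])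
  have g: "c A \<odot>\<^bsub>S\<^esub> e_elt n r A \<in> carrier S" if "A \<in> \<Theta>" for A
    using that cA e_elt_props by simp
  have "f = (\<Oplus>\<^bsub>S\<^esub>A\<in>\<Theta>. c A \<odot>\<^bsub>S\<^esub> e_elt n r A)"
  proof (rule coord_eqI[OF f])
    show "(\<Oplus>\<^bsub>S\<^esub>A\<in>\<Theta>. c A \<odot>\<^bsub>S\<^esub> e_elt n r A) \<in> carrier S" using g by (intro S.finsum_closed) auto
    fix l m w assume lm: "l \<in> L" "m \<in> L" and w: "w permutes {1..r}"
    obtain B where B: "B \<in> \<Theta>" "ro B = l" "co B = m" "w \<in> double_coset r B"
      using double_coset_cover[OF lm w] by auto
    have "coord l m w (\<Oplus>\<^bsub>S\<^esub>A\<in>\<Theta>. c A \<odot>\<^bsub>S\<^esub> e_elt n r A)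
        = (\<Sum>A\<in>\<Theta>. c A * coord l m w (e_elt n r A))"
      using g lm cA e_elt_props
      by (subst coord_finsum[OF finite_Theta]) (auto intro!: sum.cong simp: coord_smult)
    also have "\<dots> = (\<Sum>A\<in>\<Theta>. if A = B then c B else 0)"
      using B double_coset_disjoint[OF _ B(1)] lm
      by (intro sum.cong) (auto simp: coord_e_elt)
    also have "\<dots> = coord l m w f" using B c by (simp add: finite_Theta)
    finally show "coord l m w f = coord l m w (\<Oplus>\<^bsub>S\<^esub>A\<in>\<Theta>. c A \<odot>\<^bsub>S\<^esub> e_elt n r A)" ..
  qed
  then show ?thesis using cA by blast
qed

subsection \<open>Weight idempotents\<close>

definition proj :: "nat vec \<Rightarrow> schur_elt" where
  "proj l = (\<lambda>m\<in>M. injM l (m l))"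

lemma proj_closed [simp]:
  assumes "l \<in> L"
  shows "proj l \<in> carrier S"
proof (rule S_intro)
  fix m m' assume "m \<in> M" "m' \<in> M"
  then show "proj l (addM m m') = addM (proj l m) (proj l m')"
    using assms by (intro M_eqI) (auto simp: proj_def M_app XH_add)
next
  fix m h assume "m \<in> M" "h \<in> carrier H"
  then show "proj l (actM m h) = actM (proj l m) h"
    using assms by (intro M_eqI) (auto simp: proj_def M_app XH_mult)
qed (use assms in \<open>auto simp: proj_def M_app\<close>)

lemma proj_orthogonal: "l \<in> L \<Longrightarrow> m \<in> L \<Longrightarrow> l \<noteq> m \<Longrightarrow> proj l \<otimes>\<^bsub>S\<^esub> proj m = \<zero>\<^bsub>S\<^esub>"
proof (rule S_eqI')
  fix k assume "l \<in> L" "m \<in> L" "l \<noteq> m" "k \<in> M"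
  then show "(proj l \<otimes>\<^bsub>S\<^esub> proj m) k = \<zero>\<^bsub>S\<^esub> k"
    by (intro M_eqI) (auto simp: proj_def M_app XH_zero)
qed simp_all

lemma coord_proj:
  assumes "l \<in> L" "m \<in> L" "f \<in> carrier S"
  shows "coord l m w (proj l \<otimes>\<^bsub>S\<^esub> f \<otimes>\<^bsub>S\<^esub> proj m) = coord l m w f"
proof -
  have "proj m (gen m) = gen m" using assms by (intro M_eqI) (auto simp: proj_def gen_def XH_X)
  then show ?thesis using assms by (simp add: coord_def) (simp add: proj_def)
qed

end

section \<open>Extension of scalars\<close>

lemma int_concrete: "concrete_ring \<Z>"
  by unfold_locales auto

context schur_algebra
begin

interpretation KK: cring KK
  by (rule concrete_ring.is_cring[OF KK_concrete])

lemma KK_simps [simp]: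
  "carrier KK = UNIV" "monoid.mult KK = (*)" "ring.add KK = (+)" "module.smult KK = (*)" "\<one>\<^bsub>KK\<^esub> = 1"
  by (simp_all add: KK_def)

lemma monoid_KK_S: "Group.monoid (KK \<times>\<times> S)"
  by (intro DirProd_monoid KK.monoid_axioms S_monoid)

sublocale tf: monoid_algebra_pairing \<Z> "KK \<times>\<times> S" "of_int :: int \<Rightarrow> ratfun"
  by (intro monoid_algebra_pairing.intro concrete_monoid_algebra.intro int_concrete monoid_KK_S)
     (unfold_locales, auto)

abbreviation "TF \<equiv> tensor_free KK S"
abbreviation "TI \<equiv> tensor_ideal AA KK S"
abbreviation "SK \<equiv> schur_K n r"
abbreviation "tgen b f \<equiv> single \<Z> (b :: ratfun, f :: schur_elt)"

lemma TF_eq: "monoid_algebra \<Z> (KK \<times>\<times> S) = TF"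
  by (simp add: tensor_free_def)

lemmas TF_facts =
  tf.ring_F tf.single_carrier tf.single_mult tf.one_F tf.pairing_single tf.pairing_add tf.pairing_minus
lemmas TF_rules = TF_facts[unfolded TF_eq]

sublocale TF: ring TF
  by (rule TF_rules)

lemma tgen_closed [simp]: "f \<in> carrier S \<Longrightarrow> tgen b f \<in> carrier TF"
  by (rule TF_rules(2)) simp

lemma tensor_rels_cases:
  assumes "s \<in> tensor_rels AA KK S"
  obtains (left) b b' f where "f \<in> carrier S" "s = tgen (b + b') f \<ominus>\<^bsub>TF\<^esub> (tgen b f \<oplus>\<^bsub>TF\<^esub> tgen b' f)"
  | (right) b f f' where "f \<in> carrier S" "f' \<in> carrier S"
      "s = tgen b (f \<oplus>\<^bsub>S\<^esub> f') \<ominus>\<^bsub>TF\<^esub> (tgen b f \<oplus>\<^bsub>TF\<^esub> tgen b f')"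
  | (balanced) a b f where "a \<in> carrier AA" "f \<in> carrier S"
      "s = tgen (a * b) f \<ominus>\<^bsub>TF\<^esub> tgen b (a \<odot>\<^bsub>S\<^esub> f)"
  using assms unfolding tensor_rels_def Let_def KK_simps by blast

lemma tensor_rels_carrier: "tensor_rels AA KK S \<subseteq> carrier TF"
proof
  fix s assume "s \<in> tensor_rels AA KK S"
  then show "s \<in> carrier TF"
    by (cases rule: tensor_rels_cases) auto
qed

sublocale TI: ideal TI TF
  unfolding tensor_ideal_def by (rule TF.genideal_ideal[OF tensor_rels_carrier])

lemma SK_simps:
  "carrier SK = carrier (TF Quot TI)" "monoid.mult SK = monoid.mult (TF Quot TI)"
  "ring.add SK = ring.add (TF Quot TI)" "ring.zero SK = ring.zero (TF Quot TI)"
  "b \<odot>\<^bsub>SK\<^esub> t = pure_tensor AA KK S b \<one>\<^bsub>S\<^esub> \<otimes>\<^bsub>SK\<^esub> t"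
  by (simp_all add: schur_K_def tensor_algebra_def Let_def ring.defs module.defs)

sublocale SK: ring SK
  using ring_extend[OF TI.quotient_is_ring] by (simp add: schur_K_def tensor_algebra_def Let_def)

definition tcls :: "(ratfun \<times> schur_elt \<Rightarrow> int) \<Rightarrow> (ratfun \<times> schur_elt \<Rightarrow> int) set" where
  "tcls z = TI +>\<^bsub>TF\<^esub> z"

abbreviation "pure \<equiv> pure_tensor AA KK S"

lemma pure_eq: "pure b f = tcls (tgen b f)"
  by (simp add: pure_tensor_def tcls_def)

lemma tcls_closed [simp]: "z \<in> carrier TF \<Longrightarrow> tcls z \<in> carrier SK"
  using ring_hom_closed[OF TI.rcos_ring_hom] by (simp add: tcls_def SK_simps)

lemma tcls_add: "z \<in> carrier TF \<Longrightarrow> y \<in> carrier TF \<Longrightarrow> tcls (z \<oplus>\<^bsub>TF\<^esub> y) = tcls z \<oplus>\<^bsub>SK\<^esub> tcls y"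
  using ring_hom_add[OF TI.rcos_ring_hom] by (simp add: tcls_def SK_simps)

lemma tcls_mult: "z \<in> carrier TF \<Longrightarrow> y \<in> carrier TF \<Longrightarrow> tcls (z \<otimes>\<^bsub>TF\<^esub> y) = tcls z \<otimes>\<^bsub>SK\<^esub> tcls y"
  using ring_hom_mult[OF TI.rcos_ring_hom] by (simp add: tcls_def SK_simps)

lemma tcls_eqI: "z \<in> carrier TF \<Longrightarrow> y \<in> carrier TF \<Longrightarrow> z \<ominus>\<^bsub>TF\<^esub> y \<in> tensor_rels AA KK S \<Longrightarrow> tcls z = tcls y"
  using TF.quotient_eq_iff_same_a_r_cos[OF TI.is_ideal, of z y] TF.genideal_self[OF tensor_rels_carrier]
  by (auto simp: tcls_def tensor_ideal_def)

lemma SK_cases: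
  assumes "t \<in> carrier SK"
  obtains z where "z \<in> carrier TF" "t = tcls z"
  using assms by (auto simp: SK_simps FactRing_def A_RCOSETS_def' tcls_def)

lemma pure_closed [simp]: "f \<in> carrier S \<Longrightarrow> pure b f \<in> carrier SK"
  by (simp add: pure_eq)

lemma pure_add_left: "f \<in> carrier S \<Longrightarrow> pure (b + b') f = pure b f \<oplus>\<^bsub>SK\<^esub> pure b' f"
proof -
  assume f: "f \<in> carrier S"
  have "tgen (b + b') f \<ominus>\<^bsub>TF\<^esub> (tgen b f \<oplus>\<^bsub>TF\<^esub> tgen b' f) \<in> tensor_rels AA KK S"
    unfolding tensor_rels_def Let_def KK_simps using f by blast
  from tcls_eqI[OF _ _ this] f show ?thesis by (simp add: pure_eq tcls_add)
qed

lemma pure_add_right: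
  "f \<in> carrier S \<Longrightarrow> f' \<in> carrier S \<Longrightarrow> pure b (f \<oplus>\<^bsub>S\<^esub> f') = pure b f \<oplus>\<^bsub>SK\<^esub> pure b f'"
proof -
  assume f: "f \<in> carrier S" "f' \<in> carrier S"
  have "tgen b (f \<oplus>\<^bsub>S\<^esub> f') \<ominus>\<^bsub>TF\<^esub> (tgen b f \<oplus>\<^bsub>TF\<^esub> tgen b f') \<in> tensor_rels AA KK S"
    unfolding tensor_rels_def Let_def KK_simps using f by blast
  from tcls_eqI[OF _ _ this] f show ?thesis by (simp add: pure_eq tcls_add)
qed

lemma pure_balanced:
  "a \<in> carrier AA \<Longrightarrow> f \<in> carrier S \<Longrightarrow> pure b (a \<odot>\<^bsub>S\<^esub> f) = pure (a * b) f"
proof -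
  assume f: "a \<in> carrier AA" "f \<in> carrier S"
  have "tgen (a * b) f \<ominus>\<^bsub>TF\<^esub> tgen b (a \<odot>\<^bsub>S\<^esub> f) \<in> tensor_rels AA KK S"
    unfolding tensor_rels_def Let_def KK_simps using f by blast
  from tcls_eqI[OF _ _ this] f show ?thesis by (simp add: pure_eq)
qed

lemma pure_mult:
  "f \<in> carrier S \<Longrightarrow> f' \<in> carrier S \<Longrightarrow> pure b f \<otimes>\<^bsub>SK\<^esub> pure b' f' = pure (b * b') (f \<otimes>\<^bsub>S\<^esub> f')"
  using TF_rules(3)[of "(b, f)" "(b', f')"] by (simp add: pure_eq flip: tcls_mult)

lemma pure_zero_left: "f \<in> carrier S \<Longrightarrow> pure 0 f = \<zero>\<^bsub>SK\<^esub>"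
  using pure_add_left[of f 0 0] by simp

lemma pure_zero_right: "pure b \<zero>\<^bsub>S\<^esub> = \<zero>\<^bsub>SK\<^esub>"
  using pure_add_right[of "\<zero>\<^bsub>S\<^esub>" "\<zero>\<^bsub>S\<^esub>" b] by simp

lemma smult_pure: "f \<in> carrier S \<Longrightarrow> b \<odot>\<^bsub>SK\<^esub> pure b' f = pure (b * b') f"
proof -
  assume f: "f \<in> carrier S"
  have "\<one>\<^bsub>S\<^esub> \<otimes>\<^bsub>S\<^esub> f = f" using Group.monoid.l_one[OF S_monoid f] .
  with f show ?thesis by (simp add: SK_simps(5) pure_mult)
qed

text \<open>
  Every tensor is a sum of pure tensors, since integer multiples of a pure tensor are pure.
\<close>

lemma SK_induct [consumes 1, case_names pure add]:
  assumes t: "t \<in> carrier SK"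
    and pure: "\<And>b f. f \<in> carrier S \<Longrightarrow> P (pure b f)"
    and add: "\<And>t u. t \<in> carrier SK \<Longrightarrow> u \<in> carrier SK \<Longrightarrow> P t \<Longrightarrow> P u \<Longrightarrow> P (t \<oplus>\<^bsub>SK\<^esub> u)"
  shows "P t"
proof -
  obtain z where z: "z \<in> carrier TF" and t: "t = tcls z" using assms(1) by (rule SK_cases)
  have smult_add: "(a + b) \<odot>\<^bsub>TF\<^esub> y = a \<odot>\<^bsub>TF\<^esub> y \<oplus>\<^bsub>TF\<^esub> b \<odot>\<^bsub>TF\<^esub> y" for a b y
    using tf.smult_F tf.add_F unfolding TF_eq by (simp add: distrib_right)
  have smult_closed: "a \<odot>\<^bsub>TF\<^esub> y \<in> carrier TF" if "y \<in> carrier TF" for a y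
    using tf.smult_carrier[of a y] that unfolding TF_eq by simp
  have smult_triv: "1 \<odot>\<^bsub>TF\<^esub> y = y" "0 \<odot>\<^bsub>TF\<^esub> y = \<zero>\<^bsub>TF\<^esub>" for y
    using tf.smult_F tf.zero_F unfolding TF_eq by simp_all
  have int_pure: "tcls (k \<odot>\<^bsub>TF\<^esub> tgen b f) = pure (of_int k * b) f" if f: "f \<in> carrier S" for k b f
  proof (induction k rule: int_induct[where k = 0])
    case base
    have "tcls \<zero>\<^bsub>TF\<^esub> = \<zero>\<^bsub>SK\<^esub>" using tcls_add[of "\<zero>\<^bsub>TF\<^esub>" "\<zero>\<^bsub>TF\<^esub>"] by simp
    then show ?case using f by (simp add: smult_triv pure_zero_left)
  next
    case (step1 i)
    then show ?case
      using f by (simp add: smult_add tcls_add smult_closed smult_triv distrib_right pure_add_left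
          flip: pure_eq)
  next
    case (step2 i)
    have "tcls ((i - 1) \<odot>\<^bsub>TF\<^esub> tgen b f) \<oplus>\<^bsub>SK\<^esub> tcls (tgen b f) = tcls (i \<odot>\<^bsub>TF\<^esub> tgen b f)"
      using f smult_add[of "i - 1" 1 "tgen b f"] by (simp add: smult_triv smult_closed flip: tcls_add)
    also have "\<dots> = pure (of_int (i - 1) * b) f \<oplus>\<^bsub>SK\<^esub> tcls (tgen b f)"
      using f pure_add_left[of f "of_int (i - 1) * b" b] by (simp add: step2 algebra_simps flip: pure_eq)
    finally show ?case using f by (simp add: smult_closed)
  qed
  have "P (tcls z)"
    using z[folded TF_eq]
  proof (induction z rule: tf.F_induct)
    case (single a m)
    then show ?case using int_pure[of "snd m" a "fst m"] pure by (cases m) (simp add: TF_eq)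
  next
    case (add y z)
    then show ?case by (simp add: TF_eq tcls_add assms(3))
  qed
  then show ?thesis by (simp add: t)
qed

definition coord_fun :: "nat vec \<Rightarrow> nat vec \<Rightarrow> (nat \<Rightarrow> nat) \<Rightarrow> ratfun \<times> schur_elt \<Rightarrow> ratfun" where
  "coord_fun l m w = (\<lambda>(b, f). b * coord l m w f)"

definition coordK :: "nat vec \<Rightarrow> nat vec \<Rightarrow> (nat \<Rightarrow> nat) \<Rightarrow> (ratfun \<times> schur_elt \<Rightarrow> int) set \<Rightarrow> ratfun" where
  "coordK l m w t = tf.coset_pairing t (coord_fun l m w)"

text \<open>
  A translate of a defining relation by pure tensors is a relation of the same kind, and coordinates
  are bilinear and balanced.
\<close>

lemma coord_fun_rels:
  assumes lm: "l \<in> L" "m \<in> L" and s: "s \<in> tensor_rels AA KK S"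
    and u: "u \<in> carrier (KK \<times>\<times> S)" and v: "v \<in> carrier (KK \<times>\<times> S)"
  shows "pairing of_int s (\<lambda>p. coord_fun l m w (u \<otimes>\<^bsub>KK \<times>\<times> S\<^esub> p \<otimes>\<^bsub>KK \<times>\<times> S\<^esub> v)) = 0"
proof -
  obtain u1 u2 v1 v2 where uv: "u = (u1, u2)" "v = (v1, v2)" "u2 \<in> carrier S" "v2 \<in> carrier S"
    using u v by (cases u; cases v) auto
  show ?thesis
    using s
  proof (cases rule: tensor_rels_cases)
    case (left b b' f)
    then show ?thesis
      using uv by (simp add: TF_rules coord_fun_def algebra_simps)
  next
    case (right b f f')
    then show ?thesis
      using uv lm by (simp add: TF_rules coord_fun_def S_distr coord_add algebra_simps)
  next
    case (balanced a b f)
    then show ?thesis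
      using uv lm by (simp add: TF_rules coord_fun_def S_smult_mult coord_smult algebra_simps)
  qed
qed

lemma coordK_tcls:
  assumes lm: "l \<in> L" "m \<in> L" and z: "z \<in> carrier TF"
  shows "coordK l m w (tcls z) = pairing of_int z (coord_fun l m w)"
proof -
  have "pairing of_int z (coord_fun l m w) = 0" if "z \<in> TI" for z
    using tf.pairing_genideal[of "tensor_rels AA KK S" "coord_fun l m w" z] coord_fun_rels[OF lm]
      tensor_rels_carrier that unfolding TF_eq tensor_ideal_def by blast
  then show ?thesis
    using tf.coset_pairing[of TI "coord_fun l m w" z] TI.is_ideal z
    unfolding TF_eq coordK_def tcls_def by blast
qed

lemma coordK_pure:
  "l \<in> L \<Longrightarrow> m \<in> L \<Longrightarrow> f \<in> carrier S \<Longrightarrow> coordK l m w (pure b f) = b * coord l m w f"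
  by (simp add: pure_eq coordK_tcls TF_rules coord_fun_def)

lemma coordK_add:
  assumes "l \<in> L" "m \<in> L" "t \<in> carrier SK" "u \<in> carrier SK"
  shows "coordK l m w (t \<oplus>\<^bsub>SK\<^esub> u) = coordK l m w t + coordK l m w u"
proof -
  obtain y z where "y \<in> carrier TF" "t = tcls y" "z \<in> carrier TF" "u = tcls z"
    using assms SK_cases by metis
  then show ?thesis using assms(1,2) by (simp add: coordK_tcls TF_rules flip: tcls_add)
qed

lemma coordK_zero: "l \<in> L \<Longrightarrow> m \<in> L \<Longrightarrow> coordK l m w \<zero>\<^bsub>SK\<^esub> = 0"
  using coordK_add[of l m "\<zero>\<^bsub>SK\<^esub>" "\<zero>\<^bsub>SK\<^esub>" w] by simp

lemma coordK_finsum: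
  "finite K \<Longrightarrow> h \<in> K \<rightarrow> carrier SK \<Longrightarrow> l \<in> L \<Longrightarrow> m \<in> L \<Longrightarrow>
    coordK l m w (finsum SK h K) = (\<Sum>k\<in>K. coordK l m w (h k))"
  by (induction K rule: finite_induct) (auto simp: coordK_zero coordK_add)

subsection \<open>The normalised basis\<close>

abbreviation "blmK \<equiv> blm_K n r"

lemma inverse_upsilon_power: "inverse upsilon ^ k \<in> carrier AA" "upsilon ^ k \<in> carrier AA"
  by (intro hf.power_mem upsilon_AA)+

lemma blm_closed [simp]: "A \<in> \<Theta> \<Longrightarrow> blm n r A \<in> carrier S"
  by (simp add: blm_def e_elt_props inverse_upsilon_power)

lemma e_elt_eq_blm: "A \<in> \<Theta> \<Longrightarrow> e_elt n r A = upsilon ^ d_exp A \<odot>\<^bsub>S\<^esub> blm n r A"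
proof -
  assume A: "A \<in> \<Theta>"
  have "upsilon ^ d_exp A * inverse upsilon ^ d_exp A = 1"
    using upsilon_nonzero by (simp add: power_mult_distrib[symmetric])
  then show ?thesis
    using S_smult_assoc[OF inverse_upsilon_power(2,1) e_elt_props(1)[OF A], of "d_exp A" "d_exp A"]
    by (simp add: blm_def S_smult_one e_elt_props A)
qed

lemma smult_blmK: "A \<in> \<Theta> \<Longrightarrow> b \<odot>\<^bsub>SK\<^esub> blmK A = pure b (blm n r A)"
  by (simp add: blm_K_def smult_pure)

lemma smult_blmK_closed [simp]: "A \<in> \<Theta> \<Longrightarrow> b \<odot>\<^bsub>SK\<^esub> blmK A \<in> carrier SK"
  by (simp add: smult_blmK)

lemma coordK_lincomb:
  assumes B: "B \<in> \<Theta>" and w: "w \<in> double_coset r B"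
  shows "coordK (ro B) (co B) w (\<Oplus>\<^bsub>SK\<^esub>A\<in>\<Theta>. x A \<odot>\<^bsub>SK\<^esub> blmK A) = x B * inverse upsilon ^ d_exp B"
proof -
  note l = ro_co_Lambda[OF B]
  have "coordK (ro B) (co B) w (\<Oplus>\<^bsub>SK\<^esub>A\<in>\<Theta>. x A \<odot>\<^bsub>SK\<^esub> blmK A)
      = (\<Sum>A\<in>\<Theta>. coordK (ro B) (co B) w (x A \<odot>\<^bsub>SK\<^esub> blmK A))"
    by (intro coordK_finsum finite_Theta l) simp
  also have "\<dots> = (\<Sum>A\<in>\<Theta>. if A = B then x B * inverse upsilon ^ d_exp B else 0)"
  proof (intro sum.cong refl)
    fix A assume A: "A \<in> \<Theta>"
    have "coordK (ro B) (co B) w (x A \<odot>\<^bsub>SK\<^esub> blmK A)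
        = x A * (inverse upsilon ^ d_exp A * coord (ro B) (co B) w (e_elt n r A))"
      using A l by (simp add: smult_blmK coordK_pure) (simp add: blm_def coord_smult inverse_upsilon_power e_elt_props)
    also have "\<dots> = (if A = B then x B * inverse upsilon ^ d_exp B else 0)"
      using double_coset_disjoint[OF A B _ _ _ w] w by (auto simp: coord_e_elt[OF A l])
    finally show "coordK (ro B) (co B) w (x A \<odot>\<^bsub>SK\<^esub> blmK A)
        = (if A = B then x B * inverse upsilon ^ d_exp B else 0)" .
  qed
  also have "\<dots> = x B * inverse upsilon ^ d_exp B" using B by (simp add: finite_Theta)
  finally show ?thesis .
qed

text \<open>
  Coefficients from \<open>\<int>[\<upsilon>, \<upsilon>\<^sup>-\<^sup>1]\<close>, including the normalising power of \<open>\<upsilon>\<close>, move across the tensor sign.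
\<close>

lemma SK_spanned:
  assumes "t \<in> carrier SK"
  shows "\<exists>x. t = (\<Oplus>\<^bsub>SK\<^esub>A\<in>\<Theta>. x A \<odot>\<^bsub>SK\<^esub> blmK A)"
  using assms
proof (induction t rule: SK_induct)
  case (pure b f)
  obtain c where c: "\<And>A. A \<in> \<Theta> \<Longrightarrow> c A \<in> carrier AA" "f = (\<Oplus>\<^bsub>S\<^esub>A\<in>\<Theta>. c A \<odot>\<^bsub>S\<^esub> e_elt n r A)"
    using S_spanned[OF pure] by auto
  have term_closed: "c A \<odot>\<^bsub>S\<^esub> e_elt n r A \<in> carrier S" if "A \<in> \<Theta>" for A
    using that c(1) e_elt_props by simp
  have "finite K \<Longrightarrow> K \<subseteq> \<Theta> \<Longrightarrow> pure b (\<Oplus>\<^bsub>S\<^esub>A\<in>K. c A \<odot>\<^bsub>S\<^esub> e_elt n r A)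
      = (\<Oplus>\<^bsub>SK\<^esub>A\<in>K. pure b (c A \<odot>\<^bsub>S\<^esub> e_elt n r A))" for K
  proof (induction K rule: finite_induct)
    case (insert A K)
    then have "(\<lambda>A. c A \<odot>\<^bsub>S\<^esub> e_elt n r A) \<in> K \<rightarrow> carrier S" "c A \<odot>\<^bsub>S\<^esub> e_elt n r A \<in> carrier S"
      using term_closed by auto
    with insert show ?case by (simp add: pure_add_right S.finsum_closed Pi_iff)
  qed (simp add: pure_zero_right)
  from this[OF finite_Theta] have "pure b f = (\<Oplus>\<^bsub>SK\<^esub>A\<in>\<Theta>. pure b (c A \<odot>\<^bsub>S\<^esub> e_elt n r A))"
    by (simp add: c(2))
  also have "\<dots> = (\<Oplus>\<^bsub>SK\<^esub>A\<in>\<Theta>. (upsilon ^ d_exp A * (c A * b)) \<odot>\<^bsub>SK\<^esub> blmK A)"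
  proof (rule SK.finsum_cong')
    fix A assume A: "A \<in> \<Theta>"
    have "pure b (c A \<odot>\<^bsub>S\<^esub> e_elt n r A) = pure (c A * b) (e_elt n r A)"
      by (rule pure_balanced[OF c(1)[OF A] e_elt_props(1)[OF A]])
    also have "\<dots> = pure (upsilon ^ d_exp A * (c A * b)) (blm n r A)"
      unfolding e_elt_eq_blm[OF A] by (intro pure_balanced inverse_upsilon_power blm_closed A)
    finally show "pure b (c A \<odot>\<^bsub>S\<^esub> e_elt n r A) = (upsilon ^ d_exp A * (c A * b)) \<odot>\<^bsub>SK\<^esub> blmK A"
      by (simp only: smult_blmK[OF A])
  qed auto
  finally show ?case by (intro exI[of _ "\<lambda>A. upsilon ^ d_exp A * (c A * b)"])
next
  case (add t u)
  then obtain x y where xy: "t = (\<Oplus>\<^bsub>SK\<^esub>A\<in>\<Theta>. x A \<odot>\<^bsub>SK\<^esub> blmK A)" "u = (\<Oplus>\<^bsub>SK\<^esub>A\<in>\<Theta>. y A \<odot>\<^bsub>SK\<^esub> blmK A)"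
    by blast
  have "t \<oplus>\<^bsub>SK\<^esub> u = (\<Oplus>\<^bsub>SK\<^esub>A\<in>\<Theta>. x A \<odot>\<^bsub>SK\<^esub> blmK A \<oplus>\<^bsub>SK\<^esub> y A \<odot>\<^bsub>SK\<^esub> blmK A)"
    unfolding xy by (intro SK.finsum_addf[symmetric]) auto
  also have "\<dots> = (\<Oplus>\<^bsub>SK\<^esub>A\<in>\<Theta>. (x A + y A) \<odot>\<^bsub>SK\<^esub> blmK A)"
    by (intro SK.finsum_cong') (auto simp: smult_blmK pure_add_left)
  finally show ?case by (intro exI[of _ "\<lambda>A. x A + y A"])
qed

lemma coordK_proj:
  assumes lm: "l \<in> L" "m \<in> L" and t: "t \<in> carrier SK"
  shows "coordK l m w (pure 1 (proj l) \<otimes>\<^bsub>SK\<^esub> t \<otimes>\<^bsub>SK\<^esub> pure 1 (proj m)) = coordK l m w t"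
  using t
proof (induction t rule: SK_induct)
  case (pure b f)
  then show ?case using lm by (simp add: pure_mult coordK_pure coord_proj)
next
  case (add t u)
  then show ?case using lm by (simp add: SK.r_distr SK.l_distr coordK_add)
qed

text \<open>
  A coordinate with indices \<open>l\<close> and \<open>m\<close> sees only \<open>1\<^sub>l c 1\<^sub>m\<close>, which equals \<open>c 1\<^sub>l 1\<^sub>m = 0\<close>.
\<close>

lemma center_coordK:
  assumes c: "c \<in> ring_center SK" and lm: "l \<in> L" "m \<in> L" "l \<noteq> m"
  shows "coordK l m w c = 0"
proof -
  have cS: "c \<in> carrier SK" and comm: "c \<otimes>\<^bsub>SK\<^esub> pure 1 (proj l) = pure 1 (proj l) \<otimes>\<^bsub>SK\<^esub> c"
    using c lm by (auto simp: ring_center_def)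
  have "pure 1 (proj l) \<otimes>\<^bsub>SK\<^esub> c \<otimes>\<^bsub>SK\<^esub> pure 1 (proj m)
      = c \<otimes>\<^bsub>SK\<^esub> (pure 1 (proj l) \<otimes>\<^bsub>SK\<^esub> pure 1 (proj m))"
    using cS lm by (simp add: comm[symmetric] SK.m_assoc)
  also have "\<dots> = \<zero>\<^bsub>SK\<^esub>"
    using cS lm by (simp add: pure_mult proj_orthogonal pure_zero_right)
  finally show ?thesis using coordK_proj[OF lm(1,2) cS, of w] lm by (simp add: coordK_zero)
qed

theorem center_unbalanced_zero:
  assumes c: "c \<in> ring_center SK" "c = (\<Oplus>\<^bsub>SK\<^esub>A\<in>\<Theta>. x A \<odot>\<^bsub>SK\<^esub> blmK A)"
    and A: "A \<in> \<Theta>" "A \<notin> Omega n r"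
  shows "x A = 0"
proof -
  have ne: "ro A \<noteq> co A" using A by (simp add: Omega_def)
  obtain w where w: "w \<in> double_coset r A" using double_coset_nonempty[OF A(1)] by auto
  have "x A * inverse upsilon ^ d_exp A = 0"
    using center_coordK[OF c(1) ro_co_Lambda[OF A(1)] ne, of w]
    unfolding c(2) coordK_lincomb[OF A(1) w] .
  then show ?thesis using upsilon_nonzero by simp
qed

text \<open>
  Linear spans are formed over sets of elements, so the coefficients must be reindexed from matrices to
  basis elements.
\<close>

lemma blmK_inj: "inj_on blmK \<Theta>"
proof
  fix A B assume A: "A \<in> \<Theta>" and B: "B \<in> \<Theta>" and eq: "blmK A = blmK B"
  obtain w where w: "w \<in> double_coset r A" using double_coset_nonempty[OF A] by auto
  note l = ro_co_Lambda[OF A]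
  have "coordK (ro A) (co A) w (blmK C)
      = inverse upsilon ^ d_exp C * (if ro C = ro A \<and> co C = co A \<and> w \<in> double_coset r C then 1 else 0)"
    if "C \<in> \<Theta>" for C
    using that l by (simp add: blm_K_def coordK_pure)
      (simp add: blm_def coord_smult inverse_upsilon_power e_elt_props coord_e_elt)
  from this[OF A] this[OF B] eq have "ro B = ro A \<and> co B = co A \<and> w \<in> double_coset r B"
    using w upsilon_nonzero by (auto split: if_splits)
  then show "A = B" using double_coset_disjoint[OF A B _ _ w] by simp
qed

theorem center_subset_span: "ring_center SK \<subseteq> lin_span KK SK (blmK ` Omega n r)"
proof
  fix c assume c: "c \<in> ring_center SK"
  then have "c \<in> carrier SK" by (simp add: ring_center_def)
  then obtain x where x: "c = (\<Oplus>\<^bsub>SK\<^esub>A\<in>\<Theta>. x A \<odot>\<^bsub>SK\<^esub> blmK A)" using SK_spanned by blast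
  have sub: "Omega n r \<subseteq> \<Theta>" by (auto simp: Omega_def)
  have inj: "inj_on blmK (Omega n r)" by (rule inj_on_subset[OF blmK_inj sub])
  have fin: "finite (Omega n r)" by (rule finite_subset[OF sub finite_Theta])
  have "0 \<odot>\<^bsub>SK\<^esub> blmK A = \<zero>\<^bsub>SK\<^esub>" if "A \<in> \<Theta>" for A
    using that by (simp add: smult_blmK pure_zero_left)
  then have "c = (\<Oplus>\<^bsub>SK\<^esub>A\<in>Omega n r. x A \<odot>\<^bsub>SK\<^esub> blmK A)"
    unfolding x using center_unbalanced_zero[OF c x] sub
    by (intro SK.add.finprod_mono_neutral_cong_left[symmetric, folded finsum_def] finite_Theta) auto
  also have "\<dots> = (\<Oplus>\<^bsub>SK\<^esub>A\<in>Omega n r. x (inv_into (Omega n r) blmK (blmK A)) \<odot>\<^bsub>SK\<^esub> blmK A)"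
    using inj sub by (intro SK.finsum_cong') auto
  also have "\<dots> = (\<Oplus>\<^bsub>SK\<^esub>b\<in>blmK ` Omega n r. x (inv_into (Omega n r) blmK b) \<odot>\<^bsub>SK\<^esub> b)"
    using inj sub by (intro SK.finsum_reindex[symmetric]) auto
  finally have c_eq:
    "c = (\<Oplus>\<^bsub>SK\<^esub>b\<in>blmK ` Omega n r. x (inv_into (Omega n r) blmK b) \<odot>\<^bsub>SK\<^esub> b)" .
  have "finite (blmK ` Omega n r) \<and> blmK ` Omega n r \<subseteq> blmK ` Omega n r \<and>
      (\<lambda>b. x (inv_into (Omega n r) blmK b)) \<in> blmK ` Omega n r \<rightarrow> carrier KK"
    using fin by simp
  with c_eq show "c \<in> lin_span KK SK (blmK ` Omega n r)"
    unfolding lin_span_def mem_Collect_eq by (intro exI conjI; (assumption | blast))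
qed

end

theorem lemma2p4:
  fixes n r :: nat
  shows "(\<forall>c x. c \<in> ring_center (schur_K n r) \<longrightarrow>
            c = (\<Oplus>\<^bsub>schur_K n r\<^esub>A \<in> Theta n r. x A \<odot>\<^bsub>schur_K n r\<^esub> blm_K n r A) \<longrightarrow>
            (\<forall>A \<in> Theta n r. A \<notin> Omega n r \<longrightarrow> x A = 0)) \<and>
         ring_center (schur_K n r) \<subseteq> lin_span KK (schur_K n r) (blm_K n r ` Omega n r)"
  using schur_algebra.center_unbalanced_zero schur_algebra.center_subset_span by blast

end
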